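(* Let $G$ be a residually torsion-free nilpotent group. Then $G$ is faithful over every integral domain $A$ of characteristic $0$. In particular, free groups, free solvable groups and free polynilpotent groups are faithful over every integral domain of characteristic $0$.
   Context: Let $A$ be an associative ring with identity. An $A$-group is a group $G$ with a map $G\times A\to G$, $(g,\alpha)\mapsto g^\alpha$, such that for all $g,h\in G$, $\alpha,\beta\in A$: (1) $g^1=g$, $g^0=1$, $1^\alpha=1$; (2) $g^{\alpha+\beta}=g^\alpha g^\beta$, $g^{\alpha\beta}=(g^\alpha)^\beta$; (3) $(h^{-1}gh)^\alpha=h^{-1}g^\alpha h$; (4) $[g,h]=1$ implies $(gh)^\alpha=g^\alpha h^\alpha$. An $A$-homomorphism is a group homomorphism $f$ with $f(g^\alpha)=f(g)^\alpha$. For a group $G$ and a ring $A\ge\mathbf{Z}$, a tensor $A$-completion of $G$ is an $A$-group $G^A$ with a group homomorphism $\lambda:G\to G^A$ such that $\lambda(G)$ generates $G^A$ as an $A$-group and for every $A$-group $H$ and group homomorphism $\varphi:G\to H$ there is a unique $A$-homomorphism $\psi:G^A\to H$ with $\psi\circ\lambda=\varphi$. It exists and is unique up to $A$-isomorphism. $G$ is called faithful over $A$ if $\lambda:G\to G^A$ is injective. $G$ is residually torsion-free nilpotent if for every $1\ne g\in G$ there is a homomorphism from $G$ to a torsion-free nilpotent group not killing $g$. *)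

theory Defs
  imports "HOL-Algebra.Generated_Groups"
begin

section \<open>A-groups\<close>

text \<open>
  The exponent ring \<open>A\<close> is a type \<open>'r\<close> of class \<^class>\<open>ring_1\<close>; groups are HOL-Algebra groups.
\<close>

definition commutator :: "('g, 'm) monoid_scheme \<Rightarrow> 'g \<Rightarrow> 'g \<Rightarrow> 'g" where
  "commutator G x y = x \<otimes>\<^bsub>G\<^esub> y \<otimes>\<^bsub>G\<^esub> inv\<^bsub>G\<^esub> x \<otimes>\<^bsub>G\<^esub> inv\<^bsub>G\<^esub> y"

lemma (in group) commutator_eq_one_iff:
  assumes "x \<in> carrier G" "y \<in> carrier G"
  shows "commutator G x y = \<one> \<longleftrightarrow> x \<otimes> y = y \<otimes> x"
proof -
  have "commutator G x y = (x \<otimes> y) \<otimes> inv (y \<otimes> x)"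
    using assms by (simp add: commutator_def inv_mult_group m_assoc)
  then show ?thesis
    using assms by (simp add: inv_solve_right')
qed

record ('g, 'r) agroup = "'g monoid" +
  apow :: "'g \<Rightarrow> 'r \<Rightarrow> 'g" (infixl \<open>\<up>\<index>\<close> 75)

locale A_group = group H for H :: "('g, 'r::ring_1) agroup" (structure) +
  assumes apow_closed: "g \<in> carrier H \<Longrightarrow> g \<up> \<alpha> \<in> carrier H"
    and apow_one: "g \<in> carrier H \<Longrightarrow> g \<up> 1 = g"
    and apow_zero: "g \<in> carrier H \<Longrightarrow> g \<up> 0 = \<one>"
    and one_apow: "\<one> \<up> \<alpha> = \<one>"
    and apow_add: "g \<in> carrier H \<Longrightarrow> g \<up> (\<alpha> + \<beta>) = g \<up> \<alpha> \<otimes> g \<up> \<beta>"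
    and apow_mult: "g \<in> carrier H \<Longrightarrow> g \<up> (\<alpha> * \<beta>) = (g \<up> \<alpha>) \<up> \<beta>"
    and apow_conj: "\<lbrakk>g \<in> carrier H; h \<in> carrier H\<rbrakk>
                      \<Longrightarrow> (inv h \<otimes> g \<otimes> h) \<up> \<alpha> = inv h \<otimes> g \<up> \<alpha> \<otimes> h"
    and apow_comm: "\<lbrakk>g \<in> carrier H; h \<in> carrier H; commutator H g h = \<one>\<rbrakk>
                      \<Longrightarrow> (g \<otimes> h) \<up> \<alpha> = g \<up> \<alpha> \<otimes> h \<up> \<alpha>"

definition A_hom :: "('g, 'r) agroup \<Rightarrow> ('h, 'r) agroup \<Rightarrow> ('g \<Rightarrow> 'h) set" where
  "A_hom G H = {f \<in> hom G H. \<forall>g\<in>carrier G. \<forall>\<alpha>. f (g \<up>\<^bsub>G\<^esub> \<alpha>) = f g \<up>\<^bsub>H\<^esub> \<alpha>}"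

inductive_set A_generate :: "('g, 'r) agroup \<Rightarrow> 'g set \<Rightarrow> 'g set"
  for H S where
    one: "\<one>\<^bsub>H\<^esub> \<in> A_generate H S"
  | incl: "x \<in> S \<Longrightarrow> x \<in> A_generate H S"
  | mult: "\<lbrakk>x \<in> A_generate H S; y \<in> A_generate H S\<rbrakk> \<Longrightarrow> x \<otimes>\<^bsub>H\<^esub> y \<in> A_generate H S"
  | inv: "x \<in> A_generate H S \<Longrightarrow> inv\<^bsub>H\<^esub> x \<in> A_generate H S"
  | pow: "x \<in> A_generate H S \<Longrightarrow> x \<up>\<^bsub>H\<^esub> \<alpha> \<in> A_generate H S"


section \<open>Tensor completions and faithfulness\<close>

text \<open>
  HOL cannot quantify over types inside a formula, so the universal property is tested against the
  \<open>A\<close>-groups with elements in a given type \<open>'h\<close>.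
\<close>

definition is_tensor_completion ::
  "'h itself \<Rightarrow> ('g, 'm) monoid_scheme \<Rightarrow> ('c, 'r::ring_1) agroup \<Rightarrow> ('g \<Rightarrow> 'c) \<Rightarrow> bool" where
  "is_tensor_completion _ G GA l \<longleftrightarrow>
     A_group GA \<and> l \<in> hom G GA \<and> A_generate GA (l ` carrier G) = carrier GA \<and>
     (\<forall>(H :: ('h, 'r) agroup) \<phi>. A_group H \<and> \<phi> \<in> hom G H \<longrightarrow>
        (\<exists>\<psi>\<in>A_hom GA H. (\<forall>g\<in>carrier G. \<psi> (l g) = \<phi> g) \<and>
           (\<forall>\<psi>'\<in>A_hom GA H. (\<forall>g\<in>carrier G. \<psi>' (l g) = \<phi> g) \<longrightarrow> (\<forall>x\<in>carrier GA. \<psi>' x = \<psi> x))))"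

text \<open>
  The tensor completion is realised as the set of \<open>A\<close>-group terms over \<open>G\<close> modulo the least
  congruence that enforces the axioms and the multiplication table of \<open>G\<close>. Its universal property
  holds for test groups of every type (\<open>tensor_completion_universal\<close>).
\<close>

datatype (gens: 'g, 'r) aterm =
    Gen 'g
  | TOne
  | TMult "('g, 'r) aterm" "('g, 'r) aterm"
  | TInv "('g, 'r) aterm"
  | TPow "('g, 'r) aterm" 'r

inductive aterm_eq :: "('g, 'm) monoid_scheme \<Rightarrow> ('g, 'r::ring_1) aterm \<Rightarrow> ('g, 'r) aterm \<Rightarrow> bool"
  for G where
    refl: "gens t \<subseteq> carrier G \<Longrightarrow> aterm_eq G t t"
  | sym: "aterm_eq G t u \<Longrightarrow> aterm_eq G u t"
  | trans: "\<lbrakk>aterm_eq G t u; aterm_eq G u v\<rbrakk> \<Longrightarrow> aterm_eq G t v"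
  | cong_mult: "\<lbrakk>aterm_eq G t t'; aterm_eq G u u'\<rbrakk> \<Longrightarrow> aterm_eq G (TMult t u) (TMult t' u')"
  | cong_inv: "aterm_eq G t t' \<Longrightarrow> aterm_eq G (TInv t) (TInv t')"
  | cong_pow: "aterm_eq G t t' \<Longrightarrow> aterm_eq G (TPow t \<alpha>) (TPow t' \<alpha>)"
  | gen_mult: "\<lbrakk>x \<in> carrier G; y \<in> carrier G\<rbrakk>
      \<Longrightarrow> aterm_eq G (Gen (x \<otimes>\<^bsub>G\<^esub> y)) (TMult (Gen x) (Gen y))"
  | assoc: "\<lbrakk>gens t \<subseteq> carrier G; gens u \<subseteq> carrier G; gens v \<subseteq> carrier G\<rbrakk>
      \<Longrightarrow> aterm_eq G (TMult (TMult t u) v) (TMult t (TMult u v))"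
  | l_one: "gens t \<subseteq> carrier G \<Longrightarrow> aterm_eq G (TMult TOne t) t"
  | l_inv: "gens t \<subseteq> carrier G \<Longrightarrow> aterm_eq G (TMult (TInv t) t) TOne"
  | pow_one: "gens t \<subseteq> carrier G \<Longrightarrow> aterm_eq G (TPow t 1) t"
  | pow_zero: "gens t \<subseteq> carrier G \<Longrightarrow> aterm_eq G (TPow t 0) TOne"
  | one_pow: "aterm_eq G (TPow TOne \<alpha>) TOne"
  | pow_add: "gens t \<subseteq> carrier G
      \<Longrightarrow> aterm_eq G (TPow t (\<alpha> + \<beta>)) (TMult (TPow t \<alpha>) (TPow t \<beta>))"
  | pow_mult: "gens t \<subseteq> carrier G \<Longrightarrow> aterm_eq G (TPow t (\<alpha> * \<beta>)) (TPow (TPow t \<alpha>) \<beta>)"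
  | pow_conj: "\<lbrakk>gens t \<subseteq> carrier G; gens u \<subseteq> carrier G\<rbrakk>
      \<Longrightarrow> aterm_eq G (TPow (TMult (TMult (TInv u) t) u) \<alpha>) (TMult (TMult (TInv u) (TPow t \<alpha>)) u)"
  | pow_comm: "aterm_eq G (TMult t u) (TMult u t)
      \<Longrightarrow> aterm_eq G (TPow (TMult t u) \<alpha>) (TMult (TPow t \<alpha>) (TPow u \<alpha>))"

definition aterm_class ::
  "('g, 'm) monoid_scheme \<Rightarrow> ('g, 'r::ring_1) aterm \<Rightarrow> ('g, 'r) aterm set" where
  "aterm_class G t = {u. aterm_eq G t u}"

definition tensor_completion ::
  "('g, 'm) monoid_scheme \<Rightarrow> (('g, 'r::ring_1) aterm set, 'r) agroup" where
  "tensor_completion G =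
     \<lparr>carrier = aterm_class G ` {t. gens t \<subseteq> carrier G},
      mult = (\<lambda>X Y. aterm_class G (TMult (SOME t. t \<in> X) (SOME u. u \<in> Y))),
      one = aterm_class G TOne,
      apow = (\<lambda>X \<alpha>. aterm_class G (TPow (SOME t. t \<in> X) \<alpha>))\<rparr>"

definition completion_map :: "('g, 'm) monoid_scheme \<Rightarrow> 'g \<Rightarrow> ('g, 'r::ring_1) aterm set" where
  "completion_map G g = aterm_class G (Gen g)"

definition faithful_over :: "'r::ring_1 itself \<Rightarrow> ('g, 'm) monoid_scheme \<Rightarrow> bool" where
  "faithful_over _ G \<longleftrightarrow> inj_on (completion_map G :: 'g \<Rightarrow> ('g, 'r) aterm set) (carrier G)"

lemma aterm_eq_gens:
  assumes "group G" "aterm_eq G t u"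
  shows "gens t \<subseteq> carrier G \<and> gens u \<subseteq> carrier G"
  using assms(2) by induction (auto simp: group.is_monoid[OF assms(1)] monoid.m_closed)

lemma aterm_class_eq_iff:
  assumes "gens u \<subseteq> carrier G"
  shows "aterm_class G t = aterm_class G u \<longleftrightarrow> aterm_eq G t u"
  unfolding aterm_class_def using assms
  by (auto intro: aterm_eq.refl aterm_eq.sym aterm_eq.trans)

lemma some_aterm_class:
  assumes "gens t \<subseteq> carrier G"
  shows "aterm_eq G t (SOME u. u \<in> aterm_class G t)"
  using someI[of "\<lambda>u. u \<in> aterm_class G t" t] assms
  by (simp add: aterm_class_def aterm_eq.refl)

lemma tensor_completion_carrier:
  "carrier (tensor_completion G) = aterm_class G ` {t. gens t \<subseteq> carrier G}"
  by (simp add: tensor_completion_def)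

lemma tensor_completion_one: "\<one>\<^bsub>tensor_completion G\<^esub> = aterm_class G TOne"
  by (simp add: tensor_completion_def)

lemma tensor_completion_mult:
  assumes "group G" "gens t \<subseteq> carrier G" "gens u \<subseteq> carrier G"
  shows "aterm_class G t \<otimes>\<^bsub>tensor_completion G\<^esub> aterm_class G u = aterm_class G (TMult t u)"
proof -
  have "aterm_eq G (TMult (SOME v. v \<in> aterm_class G t) (SOME v. v \<in> aterm_class G u)) (TMult t u)"
    using assms by (intro aterm_eq.cong_mult aterm_eq.sym[OF some_aterm_class]) auto
  then show ?thesis
    using assms by (simp add: tensor_completion_def aterm_class_eq_iff)
qed

lemma tensor_completion_apow:
  assumes "group G" "gens t \<subseteq> carrier G"
  shows "aterm_class G t \<up>\<^bsub>tensor_completion G\<^esub> \<alpha> = aterm_class G (TPow t \<alpha>)"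
proof -
  have "aterm_eq G (TPow (SOME v. v \<in> aterm_class G t) \<alpha>) (TPow t \<alpha>)"
    using assms by (intro aterm_eq.cong_pow aterm_eq.sym[OF some_aterm_class]) auto
  then show ?thesis
    using assms by (simp add: tensor_completion_def aterm_class_eq_iff)
qed

lemma group_tensor_completion:
  fixes G :: "('g, 'm) monoid_scheme"
  assumes "group G"
  shows "group (tensor_completion G :: (('g, 'r::ring_1) aterm set, 'r) agroup)"
    (is "group ?T")
proof (rule groupI)
  fix X Y assume "X \<in> carrier ?T" "Y \<in> carrier ?T"
  then show "X \<otimes>\<^bsub>?T\<^esub> Y \<in> carrier ?T"
    by (auto simp: tensor_completion_carrier tensor_completion_mult[OF assms])
next
  show "\<one>\<^bsub>?T\<^esub> \<in> carrier ?T"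
    by (auto simp: tensor_completion_carrier tensor_completion_one)
next
  fix X Y Z assume "X \<in> carrier ?T" "Y \<in> carrier ?T" "Z \<in> carrier ?T"
  then show "X \<otimes>\<^bsub>?T\<^esub> Y \<otimes>\<^bsub>?T\<^esub> Z = X \<otimes>\<^bsub>?T\<^esub> (Y \<otimes>\<^bsub>?T\<^esub> Z)"
    by (clarsimp simp: tensor_completion_carrier tensor_completion_mult[OF assms])
      (simp add: aterm_class_eq_iff aterm_eq.assoc)
next
  fix X assume "X \<in> carrier ?T"
  then obtain t where t: "gens t \<subseteq> carrier G" "X = aterm_class G t"
    by (auto simp: tensor_completion_carrier)
  then show "\<one>\<^bsub>?T\<^esub> \<otimes>\<^bsub>?T\<^esub> X = X"
    by (simp add: tensor_completion_one tensor_completion_mult[OF assms] aterm_class_eq_iff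
        aterm_eq.l_one)
  show "\<exists>Y\<in>carrier ?T. Y \<otimes>\<^bsub>?T\<^esub> X = \<one>\<^bsub>?T\<^esub>"
  proof (rule bexI)
    show "aterm_class G (TInv t) \<otimes>\<^bsub>?T\<^esub> X = \<one>\<^bsub>?T\<^esub>"
      using t by (simp add: tensor_completion_one tensor_completion_mult[OF assms]
          aterm_class_eq_iff aterm_eq.l_inv)
    show "aterm_class G (TInv t) \<in> carrier ?T"
      using t by (auto simp: tensor_completion_carrier)
  qed
qed

lemma tensor_completion_inv:
  assumes "group G" "gens t \<subseteq> carrier G"
  shows "inv\<^bsub>tensor_completion G\<^esub> (aterm_class G t) = aterm_class G (TInv t)"
proof (rule group.inv_equality[OF group_tensor_completion[OF assms(1)]])
  show "aterm_class G (TInv t) \<otimes>\<^bsub>tensor_completion G\<^esub> aterm_class G t = \<one>\<^bsub>tensor_completion G\<^esub>"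
    using assms by (simp add: tensor_completion_one tensor_completion_mult aterm_class_eq_iff
        aterm_eq.l_inv)
qed (use assms in \<open>auto simp: tensor_completion_carrier\<close>)

lemma A_group_tensor_completion:
  fixes G :: "('g, 'm) monoid_scheme"
  assumes "group G"
  shows "A_group (tensor_completion G :: (('g, 'r::ring_1) aterm set, 'r) agroup)"
    (is "A_group ?T")
proof -
  interpret T: group ?T by (rule group_tensor_completion[OF assms])
  note simps = tensor_completion_one tensor_completion_mult[OF assms]
    tensor_completion_apow[OF assms] tensor_completion_inv[OF assms]
  show ?thesis
  proof (intro A_group.intro A_group_axioms.intro)
    show "group ?T" by (rule T.group_axioms)
  next
    fix X \<alpha> assume "X \<in> carrier ?T"
    then show "X \<up>\<^bsub>?T\<^esub> \<alpha> \<in> carrier ?T"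
      by (auto simp: tensor_completion_carrier simps)
  next
    fix X assume "X \<in> carrier ?T"
    then obtain t where "gens t \<subseteq> carrier G" "X = aterm_class G t"
      by (auto simp: tensor_completion_carrier)
    then show "X \<up>\<^bsub>?T\<^esub> 1 = X"
      by (simp add: simps aterm_class_eq_iff aterm_eq.pow_one)
  next
    fix X assume "X \<in> carrier ?T"
    then obtain t where "gens t \<subseteq> carrier G" "X = aterm_class G t"
      by (auto simp: tensor_completion_carrier)
    then show "X \<up>\<^bsub>?T\<^esub> 0 = \<one>\<^bsub>?T\<^esub>"
      by (simp add: simps aterm_class_eq_iff aterm_eq.pow_zero)
  next
    show "\<one>\<^bsub>?T\<^esub> \<up>\<^bsub>?T\<^esub> \<alpha> = \<one>\<^bsub>?T\<^esub>" for \<alpha>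
      by (auto simp: simps aterm_class_eq_iff intro: aterm_eq.one_pow)
  next
    fix X \<alpha> \<beta> assume "X \<in> carrier ?T"
    then show "X \<up>\<^bsub>?T\<^esub> (\<alpha> + \<beta>) = X \<up>\<^bsub>?T\<^esub> \<alpha> \<otimes>\<^bsub>?T\<^esub> X \<up>\<^bsub>?T\<^esub> \<beta>"
      by (clarsimp simp: tensor_completion_carrier simps) (simp add: aterm_class_eq_iff aterm_eq.pow_add)
  next
    fix X \<alpha> \<beta> assume "X \<in> carrier ?T"
    then show "X \<up>\<^bsub>?T\<^esub> (\<alpha> * \<beta>) = (X \<up>\<^bsub>?T\<^esub> \<alpha>) \<up>\<^bsub>?T\<^esub> \<beta>"
      by (clarsimp simp: tensor_completion_carrier simps) (simp add: aterm_class_eq_iff aterm_eq.pow_mult)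
  next
    fix X Y \<alpha> assume "X \<in> carrier ?T" "Y \<in> carrier ?T"
    then show "(inv\<^bsub>?T\<^esub> Y \<otimes>\<^bsub>?T\<^esub> X \<otimes>\<^bsub>?T\<^esub> Y) \<up>\<^bsub>?T\<^esub> \<alpha> = inv\<^bsub>?T\<^esub> Y \<otimes>\<^bsub>?T\<^esub> X \<up>\<^bsub>?T\<^esub> \<alpha> \<otimes>\<^bsub>?T\<^esub> Y"
      by (clarsimp simp: tensor_completion_carrier simps) (simp add: aterm_class_eq_iff aterm_eq.pow_conj)
  next
    fix X Y \<alpha> assume XY: "X \<in> carrier ?T" "Y \<in> carrier ?T" and "commutator ?T X Y = \<one>\<^bsub>?T\<^esub>"
    then have "X \<otimes>\<^bsub>?T\<^esub> Y = Y \<otimes>\<^bsub>?T\<^esub> X"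
      by (simp add: T.commutator_eq_one_iff)
    moreover obtain t u where "gens t \<subseteq> carrier G" "X = aterm_class G t"
      "gens u \<subseteq> carrier G" "Y = aterm_class G u"
      using XY by (auto simp: tensor_completion_carrier)
    ultimately show "(X \<otimes>\<^bsub>?T\<^esub> Y) \<up>\<^bsub>?T\<^esub> \<alpha> = X \<up>\<^bsub>?T\<^esub> \<alpha> \<otimes>\<^bsub>?T\<^esub> Y \<up>\<^bsub>?T\<^esub> \<alpha>"
      using aterm_eq.pow_comm[of G t u \<alpha>]
      by (simp add: simps aterm_class_eq_iff)
  qed
qed

lemma completion_map_hom:
  assumes "group G"
  shows "completion_map G \<in> hom G (tensor_completion G)"
  using assms
  by (auto simp: hom_def completion_map_def tensor_completion_carrier tensor_completion_mult
      aterm_class_eq_iff intro: aterm_eq.gen_mult)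

lemma tensor_completion_generated:
  assumes "group G"
  shows "A_generate (tensor_completion G) (completion_map G ` carrier G) = carrier (tensor_completion G)"
    (is "A_generate ?T ?S = _")
proof
  interpret A_group ?T by (rule A_group_tensor_completion[OF assms])
  have "x \<in> carrier ?T" if "x \<in> A_generate ?T ?S" for x
    using that
    by induction (use completion_map_hom[OF assms] in \<open>auto simp: apow_closed hom_def\<close>)
  then show "A_generate ?T ?S \<subseteq> carrier ?T" by blast
next
  have "gens t \<subseteq> carrier G \<Longrightarrow> aterm_class G t \<in> A_generate ?T ?S" for t
  proof (induction t)
    case (Gen x)
    then show ?case by (auto simp: completion_map_def intro: A_generate.incl)
  next
    case TOne
    then show ?case by (metis A_generate.one tensor_completion_one)
  next
    case (TMult t u)
    then show ?case
      using A_generate.mult[of "aterm_class G t" ?T ?S "aterm_class G u"]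
      by (simp add: tensor_completion_mult[OF assms])
  next
    case (TInv t)
    then show ?case
      using A_generate.inv[of "aterm_class G t" ?T ?S]
      by (simp add: tensor_completion_inv[OF assms])
  next
    case (TPow t \<alpha>)
    then show ?case
      using A_generate.pow[of "aterm_class G t" ?T ?S \<alpha>]
      by (simp add: tensor_completion_apow[OF assms])
  qed
  then show "carrier ?T \<subseteq> A_generate ?T ?S"
    by (auto simp: tensor_completion_carrier)
qed

primrec aterm_eval :: "('h, 'r) agroup \<Rightarrow> ('g \<Rightarrow> 'h) \<Rightarrow> ('g, 'r) aterm \<Rightarrow> 'h" where
  "aterm_eval H \<phi> (Gen g) = \<phi> g"
| "aterm_eval H \<phi> TOne = \<one>\<^bsub>H\<^esub>"
| "aterm_eval H \<phi> (TMult t u) = aterm_eval H \<phi> t \<otimes>\<^bsub>H\<^esub> aterm_eval H \<phi> u"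
| "aterm_eval H \<phi> (TInv t) = inv\<^bsub>H\<^esub> (aterm_eval H \<phi> t)"
| "aterm_eval H \<phi> (TPow t \<alpha>) = aterm_eval H \<phi> t \<up>\<^bsub>H\<^esub> \<alpha>"

lemma aterm_eval_closed:
  assumes "A_group H" "\<phi> \<in> hom G H" "gens t \<subseteq> carrier G"
  shows "aterm_eval H \<phi> t \<in> carrier H"
proof -
  interpret A_group H by fact
  show ?thesis using assms(3)
    by (induction t) (use assms(2) in \<open>auto simp: hom_def apow_closed\<close>)
qed

lemma aterm_eval_cong:
  assumes "group G" "A_group H" "\<phi> \<in> hom G H" "aterm_eq G t u"
  shows "aterm_eval H \<phi> t = aterm_eval H \<phi> u"
proof -
  interpret A_group H by fact
  note closed = aterm_eval_closed[OF assms(2,3)]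
  show ?thesis using assms(4)
  proof induction
    case (gen_mult x y)
    then show ?case using assms(3) by (auto simp: hom_def)
  next
    case (pow_comm t u \<alpha>)
    then have "gens t \<subseteq> carrier G" "gens u \<subseteq> carrier G"
      using aterm_eq_gens[OF assms(1)] by fastforce+
    with pow_comm.IH show ?case
      using apow_comm[of "aterm_eval H \<phi> t" "aterm_eval H \<phi> u" \<alpha>]
      by (simp add: closed commutator_eq_one_iff)
  next
    case (pow_conj t u \<alpha>)
    then show ?case by (simp add: closed apow_conj)
  qed (simp_all add: closed m_assoc apow_one apow_zero one_apow apow_add apow_mult)
qed

text \<open>The type \<open>'h\<close> of test groups is arbitrary here.\<close>

theorem tensor_completion_universal:
  assumes "group G"
  shows "is_tensor_completion TYPE('h) G
           (tensor_completion G :: (('g, 'r::ring_1) aterm set, 'r) agroup) (completion_map G)"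
  unfolding is_tensor_completion_def
proof (intro conjI allI impI)
  let ?T = "tensor_completion G :: (('g, 'r) aterm set, 'r) agroup"
  note simps = tensor_completion_one tensor_completion_mult[OF assms]
    tensor_completion_apow[OF assms] tensor_completion_inv[OF assms]
  show "A_group ?T" by (rule A_group_tensor_completion[OF assms])
  show "completion_map G \<in> hom G ?T" by (rule completion_map_hom[OF assms])
  show "A_generate ?T (completion_map G ` carrier G) = carrier ?T"
    by (rule tensor_completion_generated[OF assms])
  fix H :: "('h, 'r) agroup" and \<phi>
  assume "A_group H \<and> \<phi> \<in> hom G H"
  then have H: "A_group H" and \<phi>: "\<phi> \<in> hom G H" by auto
  interpret T: A_group ?T by (rule A_group_tensor_completion[OF assms])
  interpret H: A_group H by (rule H)
  define \<psi> where "\<psi> X = aterm_eval H \<phi> (SOME t. t \<in> X)" for X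
  have \<psi>: "\<psi> (aterm_class G t) = aterm_eval H \<phi> t" if "gens t \<subseteq> carrier G" for t
    unfolding \<psi>_def using aterm_eval_cong[OF assms H \<phi> some_aterm_class[OF that]] by simp
  have "\<psi> \<in> A_hom ?T H"
    by (auto simp: A_hom_def hom_def tensor_completion_carrier simps \<psi> aterm_eval_closed[OF H \<phi>])
  moreover have "\<forall>g\<in>carrier G. \<psi> (completion_map G g) = \<phi> g"
    by (simp add: completion_map_def \<psi>)
  moreover have "\<psi>' x = \<psi> x"
    if \<psi>': "\<psi>' \<in> A_hom ?T H" "\<forall>g\<in>carrier G. \<psi>' (completion_map G g) = \<phi> g"
      and x: "x \<in> carrier ?T" for \<psi>' x
  proof -
    have hom': "\<psi>' \<in> hom ?T H" using \<psi>'(1) by (simp add: A_hom_def)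
    interpret h: group_hom ?T H \<psi>'
      by (intro group_hom.intro group_hom_axioms.intro T.group_axioms H.group_axioms hom')
    have "gens t \<subseteq> carrier G \<Longrightarrow> \<psi>' (aterm_class G t) = aterm_eval H \<phi> t" for t
    proof (induction t)
      case (Gen g)
      then show ?case using \<psi>'(2) by (simp add: completion_map_def)
    next
      case TOne
      then show ?case using h.hom_one by (simp add: tensor_completion_one)
    next
      case (TMult t u)
      then show ?case
        using h.hom_mult[of "aterm_class G t" "aterm_class G u"]
        by (simp add: simps tensor_completion_carrier)
    next
      case (TInv t)
      then show ?case
        using h.hom_inv[of "aterm_class G t"] by (simp add: simps tensor_completion_carrier)
    next
      case (TPow t \<alpha>)
      then have "aterm_class G t \<in> carrier ?T" by (auto simp: tensor_completion_carrier)
      then have "\<psi>' (aterm_class G t \<up>\<^bsub>?T\<^esub> \<alpha>) = \<psi>' (aterm_class G t) \<up>\<^bsub>H\<^esub> \<alpha>"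
        using \<psi>'(1) by (simp add: A_hom_def)
      with TPow show ?case by (simp add: simps)
    qed
    with x show ?thesis by (auto simp: tensor_completion_carrier \<psi>)
  qed
  ultimately show "\<exists>\<psi>\<in>A_hom ?T H. (\<forall>g\<in>carrier G. \<psi> (completion_map G g) = \<phi> g) \<and>
      (\<forall>\<psi>'\<in>A_hom ?T H. (\<forall>g\<in>carrier G. \<psi>' (completion_map G g) = \<phi> g) \<longrightarrow>
         (\<forall>x\<in>carrier ?T. \<psi>' x = \<psi> x))"
    by blast
qed

text \<open>Faithfulness may be read off any tensor completion, with elements in any type.\<close>

theorem faithful_over_iff:
  fixes G :: "('g, 'm) monoid_scheme" and GA :: "('c, 'r::ring_1) agroup"
  assumes G: "group G" and GA: "is_tensor_completion TYPE(('g, 'r) aterm set) G GA l"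
  shows "faithful_over TYPE('r) G \<longleftrightarrow> inj_on l (carrier G)"
proof -
  have "A_group GA" "l \<in> hom G GA"
    using GA by (auto simp: is_tensor_completion_def)
  then obtain f where f: "\<forall>g\<in>carrier G. f (completion_map G g :: ('g, 'r) aterm set) = l g"
    using tensor_completion_universal[OF G, where 'h = 'c and 'r = 'r]
    unfolding is_tensor_completion_def by blast
  obtain f' where f': "\<forall>g\<in>carrier G. f' (l g) = (completion_map G g :: ('g, 'r) aterm set)"
    using GA A_group_tensor_completion[OF G, where 'r = 'r] completion_map_hom[OF G]
    unfolding is_tensor_completion_def by blast
  show ?thesis
    unfolding faithful_over_def inj_on_def using f f' by metis
qed


section \<open>Torsion-free, nilpotent and polynilpotent\<close>

definition torsion_free :: "('g, 'm) monoid_scheme \<Rightarrow> bool" where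
  "torsion_free G \<longleftrightarrow> (\<forall>g\<in>carrier G. \<forall>n::nat. n > 0 \<and> g [^]\<^bsub>G\<^esub> n = \<one>\<^bsub>G\<^esub> \<longrightarrow> g = \<one>\<^bsub>G\<^esub>)"

text \<open>\<open>lower_central G H n\<close> is the term usually written \<open>\<gamma>\<^sub>n\<^sub>+\<^sub>1(H)\<close>, for a subgroup \<open>H\<close> of \<open>G\<close>.\<close>

primrec lower_central :: "('g, 'm) monoid_scheme \<Rightarrow> 'g set \<Rightarrow> nat \<Rightarrow> 'g set" where
  "lower_central G H 0 = H"
| "lower_central G H (Suc n) =
     generate G {commutator G x y | x y. x \<in> lower_central G H n \<and> y \<in> H}"

definition nilpotent :: "('g, 'm) monoid_scheme \<Rightarrow> bool" where
  "nilpotent G \<longleftrightarrow> (\<exists>c. lower_central G (carrier G) c = {\<one>\<^bsub>G\<^esub>})"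

text \<open>
  The targets may be taken with elements in \<open>'g set\<close>, the type of quotients of \<open>G\<close>; by
  \<open>residually_torsion_free_nilpotentI\<close> this is no restriction.
\<close>

definition residually_torsion_free_nilpotent :: "('g, 'm) monoid_scheme \<Rightarrow> bool" where
  "residually_torsion_free_nilpotent G \<longleftrightarrow>
     (\<forall>g\<in>carrier G. g \<noteq> \<one>\<^bsub>G\<^esub> \<longrightarrow>
        (\<exists>(N :: 'g set monoid) \<phi>. group N \<and> torsion_free N \<and> nilpotent N \<and>
           \<phi> \<in> hom G N \<and> \<phi> g \<noteq> \<one>\<^bsub>N\<^esub>))"

lemma lower_central_subset:
  assumes "group G"
  shows "lower_central G (carrier G) n \<subseteq> carrier G"
proof -
  interpret group G by fact
  show ?thesis
  proof (induction n)
    case (Suc n)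
    then have "{commutator G x y | x y. x \<in> lower_central G (carrier G) n \<and> y \<in> carrier G}
        \<subseteq> carrier G"
      by (auto simp: commutator_def)
    then show ?case
      unfolding lower_central.simps by (rule generate_incl)
  qed simp
qed

lemma lower_central_hom:
  assumes "group_hom G H f"
  shows "f ` lower_central G (carrier G) n \<subseteq> lower_central H (carrier H) n"
proof -
  interpret group_hom G H f by fact
  show ?thesis
  proof (induction n)
    case (Suc n)
    let ?S = "{commutator G x y | x y. x \<in> lower_central G (carrier G) n \<and> y \<in> carrier G}"
    let ?S' = "{commutator H x y | x y. x \<in> lower_central H (carrier H) n \<and> y \<in> carrier H}"
    have lc: "x \<in> carrier G" if "x \<in> lower_central G (carrier G) n" for x
      using that lower_central_subset[OF G.group_axioms] by auto
    have S: "?S \<subseteq> carrier G"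
      using lc by (auto simp: commutator_def)
    have "f s \<in> ?S'" if s: "s \<in> ?S" for s
    proof -
      obtain x y where s: "s = commutator G x y" and x: "x \<in> lower_central G (carrier G) n"
        and y: "y \<in> carrier G" using s by blast
      have "f s = commutator H (f x) (f y)"
        using lc[OF x] y by (simp add: s commutator_def)
      moreover have "f x \<in> lower_central H (carrier H) n" using Suc.IH x by blast
      ultimately show ?thesis
        using hom_closed[OF y] by (intro CollectI exI conjI)
    qed
    then have "f ` ?S \<subseteq> ?S'" by blast
    then have "generate H (f ` ?S) \<subseteq> generate H ?S'" by (rule H.mono_generate)
    then show ?case
      unfolding lower_central.simps generate_img[OF S] .
  qed auto
qed

theorem residually_torsion_free_nilpotentI:
  fixes G :: "('g, 'm) monoid_scheme"
  assumes G: "group G"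
    and sep: "\<And>g. \<lbrakk>g \<in> carrier G; g \<noteq> \<one>\<^bsub>G\<^esub>\<rbrakk> \<Longrightarrow>
        \<exists>(N :: 'n monoid) \<phi>. group N \<and> torsion_free N \<and> nilpotent N \<and>
           \<phi> \<in> hom G N \<and> \<phi> g \<noteq> \<one>\<^bsub>N\<^esub>"
  shows "residually_torsion_free_nilpotent G"
  unfolding residually_torsion_free_nilpotent_def
proof (intro ballI impI)
  fix g assume g: "g \<in> carrier G" "g \<noteq> \<one>\<^bsub>G\<^esub>"
  obtain N :: "'n monoid" and \<phi> where N: "group N" "torsion_free N" "nilpotent N"
    and \<phi>: "\<phi> \<in> hom G N" "\<phi> g \<noteq> \<one>\<^bsub>N\<^esub>"
    using sep[OF g] by (elim exE conjE) (rule that)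
  interpret h: group_hom G N \<phi>
    by (intro group_hom.intro group_hom_axioms.intro G N \<phi>)
  let ?K = "kernel G N \<phi>"
  let ?Q = "G Mod ?K"
  let ?f = "\<lambda>X. the_elem (\<phi> ` X)"
  have K: "?K \<lhd> G" by (rule h.normal_kernel)
  have Q: "group ?Q" by (rule normal.factorgroup_is_group[OF K])
  interpret q: group_hom ?Q N ?f
    by (intro group_hom.intro group_hom_axioms.intro Q N h.FactGroup_hom)
  have inj: "inj_on ?f (carrier ?Q)" by (rule h.FactGroup_inj_on)
  have inj1: "X = \<one>\<^bsub>?Q\<^esub>" if "X \<in> carrier ?Q" "?f X = \<one>\<^bsub>N\<^esub>" for X
    using inj that q.hom_one q.G.one_closed unfolding inj_on_def by metis
  have "torsion_free ?Q"
    unfolding torsion_free_def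
  proof (intro ballI allI impI)
    fix X and n :: nat assume X: "X \<in> carrier ?Q" and n: "n > 0 \<and> X [^]\<^bsub>?Q\<^esub> n = \<one>\<^bsub>?Q\<^esub>"
    then have "?f X [^]\<^bsub>N\<^esub> n = \<one>\<^bsub>N\<^esub>"
      using q.hom_nat_pow[OF X, of n] q.hom_one by metis
    then have "?f X = \<one>\<^bsub>N\<^esub>"
      using N(2) n q.hom_closed[OF X] unfolding torsion_free_def by blast
    then show "X = \<one>\<^bsub>?Q\<^esub>" by (rule inj1[OF X])
  qed
  moreover have "nilpotent ?Q"
  proof -
    obtain c where c: "lower_central N (carrier N) c = {\<one>\<^bsub>N\<^esub>}"
      using N(3) by (auto simp: nilpotent_def)
    have "X = \<one>\<^bsub>?Q\<^esub>" if "X \<in> lower_central ?Q (carrier ?Q) c" for X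
    proof (rule inj1)
      show "X \<in> carrier ?Q" using that lower_central_subset[OF Q] by blast
      show "?f X = \<one>\<^bsub>N\<^esub>"
        using that lower_central_hom[OF q.group_hom_axioms, of c] c by blast
    qed
    moreover have "\<one>\<^bsub>?Q\<^esub> \<in> lower_central ?Q (carrier ?Q) c"
      by (cases c) (auto intro: generate.one simp del: one_FactGroup)
    ultimately show ?thesis unfolding nilpotent_def by blast
  qed
  moreover have "(\<lambda>x. ?K #>\<^bsub>G\<^esub> x) \<in> hom G ?Q"
    by (rule normal.r_coset_hom_Mod[OF K])
  moreover have "?K #>\<^bsub>G\<^esub> g \<noteq> \<one>\<^bsub>?Q\<^esub>"
  proof
    assume "?K #>\<^bsub>G\<^esub> g = \<one>\<^bsub>?Q\<^esub>"
    then have "g \<in> ?K"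
      using h.G.rcos_self[OF g(1)] K by (auto simp: normal_def)
    with \<phi>(2) show False by (simp add: kernel_def)
  qed
  ultimately show "\<exists>(N :: 'g set monoid) \<phi>. group N \<and> torsion_free N \<and> nilpotent N \<and>
           \<phi> \<in> hom G N \<and> \<phi> g \<noteq> \<one>\<^bsub>N\<^esub>"
    using Q by (intro exI[of _ ?Q] exI[of _ "\<lambda>x. ?K #>\<^bsub>G\<^esub> x"] conjI)
qed

text \<open>
  For \<open>cs = [c\<^sub>1, \<dots>, c\<^sub>k]\<close> this is \<open>\<gamma>\<close> of index \<open>c\<^sub>k + 1\<close> of \dots of \<open>\<gamma>\<close> of index \<open>c\<^sub>1 + 1\<close> of
  \<open>G\<close>, the verbal subgroup of the variety of polynilpotent groups of class row
  \<open>(c\<^sub>1, \<dots>, c\<^sub>k)\<close>.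
\<close>

definition polynilpotent_subgroup :: "('g, 'm) monoid_scheme \<Rightarrow> nat list \<Rightarrow> 'g set" where
  "polynilpotent_subgroup G cs = fold (\<lambda>c H. lower_central G H c) cs (carrier G)"


section \<open>Free groups\<close>

text \<open>
  A letter \<open>(True, x)\<close> stands for \<open>x\<close> and \<open>(False, x)\<close> for the inverse of \<open>x\<close>.
\<close>

definition reduced_word :: "(bool \<times> 'g) list \<Rightarrow> bool" where
  "reduced_word = successively (\<lambda>p q. \<not> (snd p = snd q \<and> fst p \<noteq> fst q))"

primrec word_value :: "('h, 'm) monoid_scheme \<Rightarrow> ('g \<Rightarrow> 'h) \<Rightarrow> (bool \<times> 'g) list \<Rightarrow> 'h" where
  "word_value H f [] = \<one>\<^bsub>H\<^esub>"
| "word_value H f (p # w) =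
     (if fst p then f (snd p) else inv\<^bsub>H\<^esub> f (snd p)) \<otimes>\<^bsub>H\<^esub> word_value H f w"

definition free_basis :: "('g, 'm) monoid_scheme \<Rightarrow> 'g set \<Rightarrow> bool" where
  "free_basis F X \<longleftrightarrow> X \<subseteq> carrier F \<and> generate F X = carrier F \<and>
     (\<forall>w. snd ` set w \<subseteq> X \<and> reduced_word w \<and> w \<noteq> [] \<longrightarrow> word_value F (\<lambda>x. x) w \<noteq> \<one>\<^bsub>F\<^esub>)"

definition free_group :: "('g, 'm) monoid_scheme \<Rightarrow> bool" where
  "free_group F \<longleftrightarrow> group F \<and> (\<exists>X. free_basis F X)"

lemma word_value_closed:
  assumes "group H" "f \<in> X \<rightarrow> carrier H" "snd ` set w \<subseteq> X"
  shows "word_value H f w \<in> carrier H"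
proof -
  interpret group H by fact
  show ?thesis using assms(3) by (induction w) (use assms(2) in auto)
qed

lemma word_value_append:
  assumes "group H" "f \<in> X \<rightarrow> carrier H" "snd ` set v \<subseteq> X" "snd ` set w \<subseteq> X"
  shows "word_value H f (v @ w) = word_value H f v \<otimes>\<^bsub>H\<^esub> word_value H f w"
proof -
  interpret group H by fact
  note closed = word_value_closed[OF assms(1,2)]
  show ?thesis using assms(3)
  proof (induction v)
    case (Cons p v)
    then have "f (snd p) \<in> carrier H" using assms(2) by auto
    with Cons show ?case by (auto simp: closed assms(4) m_assoc)
  qed (simp add: closed assms(4))
qed

definition inverse_word :: "(bool \<times> 'g) list \<Rightarrow> (bool \<times> 'g) list" where
  "inverse_word w = map (\<lambda>(b, x). (\<not> b, x)) (rev w)"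

lemma snd_inverse_word: "snd ` set (inverse_word w) = snd ` set w"
  by (force simp: inverse_word_def image_def)

lemma word_value_inverse_word:
  assumes "group H" "f \<in> X \<rightarrow> carrier H" "snd ` set w \<subseteq> X"
  shows "word_value H f (inverse_word w) = inv\<^bsub>H\<^esub> (word_value H f w)"
proof -
  interpret group H by fact
  note closed = word_value_closed[OF assms(1,2)]
  show ?thesis using assms(3)
  proof (induction w)
    case Nil
    then show ?case by (simp add: inverse_word_def)
  next
    case (Cons p w)
    obtain b x where p: "p = (b, x)" by (cases p)
    have x: "f x \<in> carrier H" using Cons.prems assms(2) p by auto
    have "word_value H f (inverse_word (p # w)) =
        word_value H f (inverse_word w) \<otimes>\<^bsub>H\<^esub> word_value H f [(\<not> b, x)]"
      using Cons.prems
      by (subst word_value_append[OF assms(1,2), symmetric])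
        (auto simp: snd_inverse_word p, auto simp: inverse_word_def)
    also have "\<dots> = inv\<^bsub>H\<^esub> (word_value H f (p # w))"
      using Cons x by (auto simp: p closed inv_mult_group)
    finally show ?case .
  qed
qed

primrec reduce_word :: "(bool \<times> 'g) list \<Rightarrow> (bool \<times> 'g) list" where
  "reduce_word [] = []"
| "reduce_word (p # w) =
     (case reduce_word w of
        [] \<Rightarrow> [p]
      | q # v \<Rightarrow> if snd p = snd q \<and> fst p \<noteq> fst q then v else p # q # v)"

lemma reduced_reduce_word: "reduced_word (reduce_word w)"
  by (induction w) (auto simp: reduced_word_def successively_Cons split: list.split)

lemma snd_reduce_word: "snd ` set (reduce_word w) \<subseteq> snd ` set w"
proof -
  have "set (reduce_word w) \<subseteq> set w"
    by (induction w) (auto split: list.split)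
  then show ?thesis by blast
qed

lemma word_value_reduce_word:
  assumes "group H" "f \<in> X \<rightarrow> carrier H" "snd ` set w \<subseteq> X"
  shows "word_value H f (reduce_word w) = word_value H f w"
proof -
  interpret group H by fact
  note closed = word_value_closed[OF assms(1,2)]
  show ?thesis using assms(3)
  proof (induction w)
    case (Cons p w)
    show ?case
    proof (cases "reduce_word w")
      case Nil
      with Cons show ?thesis by auto
    next
      case (Cons q v)
      have X: "snd p \<in> X" "snd q \<in> X" "snd ` set v \<subseteq> X"
        using Cons Cons.prems snd_reduce_word[of w] by auto
      then have "f (snd p) \<in> carrier H" "f (snd q) \<in> carrier H" "word_value H f v \<in> carrier H"
        using assms(2) closed by auto
      moreover have "word_value H f w = word_value H f (q # v)"
        using Cons Cons.IH Cons.prems by simp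
      ultimately show ?thesis
        by (auto simp: Cons m_assoc[symmetric])
    qed
  qed simp
qed

text \<open>A free basis has the usual universal property, for groups \<open>H\<close> with elements in any type.\<close>

theorem free_basis_universal:
  assumes F: "group F" and X: "free_basis F X" and H: "group H" and f: "f \<in> X \<rightarrow> carrier H"
  shows "\<exists>h\<in>hom F H. (\<forall>x\<in>X. h x = f x) \<and>
           (\<forall>h'\<in>hom F H. (\<forall>x\<in>X. h' x = f x) \<longrightarrow> (\<forall>y\<in>carrier F. h' y = h y))"
proof -
  interpret F: group F by fact
  interpret H: group H by fact
  have XF: "(\<lambda>x. x) \<in> X \<rightarrow> carrier F" and gen: "generate F X = carrier F"
    using X by (auto simp: free_basis_def)
  note F_simps = word_value_closed[OF F XF] word_value_append[OF F XF]
    word_value_inverse_word[OF F XF] snd_inverse_word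
  note H_simps = word_value_closed[OF H f] word_value_append[OF H f]
    word_value_inverse_word[OF H f] snd_inverse_word
  have trivial: "word_value H f w = \<one>\<^bsub>H\<^esub>"
    if w: "snd ` set w \<subseteq> X" "word_value F (\<lambda>x. x) w = \<one>\<^bsub>F\<^esub>" for w
  proof -
    have "word_value F (\<lambda>x. x) (reduce_word w) = \<one>\<^bsub>F\<^esub>"
      using w word_value_reduce_word[OF F XF] by simp
    moreover have "snd ` set (reduce_word w) \<subseteq> X"
      using w(1) snd_reduce_word[of w] by blast
    ultimately have "reduce_word w = []"
      using X reduced_reduce_word[of w] unfolding free_basis_def by blast
    then show ?thesis
      using word_value_reduce_word[OF H f w(1)] by simp
  qed
  have wd: "word_value H f v = word_value H f w"
    if vw: "snd ` set v \<subseteq> X" "snd ` set w \<subseteq> X" "word_value F (\<lambda>x. x) v = word_value F (\<lambda>x. x) w" for v w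
  proof -
    have "word_value F (\<lambda>x. x) (v @ inverse_word w) = \<one>\<^bsub>F\<^esub>"
      using vw by (simp add: F_simps)
    then have "word_value H f (v @ inverse_word w) = \<one>\<^bsub>H\<^esub>"
      using vw by (intro trivial) (auto simp: snd_inverse_word image_Un)
    then have "word_value H f v \<otimes>\<^bsub>H\<^esub> inv\<^bsub>H\<^esub> word_value H f w = \<one>\<^bsub>H\<^esub>"
      using vw by (simp add: H_simps)
    then show ?thesis
      using vw by (simp add: H_simps H.inv_solve_right')
  qed
  have words: "\<exists>w. snd ` set w \<subseteq> X \<and> word_value F (\<lambda>x. x) w = y" if "y \<in> carrier F" for y
  proof -
    have "y \<in> generate F X" using that gen by simp
    then show ?thesis
    proof induction
      case one
      show ?case by (intro exI[of _ "[]"]) simp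
    next
      case (incl x)
      then have "x \<in> carrier F" using XF by auto
      with incl show ?case by (intro exI[of _ "[(True, x)]"]) auto
    next
      case (inv x)
      then have "x \<in> carrier F" using XF by auto
      with inv show ?case by (intro exI[of _ "[(False, x)]"]) auto
    next
      case (eng y z)
      then obtain v w where v: "snd ` set v \<subseteq> X" "word_value F (\<lambda>x. x) v = y"
        and w: "snd ` set w \<subseteq> X" "word_value F (\<lambda>x. x) w = z" by blast
      have "snd ` set (v @ w) \<subseteq> X" using v(1) w(1) by auto
      moreover have "word_value F (\<lambda>x. x) (v @ w) = y \<otimes>\<^bsub>F\<^esub> z"
        using word_value_append[OF F XF v(1) w(1)] by (simp only: v(2) w(2))
      ultimately show ?case by blast
    qed
  qed
  define wd_of where "wd_of y = (SOME w. snd ` set w \<subseteq> X \<and> word_value F (\<lambda>x. x) w = y)" for y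
  have wd_of: "snd ` set (wd_of y) \<subseteq> X" "word_value F (\<lambda>x. x) (wd_of y) = y" if "y \<in> carrier F" for y
    using someI_ex[OF words[OF that]] by (simp_all add: wd_of_def)
  define h where "h y = word_value H f (wd_of y)" for y
  have h: "h (word_value F (\<lambda>x. x) w) = word_value H f w" if "snd ` set w \<subseteq> X" for w
    unfolding h_def using that wd_of[of "word_value F (\<lambda>x. x) w"] by (intro wd) (auto simp: F_simps)
  have "h \<in> hom F H"
  proof (rule homI)
    fix y assume "y \<in> carrier F"
    then show "h y \<in> carrier H" by (simp add: h_def H_simps wd_of)
  next
    fix y z assume yz: "y \<in> carrier F" "z \<in> carrier F"
    then have "h (y \<otimes>\<^bsub>F\<^esub> z) = h (word_value F (\<lambda>x. x) (wd_of y @ wd_of z))"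
      by (simp add: F_simps wd_of)
    also have "\<dots> = word_value H f (wd_of y @ wd_of z)"
      using yz wd_of(1) by (intro h) (simp add: image_Un)
    also have "\<dots> = h y \<otimes>\<^bsub>H\<^esub> h z"
      using yz by (simp add: h_def H_simps wd_of)
    finally show "h (y \<otimes>\<^bsub>F\<^esub> z) = h y \<otimes>\<^bsub>H\<^esub> h z" .
  qed
  moreover have "\<forall>x\<in>X. h x = f x"
  proof
    fix x assume x: "x \<in> X"
    then have "x \<in> carrier F" "f x \<in> carrier H" using XF f by auto
    then show "h x = f x" using h[of "[(True, x)]"] x by simp
  qed
  moreover have "h' y = h y"
    if h': "h' \<in> hom F H" "\<forall>x\<in>X. h' x = f x" and y: "y \<in> carrier F" for h' y
  proof -
    interpret h': group_hom F H h'
      by (intro group_hom.intro group_hom_axioms.intro F H h')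
    have "snd ` set w \<subseteq> X \<Longrightarrow> h' (word_value F (\<lambda>x. x) w) = word_value H f w" for w
    proof (induction w)
      case (Cons p w)
      then have "snd p \<in> carrier F" "word_value F (\<lambda>x. x) w \<in> carrier F"
        using XF by (auto simp: F_simps)
      with Cons h'(2) show ?case by auto
    qed simp
    then show ?thesis using wd_of[OF y] by (metis h_def)
  qed
  ultimately show ?thesis by blast
qed

end

theory Submission
  imports Defs
    "HOL-Computational_Algebra.Polynomial"
    "HOL-Computational_Algebra.Fraction_Field"
    "HOL-Library.Function_Algebras"
    "HOL-Library.List_Lexorder"
begin

text \<open>
  Call a function from a group \<open>G\<close> to a field \<open>K\<close> polynomial if some number of iterated right
  differences \<open>f (x h) - f x\<close> kills it. A right translation changes a polynomial function by
  one that is killed by fewer differences, so \<open>G\<close> acts on its polynomial functions by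
  unipotent operators. If \<open>K\<close> has characteristic 0, an operator \<open>u\<close> of this kind has a power
  with any exponent \<open>a\<close> in \<open>K\<close>, the binomial series \<open>\<Sum>k. (a gchoose k) (u - 1)^k\<close>, which
  is finite on every function. These powers satisfy the axioms of an \<open>A\<close>-group
  (\<open>A_group_unip_group\<close>), because the identities hold for natural exponents and both sides are
  polynomials in the exponent. Let \<open>K\<close> be the field of fractions of \<open>A\<close>. Whenever the
  polynomial functions separate the elements of \<open>G\<close> from 1, the group \<open>G\<close> embeds into an
  \<open>A\<close>-group, so it is faithful over \<open>A\<close> (\<open>faithful_over_if_pol_separated\<close>). It remains to find
  polynomial functions.

  Residually torsion-free nilpotent groups. An equality in the tensor completion has a
  derivation that mentions finitely many elements of \<open>G\<close> only, so it is enough to separate an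
  element inside finitely generated subgroups. Their images in a torsion-free nilpotent group
  arise from the trivial group by finitely many steps from \<open>H\<close> to \<open>\<langle>H, t\<rangle>\<close>
  along a central series. The lemma \<open>pol_separated_cyclic\<close> performs one step: it extends the
  unipotent action of \<open>H\<close> to \<open>\<langle>H, t\<rangle>\<close>. If no power of \<open>t\<close> lies in \<open>H\<close>, then
  \<open>t\<close> acts by conjugation. Otherwise \<open>t\<close> acts by a root of the operator that belongs to its
  power in \<open>H\<close>, and torsion-freeness allows one to replace an element by a nontrivial power of
  it that lies in \<open>H\<close>.

  Free groups. Under Magnus's homomorphism, which sends a basis element \<open>x\<close> to \<open>1 + x\<close> in the
  ring of power series in non-commuting variables, every coefficient is a polynomial function
  on the group, and every nonempty reduced word has a nonzero coefficient at a nonempty word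
  (\<open>free_group_pol_separated\<close>).

  Free solvable and polynilpotent groups. The subgroup in question is obtained from the free
  group \<open>F\<close> by repeatedly passing from a normal subgroup \<open>R\<close> to a term of its lower central
  series. Suppose that polynomial functions separate the cosets of \<open>R\<close>. Introduce one variable
  \<open>(p, x)\<close> for every polynomial function \<open>p\<close> that is constant on these cosets and every basis
  element \<open>x\<close>, give the edge from \<open>a\<close> to \<open>a x\<close> of the Cayley graph the weight
  \<open>1 + \<Sum>p. p a (p, x)\<close>, and multiply the weights along the path from 1 that spells an
  element \<open>w\<close>. The coefficients of this product are polynomial functions of \<open>w\<close>, and those of
  degree at most \<open>c\<close> are constant on the cosets of \<open>lower_central F R c\<close>. Conversely, if \<open>w\<close>
  lies in \<open>R\<close> and all its coefficients of degree 1 to \<open>c\<close> vanish, then \<open>w\<close> lies in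
  \<open>lower_central F R c\<close> (\<open>kernel_lower_central\<close>). Indeed, \<open>w\<close> is a product of finitely many
  Schreier generators of \<open>R\<close>. By interpolation the variables can be specialised so that the
  \<open>i\<close>-th of these generators is sent to one plus the \<open>i\<close>-th letter, and the theorem of Magnus
  and Witt (\<open>magnus_witt\<close>) recognises the lower central series of a group with such a map from
  the order of the power series.
\<close>

section \<open>Functions that are polynomial in the exponent\<close>

definition is_poly :: "('k::field_char_0 \<Rightarrow> 'k) \<Rightarrow> bool" where
  "is_poly F \<longleftrightarrow> (\<exists>p. F = poly p)"

lemma is_poly_const: "is_poly (\<lambda>a. c)"
  unfolding is_poly_def by (intro exI[of _ "[:c:]"]) (simp add: fun_eq_iff)

lemma is_poly_affine: "is_poly (\<lambda>a. b + c * a)"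
  unfolding is_poly_def by (intro exI[of _ "[:b, c:]"]) (simp add: fun_eq_iff mult.commute)

lemma is_poly_add: "is_poly F \<Longrightarrow> is_poly G \<Longrightarrow> is_poly (\<lambda>a. F a + G a)"
  unfolding is_poly_def by (elim exE, rename_tac p q, rule_tac x = "p + q" in exI) (simp add: fun_eq_iff poly_add)

lemma is_poly_mult: "is_poly F \<Longrightarrow> is_poly G \<Longrightarrow> is_poly (\<lambda>a. F a * G a)"
  unfolding is_poly_def by (elim exE, rename_tac p q, rule_tac x = "p * q" in exI) (simp add: fun_eq_iff poly_mult)

lemma is_poly_compose: "is_poly F \<Longrightarrow> is_poly G \<Longrightarrow> is_poly (\<lambda>a. F (G a))"
  unfolding is_poly_def by (elim exE, rename_tac p q, rule_tac x = "pcompose p q" in exI) (simp add: fun_eq_iff poly_pcompose)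

lemma is_poly_sum: "(\<And>i. i \<in> I \<Longrightarrow> is_poly (F i)) \<Longrightarrow> is_poly (\<lambda>a. \<Sum>i\<in>I. F i a)"
  by (induction I rule: infinite_finite_induct) (auto intro: is_poly_const is_poly_add)

lemma is_poly_gchoose: "is_poly (\<lambda>a. a gchoose k)"
proof -
  have "a gchoose k = poly (smult (inverse (fact k)) (\<Prod>i=0..<k. [:- of_nat i, 1:])) a" for a :: 'a
    by (simp add: gbinomial_prod_rev poly_prod field_simps)
  then show ?thesis unfolding is_poly_def by blast
qed

text \<open>
  A nonzero polynomial has finitely many roots, and the natural numbers are infinitely many
  elements of a field of characteristic 0.
\<close>

lemma is_poly_eqI:
  assumes "is_poly F" "is_poly G" and eq: "\<And>n. F (of_nat n) = G (of_nat n)"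
  shows "F a = G a"
proof -
  obtain p q where pq: "F = poly p" "G = poly q" using assms by (auto simp: is_poly_def)
  have "p - q = 0"
  proof (rule ccontr)
    assume "p - q \<noteq> 0"
    then have "finite {x. poly (p - q) x = 0}" by (rule poly_roots_finite)
    moreover have "range of_nat \<subseteq> {x. poly (p - q) x = 0}" using eq pq by auto
    ultimately have "finite (range (of_nat :: nat \<Rightarrow> 'a))" by (rule rev_finite_subset)
    then show False using finite_imageD[OF _ inj_of_nat] by blast
  qed
  then show ?thesis using pq by simp
qed

section \<open>Unipotent operators on a filtered space of functions\<close>

locale function_filtration =
  fixes V :: "nat \<Rightarrow> ('x \<Rightarrow> 'k::field_char_0) set"
  assumes V_0: "V 0 = {0}"
    and V_Suc: "f \<in> V n \<Longrightarrow> f \<in> V (Suc n)"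
    and V_add: "\<lbrakk>f \<in> V n; g \<in> V n\<rbrakk> \<Longrightarrow> f + g \<in> V n"
    and V_scale: "f \<in> V n \<Longrightarrow> (\<lambda>x. c * f x) \<in> V n"
begin

text \<open>
  Operators send functions outside \<open>total\<close> to 0, so that two of them are equal as soon as they
  agree on \<open>total\<close>.
\<close>

definition total :: "('x \<Rightarrow> 'k) set" where
  "total = (\<Union>n. V n)"

definition unip :: "(('x \<Rightarrow> 'k) \<Rightarrow> 'x \<Rightarrow> 'k) set" where
  "unip = {u. (\<forall>f. f \<notin> total \<longrightarrow> u f = 0) \<and>
              (\<forall>f\<in>total. \<forall>g\<in>total. u (f + g) = u f + u g) \<and>
              (\<forall>f\<in>total. \<forall>c. u (\<lambda>x. c * f x) = (\<lambda>x. c * u f x)) \<and>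
              (\<forall>n. \<forall>f\<in>V (Suc n). u f - f \<in> V n)}"

definition nilp :: "(('x \<Rightarrow> 'k) \<Rightarrow> 'x \<Rightarrow> 'k) \<Rightarrow> ('x \<Rightarrow> 'k) \<Rightarrow> 'x \<Rightarrow> 'k" where
  "nilp u f = u f - f"

text \<open>
  The binomial series of \<open>(1 + (u - 1))^a\<close>. On a function of level \<open>n\<close> the powers of \<open>u - 1\<close>
  from the \<open>n\<close>-th on vanish; any admissible \<open>n\<close> gives the same value (\<open>upow_eq\<close>), and the
  least one is a canonical choice.
\<close>

definition upow :: "(('x \<Rightarrow> 'k) \<Rightarrow> 'x \<Rightarrow> 'k) \<Rightarrow> 'k \<Rightarrow> ('x \<Rightarrow> 'k) \<Rightarrow> 'x \<Rightarrow> 'k" where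
  "upow u a f = (if f \<in> total
     then (\<lambda>x. \<Sum>k<(LEAST n. f \<in> V n). (a gchoose k) * (nilp u ^^ k) f x) else 0)"

lemma V_mono: "m \<le> n \<Longrightarrow> f \<in> V m \<Longrightarrow> f \<in> V n"
  by (induction n rule: dec_induct) (auto intro: V_Suc)

lemma zero_V: "0 \<in> V n"
  using V_mono[of 0 n 0] V_0 by simp

lemma V_total: "f \<in> V n \<Longrightarrow> f \<in> total"
  by (auto simp: total_def)

lemma total_common: "f \<in> total \<Longrightarrow> g \<in> total \<Longrightarrow> \<exists>n. f \<in> V n \<and> g \<in> V n"
  unfolding total_def using V_mono by (metis UN_E nat_le_linear)

lemma V_sum: "(\<And>k. k \<in> I \<Longrightarrow> g k \<in> V n) \<Longrightarrow> (\<lambda>x. \<Sum>k\<in>I. c k * g k x) \<in> V n"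
proof (induction I rule: infinite_finite_induct)
  case (insert i I)
  then have "(\<lambda>x. c i * g i x) + (\<lambda>x. \<Sum>k\<in>I. c k * g k x) \<in> V n"
    by (intro V_add V_scale) auto
  then show ?case using insert.hyps by (simp add: plus_fun_def)
qed (use zero_V in \<open>auto simp: zero_fun_def\<close>)

lemma unip_add: "u \<in> unip \<Longrightarrow> f \<in> total \<Longrightarrow> g \<in> total \<Longrightarrow> u (f + g) = u f + u g"
  by (simp add: unip_def)

lemma unip_scale: "u \<in> unip \<Longrightarrow> f \<in> total \<Longrightarrow> u (\<lambda>x. c * f x) = (\<lambda>x. c * u f x)"
  by (simp add: unip_def)

lemma unip_outside: "u \<in> unip \<Longrightarrow> f \<notin> total \<Longrightarrow> u f = 0"
  by (simp add: unip_def)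

lemma unip_zero: "u \<in> unip \<Longrightarrow> u 0 = 0"
  using unip_scale[of u 0 0] V_total[OF zero_V] by (simp add: zero_fun_def)

lemma nilp_V: "u \<in> unip \<Longrightarrow> f \<in> V n \<Longrightarrow> nilp u f \<in> V (n - 1)"
  by (cases n) (auto simp: nilp_def V_0 unip_zero unip_def)

lemma unip_V: "u \<in> unip \<Longrightarrow> f \<in> V n \<Longrightarrow> u f \<in> V n"
  using V_add[of f n "nilp u f"] nilp_V[of u f n] V_mono[of "n - 1" n] by (simp add: nilp_def)

lemma unip_total: "u \<in> unip \<Longrightarrow> f \<in> total \<Longrightarrow> u f \<in> total"
  using unip_V unfolding total_def by blast

lemma unip_sum:
  assumes u: "u \<in> unip" and g: "\<And>k. k \<in> I \<Longrightarrow> g k \<in> total"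
  shows "u (\<lambda>x. \<Sum>k\<in>I. c k * g k x) = (\<lambda>x. \<Sum>k\<in>I. c k * u (g k) x)"
proof (cases "finite I")
  case True
  then show ?thesis using g
  proof (induction I)
    case empty
    then show ?case using unip_zero[OF u] by (simp add: zero_fun_def)
  next
    case (insert i I)
    have "finite I \<Longrightarrow> (\<And>k. k \<in> I \<Longrightarrow> g k \<in> total) \<Longrightarrow> \<exists>n. \<forall>k\<in>I. g k \<in> V n"
    proof (induction I rule: finite_induct)
      case (insert i I)
      then obtain n where "\<forall>k\<in>I. g k \<in> V n" by auto
      moreover obtain m where "g i \<in> V m" using insert.prems[of i] by (auto simp: total_def)
      ultimately show ?case by (intro exI[of _ "max n m"]) (auto intro: V_mono[rotated])
    qed auto
    with insert obtain n where "\<forall>k\<in>I. g k \<in> V n" by auto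
    then have "(\<lambda>x. \<Sum>k\<in>I. c k * g k x) \<in> total"
      by (intro V_total[of _ n] V_sum) auto
    moreover have "(\<lambda>x. c i * g i x) \<in> total"
      using insert.prems[of i] V_scale unfolding total_def by blast
    ultimately have "u ((\<lambda>x. c i * g i x) + (\<lambda>x. \<Sum>k\<in>I. c k * g k x)) =
        u (\<lambda>x. c i * g i x) + u (\<lambda>x. \<Sum>k\<in>I. c k * g k x)"
      by (intro unip_add[OF u])
    then show ?case
      using insert unip_scale[OF u, of "g i" "c i"] by (simp add: plus_fun_def)
  qed
next
  case False
  then show ?thesis using unip_zero[OF u] by (simp add: zero_fun_def)
qed

lemma nilp_power_V: "u \<in> unip \<Longrightarrow> f \<in> V n \<Longrightarrow> (nilp u ^^ k) f \<in> V (n - k)"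
proof (induction k)
  case (Suc k)
  then show ?case using nilp_V[of u "(nilp u ^^ k) f" "n - k"] by simp
qed simp

lemma nilp_power_0: "u \<in> unip \<Longrightarrow> f \<in> V n \<Longrightarrow> n \<le> k \<Longrightarrow> (nilp u ^^ k) f = 0"
  using nilp_power_V[of u f n k] by (simp add: V_0)

lemma nilp_power_total: "u \<in> unip \<Longrightarrow> f \<in> total \<Longrightarrow> (nilp u ^^ k) f \<in> total"
  using nilp_power_V unfolding total_def by blast

lemma upow_eq:
  assumes u: "u \<in> unip" and f: "f \<in> V n"
  shows "upow u a f = (\<lambda>x. \<Sum>k<n. (a gchoose k) * (nilp u ^^ k) f x)"
proof -
  define m where "m = (LEAST n. f \<in> V n)"
  have m: "f \<in> V m" "m \<le> n" using f unfolding m_def by (auto intro: LeastI Least_le)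
  have "(\<Sum>k<m. (a gchoose k) * (nilp u ^^ k) f x) = (\<Sum>k<n. (a gchoose k) * (nilp u ^^ k) f x)" for x
    using m nilp_power_0[OF u m(1)] by (intro sum.mono_neutral_left) auto
  then show ?thesis using V_total[OF f] by (simp add: upow_def m_def)
qed

lemma upow_outside: "f \<notin> total \<Longrightarrow> upow u a f = 0"
  by (simp add: upow_def)

lemma nilp_power_add:
  "u \<in> unip \<Longrightarrow> f \<in> total \<Longrightarrow> g \<in> total \<Longrightarrow>
    (nilp u ^^ k) (f + g) = (nilp u ^^ k) f + (nilp u ^^ k) g"
proof (induction k)
  case (Suc k)
  let ?f = "(nilp u ^^ k) f" and ?g = "(nilp u ^^ k) g"
  have "(nilp u ^^ Suc k) (f + g) = nilp u (?f + ?g)"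
    using Suc by (simp only: funpow.simps o_apply)
  also have "\<dots> = nilp u ?f + nilp u ?g"
    using unip_add[of u ?f ?g] Suc.prems nilp_power_total by (simp add: nilp_def fun_eq_iff)
  finally show ?case by (simp only: funpow.simps o_apply)
qed simp

lemma nilp_power_scale:
  "u \<in> unip \<Longrightarrow> f \<in> total \<Longrightarrow> (nilp u ^^ k) (\<lambda>x. c * f x) = (\<lambda>x. c * (nilp u ^^ k) f x)"
proof (induction k)
  case (Suc k)
  let ?f = "(nilp u ^^ k) f"
  have "(nilp u ^^ Suc k) (\<lambda>x. c * f x) = nilp u (\<lambda>x. c * ?f x)" using Suc by simp
  also have "\<dots> = (\<lambda>x. c * nilp u ?f x)"
    using unip_scale[of u ?f c] Suc.prems nilp_power_total
    by (simp add: nilp_def fun_eq_iff algebra_simps)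
  finally show ?case by simp
qed simp

lemma upow_unip:
  assumes u: "u \<in> unip"
  shows "upow u a \<in> unip"
  unfolding unip_def
proof (intro CollectI conjI allI ballI impI)
  fix f g assume fg: "f \<in> total" "g \<in> total"
  then obtain n where n: "f \<in> V n" "g \<in> V n" using total_common by blast
  show "upow u a (f + g) = upow u a f + upow u a g"
    using fg n V_add[OF n]
    by (simp add: upow_eq[OF u] nilp_power_add[OF u] fun_eq_iff algebra_simps sum.distrib)
next
  fix f c assume "f \<in> total"
  then obtain n where n: "f \<in> V n" by (auto simp: total_def)
  show "upow u a (\<lambda>x. c * f x) = (\<lambda>x. c * upow u a f x)"
    using n V_scale[OF n] V_total[OF n]
    by (simp add: upow_eq[OF u, of _ n] nilp_power_scale[OF u] fun_eq_iff algebra_simps sum_distrib_left)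
next
  fix n f assume f: "f \<in> V (Suc n)"
  have "upow u a f - f = (\<lambda>x. \<Sum>k<n. (a gchoose Suc k) * (nilp u ^^ Suc k) f x)"
    by (simp add: upow_eq[OF u f] fun_eq_iff sum.lessThan_Suc_shift
        del: funpow.simps sum.lessThan_Suc)
  also have "\<dots> \<in> V n"
  proof (rule V_sum)
    fix k show "(nilp u ^^ Suc k) f \<in> V n"
      using nilp_power_V[OF u f, of "Suc k"] V_mono[of "n - k" n] by simp
  qed
  finally show "upow u a f - f \<in> V n" .
qed (simp add: upow_outside)

lemma upow_zero: "u \<in> unip \<Longrightarrow> f \<in> total \<Longrightarrow> upow u 0 f = f"
proof -
  assume u: "u \<in> unip" and "f \<in> total"
  then obtain n where "f \<in> V (Suc n)" using V_Suc by (auto simp: total_def)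
  from upow_eq[OF u this] show ?thesis by (simp add: sum.lessThan_Suc_shift del: sum.lessThan_Suc)
qed

text \<open>
  Pascal's rule.
\<close>

lemma upow_Suc:
  assumes u: "u \<in> unip" and f: "f \<in> total"
  shows "u (upow u a f) = upow u (a + 1) f"
proof -
  obtain n where n: "f \<in> V n" using f by (auto simp: total_def)
  let ?N = "\<lambda>k. (nilp u ^^ k) f"
  have N: "u (?N k) = ?N k + ?N (Suc k)" for k by (simp add: nilp_def)
  have "u (upow u a f) x = upow u (a + 1) f x" for x
  proof -
    have "u (upow u a f) x = (\<Sum>k<n. (a gchoose k) * (?N k x + ?N (Suc k) x))"
      unfolding upow_eq[OF u n]
      by (subst unip_sum[OF u]) (auto simp: N nilp_power_total[OF u f] simp del: funpow.simps)
    also have "\<dots> = (\<Sum>k<Suc n. (a gchoose k) * ?N k x) + (\<Sum>k<n. (a gchoose k) * ?N (Suc k) x)"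
      using nilp_power_0[OF u n, of n] by (simp add: algebra_simps sum.distrib)
    also have "\<dots> = (\<Sum>k<Suc n. ((a + 1) gchoose k) * ?N k x)"
      by (simp add: sum.lessThan_Suc_shift[of _ n] gbinomial_Suc_Suc distrib_right sum.distrib
          del: funpow.simps sum.lessThan_Suc)
    also have "\<dots> = upow u (a + 1) f x"
      by (simp only: upow_eq[OF u V_Suc[OF n]])
    finally show ?thesis .
  qed
  then show ?thesis by (rule ext)
qed

lemma is_poly_upow:
  assumes u: "u \<in> unip"
  shows "is_poly (\<lambda>a. upow u a f x)"
proof (cases "f \<in> total")
  case True
  then obtain n where n: "f \<in> V n" by (auto simp: total_def)
  show ?thesis unfolding upow_eq[OF u n]
    by (intro is_poly_sum is_poly_mult is_poly_gchoose is_poly_const)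
qed (simp add: upow_outside is_poly_const)

lemma upow_one: "u \<in> unip \<Longrightarrow> upow u 1 = u"
proof
  fix f assume u: "u \<in> unip"
  show "upow u 1 f = u f"
    using upow_Suc[OF u, of f 0] upow_zero[OF u, of f] unip_outside[OF u, of f] upow_outside[of f u 1]
    by (cases "f \<in> total") auto
qed

text \<open>
  For natural \<open>a\<close> this is an induction by Pascal's rule; both sides are polynomial in \<open>a\<close>.
\<close>

lemma upow_add:
  assumes u: "u \<in> unip"
  shows "upow u (a + b) f = upow u a (upow u b f)"
proof (cases "f \<in> total")
  case True
  note up = upow_unip[OF u]
  have tot: "upow u b f \<in> total" by (rule unip_total[OF up True])
  have nat: "upow u (of_nat n + b) f = upow u (of_nat n) (upow u b f)" for n
  proof (induction n)
    case 0
    then show ?case using upow_zero[OF u tot] by simp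
  next
    case (Suc n)
    have "upow u (of_nat (Suc n) + b) f = u (upow u (of_nat n + b) f)"
      using upow_Suc[OF u True, of "of_nat n + b"] by (simp add: algebra_simps)
    also have "\<dots> = upow u (of_nat n + 1) (upow u b f)"
      using Suc upow_Suc[OF u tot] by simp
    finally show ?case by (simp add: add.commute)
  qed
  have "is_poly (\<lambda>a. upow u (a + b) f x)" for x
    using is_poly_compose[OF is_poly_upow[OF u, of f x] is_poly_affine[of b 1]] by (simp add: add.commute)
  then have "upow u (a + b) f x = upow u a (upow u b f) x" for x
    by (rule is_poly_eqI[OF _ is_poly_upow[OF u]]) (simp add: nat)
  then show ?thesis by (rule ext)
next
  case False
  then show ?thesis using unip_zero[OF upow_unip[OF u]] by (simp add: upow_outside)
qed

text \<open>
  The exponents enter through a map \<open>e\<close> from the exponent ring to the field.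
\<close>

definition unip_group :: "('r \<Rightarrow> 'k) \<Rightarrow> (('x \<Rightarrow> 'k) \<Rightarrow> 'x \<Rightarrow> 'k, 'r) agroup" where
  "unip_group e = \<lparr>carrier = unip, monoid.mult = (\<lambda>u w f. u (w f)), one = (\<lambda>f. if f \<in> total then f else 0),
     apow = (\<lambda>u a. upow u (e a))\<rparr>"

lemma comp_unip:
  assumes u: "u \<in> unip" and w: "w \<in> unip"
  shows "(\<lambda>f. u (w f)) \<in> unip"
  unfolding unip_def
proof (intro CollectI conjI allI ballI impI)
  fix n f assume f: "f \<in> V (Suc n)"
  have "u (w f) - f = nilp u (w f) + nilp w f" by (simp add: nilp_def)
  also have "\<dots> \<in> V n"
    using nilp_V[OF u unip_V[OF w f]] nilp_V[OF w f] by (intro V_add) auto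
  finally show "u (w f) - f \<in> V n" .
next
  fix f assume "f \<notin> total"
  then show "u (w f) = 0" using unip_outside[OF w] unip_zero[OF u] by metis
next
  fix f g assume "f \<in> total" "g \<in> total"
  then show "u (w (f + g)) = u (w f) + u (w g)"
    by (simp only: unip_add[OF u] unip_add[OF w] unip_total[OF w])
qed (simp add: unip_scale[OF u] unip_scale[OF w] unip_total[OF w])

lemma one_unip: "(\<lambda>f. if f \<in> total then f else 0) \<in> unip"
proof -
  have "f + g \<in> total" if "f \<in> total" "g \<in> total" for f g
    using total_common[OF that] V_add V_total by blast
  moreover have "(\<lambda>x. c * f x) \<in> total" if "f \<in> total" for f c
    using that V_scale unfolding total_def by blast
  ultimately show ?thesis unfolding unip_def using V_total by (auto simp: zero_V fun_eq_iff)
qed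

lemma group_unip_group: "group (unip_group e)"
proof (rule groupI)
  fix u assume "u \<in> carrier (unip_group e)"
  then have u: "u \<in> unip" by (simp add: unip_group_def)
  show "\<one>\<^bsub>unip_group e\<^esub> \<otimes>\<^bsub>unip_group e\<^esub> u = u"
    using unip_total[OF u] unip_outside[OF u] V_total[OF zero_V]
    by (fastforce simp: unip_group_def fun_eq_iff)
  have "upow u (-1) (u f) = (if f \<in> total then f else 0)" for f
    using upow_add[OF u, of "-1" 1 f] upow_one[OF u] upow_zero[OF u, of f]
    by (auto simp: upow_outside)
  then show "\<exists>w\<in>carrier (unip_group e). w \<otimes>\<^bsub>unip_group e\<^esub> u = \<one>\<^bsub>unip_group e\<^esub>"
    using upow_unip[OF u, of "-1"] by (auto simp: unip_group_def)
qed (auto simp: unip_group_def comp_unip one_unip)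

text \<open>
  The laws for \<open>u^(a b)\<close> and for products of commuting operators hold for natural exponents by
  induction, and both sides, applied to a function and evaluated at a point, are polynomial in
  the exponent. The law for conjugates holds term by term in the binomial series.
\<close>

theorem A_group_unip_group:
  fixes e :: "'r::ring_1 \<Rightarrow> 'k"
  assumes e: "e 0 = 0" "e 1 = 1" "\<And>a b. e (a + b) = e a + e b" "\<And>a b. e (a * b) = e a * e b"
  shows "A_group (unip_group e)"
proof -
  interpret U: group "unip_group e" by (rule group_unip_group)
  have one: "\<one>\<^bsub>unip_group e\<^esub> = (\<lambda>f. if f \<in> total then f else 0)" by (simp add: unip_group_def)
  have carr: "carrier (unip_group e) = unip" by (simp add: unip_group_def)
  have mul: "u \<otimes>\<^bsub>unip_group e\<^esub> w = (\<lambda>f. u (w f))" for u w by (simp add: unip_group_def)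
  have pow: "u \<up>\<^bsub>unip_group e\<^esub> a = upow u (e a)" for u a by (simp add: unip_group_def)
  have zero: "upow u 0 = \<one>\<^bsub>unip_group e\<^esub>" if "u \<in> unip" for u
    using upow_zero[OF that] by (auto simp: one upow_outside)
  have mult: "upow u (a * b) = upow (upow u a) b" if u: "u \<in> unip" for u a b
  proof (intro ext)
    fix f x
    have nat: "upow u (a * of_nat n) = upow (upow u a) (of_nat n)" for n
    proof (induction n)
      case 0
      then show ?case using zero u upow_unip by simp
    next
      case (Suc n)
      show ?case
      proof
        fix f
        have "upow u (a * of_nat (Suc n)) f = upow u a (upow u (a * of_nat n) f)"
          using upow_add[OF u, of a "a * of_nat n" f] by (simp add: algebra_simps)
        also have "\<dots> = upow (upow u a) (of_nat (Suc n)) f"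
          using upow_add[OF upow_unip[OF u, of a], of 1 "of_nat n" f] upow_one[OF upow_unip[OF u, of a]] Suc
          by (simp add: algebra_simps)
        finally show "upow u (a * of_nat (Suc n)) f = upow (upow u a) (of_nat (Suc n)) f" .
      qed
    qed
    have "is_poly (\<lambda>b. upow u (a * b) f x)"
      using is_poly_compose[OF is_poly_upow[OF u, of f x] is_poly_affine[of 0 a]] by simp
    then show "upow u (a * b) f x = upow (upow u a) b f x"
      by (rule is_poly_eqI[OF _ is_poly_upow[OF upow_unip[OF u]]]) (simp add: nat)
  qed
  have comm: "upow (\<lambda>f. u (w f)) a = (\<lambda>f. upow u a (upow w a f))"
    if u: "u \<in> unip" and w: "w \<in> unip" and uw: "\<And>f. u (w f) = w (u f)" for u w a
  proof (intro ext)
    fix f x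
    have uw': "u (upow w (of_nat n) f) = upow w (of_nat n) (u f)" for n f
    proof (induction n arbitrary: f)
      case 0
      show ?case
      proof (cases "f \<in> total")
        case False
        then show ?thesis
          using V_total[OF zero_V] unip_zero[OF u] unip_outside[OF u False]
          by (simp only: zero[OF w] one of_nat_0 if_False if_True)
      qed (simp add: zero[OF w] one unip_total[OF u])
    next
      case (Suc n)
      have S: "upow w (of_nat (Suc n)) f = w (upow w (of_nat n) f)" for f
        using upow_add[OF w, of 1 "of_nat n" f] upow_one[OF w] by (simp add: algebra_simps)
      show ?case using Suc uw by (simp add: S del: of_nat_Suc)
    qed
    have nat: "upow (\<lambda>f. u (w f)) (of_nat n) = (\<lambda>f. upow u (of_nat n) (upow w (of_nat n) f))" for n
    proof (induction n)
      case 0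
      then show ?case using V_total[OF zero_V]
        by (simp add: zero[OF u] zero[OF w] zero[OF comp_unip[OF u w]] one fun_eq_iff)
    next
      case (Suc n)
      have S: "upow v (of_nat (Suc n)) f = v (upow v (of_nat n) f)" "upow v (of_nat (Suc n)) f = upow v (of_nat n) (v f)"
        if "v \<in> unip" for v f
        using upow_add[OF that, of 1 "of_nat n" f] upow_add[OF that, of "of_nat n" 1 f] upow_one[OF that]
        by (simp_all add: algebra_simps)
      show ?case
      proof
        fix f
        have "upow (\<lambda>f. u (w f)) (of_nat (Suc n)) f = upow u (of_nat n) (upow w (of_nat n) (u (w f)))"
          using S(2)[OF comp_unip[OF u w], of f] Suc by (simp del: of_nat_Suc)
        also have "\<dots> = upow u (of_nat (Suc n)) (upow w (of_nat (Suc n)) f)"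
          by (simp only: S(2)[OF u] S(2)[OF w] uw')
        finally show "upow (\<lambda>f. u (w f)) (of_nat (Suc n)) f =
          upow u (of_nat (Suc n)) (upow w (of_nat (Suc n)) f)" .
      qed
    qed
    have wf: "upow w a f = (\<lambda>x. \<Sum>k<n. (a gchoose k) * (nilp w ^^ k) f x)" if "f \<in> V n" for a n
      using upow_eq[OF w that] .
    have "is_poly (\<lambda>a. upow u a (upow w a f) x)"
    proof (cases "f \<in> total")
      case True
      then obtain n where n: "f \<in> V n" by (auto simp: total_def)
      have "upow u a (upow w a f) x = (\<Sum>k<n. (a gchoose k) * upow u a ((nilp w ^^ k) f) x)" for a
        unfolding wf[OF n] by (subst unip_sum[OF upow_unip[OF u]]) (auto simp: nilp_power_total[OF w True])
      then show ?thesis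
        by (auto intro!: is_poly_sum is_poly_mult is_poly_gchoose is_poly_upow[OF u])
    next
      case False
      then show ?thesis using unip_zero[OF upow_unip[OF u]] by (simp add: upow_outside is_poly_const)
    qed
    with is_poly_upow[OF comp_unip[OF u w]]
    show "upow (\<lambda>f. u (w f)) a f x = upow u a (upow w a f) x"
      by (rule is_poly_eqI) (simp add: nat)
  qed
  have conj: "upow (\<lambda>f. w' (u (w f))) a = (\<lambda>f. w' (upow u a (w f)))"
    if u: "u \<in> unip" and w: "w \<in> unip" "w' \<in> unip" and w': "\<And>f. f \<in> total \<Longrightarrow> w (w' f) = f"
      "\<And>f. f \<in> total \<Longrightarrow> w' (w f) = f" for u w w' a
  proof
    fix f
    have c: "(\<lambda>f. w' (u (w f))) \<in> unip" by (rule comp_unip[OF w(2) comp_unip[OF u w(1)]])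
    show "upow (\<lambda>f. w' (u (w f))) a f = w' (upow u a (w f))"
    proof (cases "f \<in> total")
      case True
      then obtain n where n: "f \<in> V n" by (auto simp: total_def)
      have tot: "(nilp u ^^ k) (w f) \<in> total" for k
        using nilp_power_total[OF u unip_total[OF w(1) True]] .
      have "(nilp (\<lambda>f. w' (u (w f))) ^^ k) f = w' ((nilp u ^^ k) (w f))" for k
      proof (induction k)
        case (Suc k)
        have "w' (u ((nilp u ^^ k) (w f))) = w' (nilp u ((nilp u ^^ k) (w f)) + (nilp u ^^ k) (w f))"
          by (simp add: nilp_def)
        also have "\<dots> = w' (nilp u ((nilp u ^^ k) (w f))) + w' ((nilp u ^^ k) (w f))"
          using nilp_power_total[OF u unip_total[OF w(1) True], of "Suc k"] tot
          by (intro unip_add[OF w(2)]) auto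
        finally have "nilp (\<lambda>f. w' (u (w f))) (w' ((nilp u ^^ k) (w f))) = w' (nilp u ((nilp u ^^ k) (w f)))"
          using tot by (simp add: nilp_def[of "\<lambda>f. w' (u (w f))"] w')
        then show ?case using Suc by simp
      qed (simp add: w' True)
      then show ?thesis
        unfolding upow_eq[OF u unip_V[OF w(1) n]] upow_eq[OF c n]
        by (subst unip_sum[OF w(2)]) (auto simp: tot)
    next
      case False
      then show ?thesis
        by (simp only: upow_outside[OF False] unip_outside[OF w(1) False]
            unip_zero[OF upow_unip[OF u]] unip_zero[OF w(2)])
    qed
  qed
  show ?thesis
  proof (intro A_group.intro A_group_axioms.intro)
    fix u w a assume uw: "u \<in> carrier (unip_group e)" "w \<in> carrier (unip_group e)"
    let ?w' = "inv\<^bsub>unip_group e\<^esub> w"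
    have "w (?w' f) = f" "?w' (w f) = f" if "f \<in> total" for f
      using U.r_inv[OF uw(2)] U.l_inv[OF uw(2)] that by (auto simp: mul one fun_eq_iff)
    then show "(?w' \<otimes>\<^bsub>unip_group e\<^esub> u \<otimes>\<^bsub>unip_group e\<^esub> w) \<up>\<^bsub>unip_group e\<^esub> a =
        ?w' \<otimes>\<^bsub>unip_group e\<^esub> u \<up>\<^bsub>unip_group e\<^esub> a \<otimes>\<^bsub>unip_group e\<^esub> w"
      unfolding mul pow using uw U.inv_closed[OF uw(2)] by (subst conj[of u w ?w']) (auto simp: carr)
  next
    fix u w a assume uw: "u \<in> carrier (unip_group e)" "w \<in> carrier (unip_group e)"
      and "commutator (unip_group e) u w = \<one>\<^bsub>unip_group e\<^esub>"
    then have "u (w f) = w (u f)" for f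
      using U.commutator_eq_one_iff[OF uw] by (simp add: mul fun_eq_iff)
    then show "(u \<otimes>\<^bsub>unip_group e\<^esub> w) \<up>\<^bsub>unip_group e\<^esub> a =
        u \<up>\<^bsub>unip_group e\<^esub> a \<otimes>\<^bsub>unip_group e\<^esub> w \<up>\<^bsub>unip_group e\<^esub> a"
      unfolding mul pow using uw by (intro comm) (auto simp: carr)
  next
    fix a
    have one': "\<one>\<^bsub>unip_group e\<^esub> \<in> unip" using U.one_closed carr by simp
    have k: "(nilp \<one>\<^bsub>unip_group e\<^esub> ^^ k) f = (if k = 0 then f else 0)" if "f \<in> total" for k f
      by (induction k) (use that V_total[OF zero_V] in \<open>auto simp: one nilp_def\<close>)
    show "\<one>\<^bsub>unip_group e\<^esub> \<up>\<^bsub>unip_group e\<^esub> a = \<one>\<^bsub>unip_group e\<^esub>"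
      unfolding pow
    proof (intro ext)
      fix f x
      show "upow \<one>\<^bsub>unip_group e\<^esub> (e a) f x = \<one>\<^bsub>unip_group e\<^esub> f x"
      proof (cases "f \<in> total")
        case True
        then obtain n where "f \<in> V (Suc n)" using V_Suc by (auto simp: total_def)
        from upow_eq[OF one' this] show ?thesis
          using True by (simp add: k sum.lessThan_Suc_shift del: sum.lessThan_Suc funpow.simps) (simp add: one)
      qed (simp add: upow_outside one)
    qed
next
    show "group (unip_group e)" by (rule U.group_axioms)
  next fix g a assume "g \<in> carrier (unip_group e)" then show "g \<up>\<^bsub>unip_group e\<^esub> a \<in> carrier (unip_group e)" by (simp add: carr pow upow_unip)
  next fix g a assume "g \<in> carrier (unip_group e)" then show "g \<up>\<^bsub>unip_group e\<^esub> 1 = g" by (simp add: carr pow upow_one e)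
  next fix g a assume "g \<in> carrier (unip_group e)" then show "g \<up>\<^bsub>unip_group e\<^esub> 0 = \<one>\<^bsub>unip_group e\<^esub>" by (simp add: carr pow zero e)
  next fix g a b assume "g \<in> carrier (unip_group e)" then show "g \<up>\<^bsub>unip_group e\<^esub> (a + b) = g \<up>\<^bsub>unip_group e\<^esub> a \<otimes>\<^bsub>unip_group e\<^esub> g \<up>\<^bsub>unip_group e\<^esub> b" by (simp add: carr mul pow upow_add e fun_eq_iff)
  next fix g a b assume "g \<in> carrier (unip_group e)" then show "g \<up>\<^bsub>unip_group e\<^esub> (a * b) = (g \<up>\<^bsub>unip_group e\<^esub> a) \<up>\<^bsub>unip_group e\<^esub> b" by (simp add: carr pow mult e)
  qed
qed

text \<open>
  Translations and conjugations act on functions by the substitution of \<open>a x\<close> for \<open>x\<close>. The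
  functions live on a subset \<open>X\<close> of the type and are kept 0 outside.
\<close>

definition pull :: "'x set \<Rightarrow> ('x \<Rightarrow> 'x) \<Rightarrow> ('x \<Rightarrow> 'k) \<Rightarrow> 'x \<Rightarrow> 'k" where
  "pull X a f = (if f \<in> total then (\<lambda>x. if x \<in> X then f (a x) else 0) else 0)"

lemma pull_unip:
  assumes van: "\<And>n f x. f \<in> V n \<Longrightarrow> x \<notin> X \<Longrightarrow> f x = 0"
    and diff: "\<And>n f. f \<in> V (Suc n) \<Longrightarrow> (\<lambda>x. if x \<in> X then f (a x) - f x else 0) \<in> V n"
  shows "pull X a \<in> unip"
  unfolding unip_def
proof (intro CollectI conjI allI ballI impI)
  fix f g assume fg: "f \<in> total" "g \<in> total"
  then have "f + g \<in> total" using total_common V_add V_total by blast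
  with fg show "pull X a (f + g) = pull X a f + pull X a g"
    by (simp add: pull_def fun_eq_iff)
next
  fix f c assume f: "f \<in> total"
  then have "(\<lambda>x. c * f x) \<in> total" using V_scale unfolding total_def by blast
  with f show "pull X a (\<lambda>x. c * f x) = (\<lambda>x. c * pull X a f x)"
    by (simp add: pull_def fun_eq_iff)
next
  fix n f assume f: "f \<in> V (Suc n)"
  have "pull X a f - f = (\<lambda>x. if x \<in> X then f (a x) - f x else 0)"
    using van[OF f] V_total[OF f] by (auto simp: pull_def fun_eq_iff)
  with diff[OF f] show "pull X a f - f \<in> V n" by simp
qed (simp add: pull_def)

lemma pull_comp:
  assumes "pull X b \<in> unip" "\<And>x. x \<in> X \<Longrightarrow> a x \<in> X"
  shows "pull X a (pull X b f) = pull X (\<lambda>x. b (a x)) f"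
proof (cases "f \<in> total")
  case True
  then show ?thesis
    using unip_total[OF assms(1) True] assms(2) by (simp add: pull_def fun_eq_iff)
next
  case False
  then show ?thesis by (simp add: pull_def fun_eq_iff)
qed

end


section \<open>Polynomial functions on a group\<close>

text \<open>
  The index exceeds the usual degree by one: level 0 consists of the functions that vanish on
  the group, and level 1 of the constants.
\<close>

primrec pol_fun :: "('g, 'm) monoid_scheme \<Rightarrow> nat \<Rightarrow> ('g \<Rightarrow> 'k::comm_ring_1) set" where
  "pol_fun G 0 = {f. \<forall>x\<in>carrier G. f x = 0}"
| "pol_fun G (Suc n) = {f. \<forall>h\<in>carrier G. (\<lambda>x. f (x \<otimes>\<^bsub>G\<^esub> h) - f x) \<in> pol_fun G n}"

context group
begin

lemma pol_fun_cong:
  "f \<in> pol_fun G n \<Longrightarrow> (\<And>x. x \<in> carrier G \<Longrightarrow> f x = g x) \<Longrightarrow> g \<in> pol_fun G n"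
proof (induction n arbitrary: f g)
  case (Suc n)
  show ?case unfolding pol_fun.simps
  proof (intro CollectI ballI)
    fix h assume h: "h \<in> carrier G"
    with Suc.prems(1) have "(\<lambda>x. f (x \<otimes> h) - f x) \<in> pol_fun G n" by simp
    then show "(\<lambda>x. g (x \<otimes> h) - g x) \<in> pol_fun G n"
      by (rule Suc.IH) (use h Suc.prems(2) in auto)
  qed
qed auto

lemma pol_fun_zero: "(\<lambda>x. 0) \<in> pol_fun G n"
  by (induction n) auto

lemma pol_fun_add: "f \<in> pol_fun G n \<Longrightarrow> g \<in> pol_fun G n \<Longrightarrow> (\<lambda>x. f x + g x) \<in> pol_fun G n"
proof (induction n arbitrary: f g)
  case (Suc n)
  have "(\<lambda>x. (f (x \<otimes> h) - f x) + (g (x \<otimes> h) - g x)) \<in> pol_fun G n" if "h \<in> carrier G" for h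
    using Suc that by auto
  then show ?case by (simp add: algebra_simps)
qed auto

lemma pol_fun_scale: "f \<in> pol_fun G n \<Longrightarrow> (\<lambda>x. c * f x) \<in> pol_fun G n"
proof (induction n arbitrary: f)
  case (Suc n)
  have "(\<lambda>x. c * (f (x \<otimes> h) - f x)) \<in> pol_fun G n" if "h \<in> carrier G" for h
    using Suc that by auto
  then show ?case by (simp add: algebra_simps)
qed auto

lemma pol_fun_uminus: "f \<in> pol_fun G n \<Longrightarrow> (\<lambda>x. - f x) \<in> pol_fun G n"
  using pol_fun_scale[of f n "-1"] by simp

lemma pol_fun_diff: "f \<in> pol_fun G n \<Longrightarrow> g \<in> pol_fun G n \<Longrightarrow> (\<lambda>x. f x - g x) \<in> pol_fun G n"
  using pol_fun_add[of f n "\<lambda>x. - g x"] pol_fun_uminus[of g n] by simp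

lemma pol_fun_sum:
  "(\<And>i. i \<in> I \<Longrightarrow> f i \<in> pol_fun G n) \<Longrightarrow> (\<lambda>x. \<Sum>i\<in>I. f i x) \<in> pol_fun G n"
  by (induction I rule: infinite_finite_induct) (auto intro: pol_fun_add pol_fun_zero)

lemma pol_fun_const: "(\<lambda>x. c) \<in> pol_fun G (Suc n)"
  by (simp add: pol_fun_zero)

lemma pol_fun_Suc: "f \<in> pol_fun G n \<Longrightarrow> f \<in> pol_fun G (Suc n)"
  by (induction n arbitrary: f) auto

lemma pol_fun_mono: "m \<le> n \<Longrightarrow> f \<in> pol_fun G m \<Longrightarrow> f \<in> pol_fun G n"
  by (induction n rule: dec_induct) (auto intro: pol_fun_Suc simp del: pol_fun.simps)

lemma pol_fun_difference:
  "f \<in> pol_fun G (Suc n) \<Longrightarrow> h \<in> carrier G \<Longrightarrow> (\<lambda>x. f (x \<otimes> h) - f x) \<in> pol_fun G n"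
  by simp

lemma pol_fun_right_translate:
  assumes "f \<in> pol_fun G n" "a \<in> carrier G"
  shows "(\<lambda>x. f (x \<otimes> a)) \<in> pol_fun G n"
proof -
  have "(\<lambda>x. f (x \<otimes> a) - f x) \<in> pol_fun G n"
    using pol_fun_difference[OF pol_fun_Suc[OF assms(1)] assms(2)] .
  from pol_fun_add[OF assms(1) this] show ?thesis by simp
qed

lemma pol_fun_left_translate:
  "f \<in> pol_fun G n \<Longrightarrow> a \<in> carrier G \<Longrightarrow> (\<lambda>x. f (a \<otimes> x)) \<in> pol_fun G n"
proof (induction n arbitrary: f)
  case (Suc n)
  show ?case unfolding pol_fun.simps
  proof (intro CollectI ballI)
    fix h assume h: "h \<in> carrier G"
    from Suc.IH[OF pol_fun_difference[OF Suc.prems(1) h] Suc.prems(2)]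
    show "(\<lambda>x. f (a \<otimes> (x \<otimes> h)) - f (a \<otimes> x)) \<in> pol_fun G n"
      by (rule pol_fun_cong) (use h Suc.prems(2) in \<open>simp add: m_assoc\<close>)
  qed
qed auto

text \<open>
  Leibniz's rule \<open>f' g' - f g = (f' - f) g' + f (g' - g)\<close>; one is subtracted because both
  indices exceed the degree by one.
\<close>

lemma pol_fun_mult:
  "f \<in> pol_fun G a \<Longrightarrow> g \<in> pol_fun G b \<Longrightarrow> (\<lambda>x. f x * g x) \<in> pol_fun G (a + b - 1)"
proof (induction "a + b" arbitrary: a b f g rule: less_induct)
  case less
  show ?case
  proof (cases "a = 0 \<or> b = 0")
    case True
    then have "f x * g x = 0" if "x \<in> carrier G" for x
      using less.prems that by (auto simp: mult_zero_left)
    then show ?thesis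
      using pol_fun_cong[OF pol_fun_zero, of "\<lambda>x. f x * g x"] by simp
  next
    case False
    then obtain a' b' where ab: "a = Suc a'" "b = Suc b'" by (metis not0_implies_Suc)
    have "(\<lambda>x. f (x \<otimes> h) * g (x \<otimes> h) - f x * g x) \<in> pol_fun G (a' + b')" if h: "h \<in> carrier G" for h
    proof -
      have "(\<lambda>x. (f (x \<otimes> h) - f x) * g (x \<otimes> h)) \<in> pol_fun G (a' + b - 1)"
        using less.prems ab h by (intro less.hyps pol_fun_difference pol_fun_right_translate) auto
      moreover have "(\<lambda>x. f x * (g (x \<otimes> h) - g x)) \<in> pol_fun G (a + b' - 1)"
        using less.prems ab h by (intro less.hyps pol_fun_difference) auto
      ultimately have "(\<lambda>x. (f (x \<otimes> h) - f x) * g (x \<otimes> h) + f x * (g (x \<otimes> h) - g x)) \<in> pol_fun G (a' + b')"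
        using ab by (intro pol_fun_add) auto
      then show ?thesis by (simp add: algebra_simps)
    qed
    then show ?thesis by (simp add: ab)
  qed
qed

lemma pol_fun_mult_Suc:
  "f \<in> pol_fun G (Suc a) \<Longrightarrow> g \<in> pol_fun G (Suc b) \<Longrightarrow> (\<lambda>x. f x * g x) \<in> pol_fun G (Suc (a + b))"
  using pol_fun_mult[of f "Suc a" g "Suc b"] by (simp del: pol_fun.simps)

lemma pol_fun_prod:
  "(\<And>i. i \<in> I \<Longrightarrow> \<exists>n. f i \<in> pol_fun G n) \<Longrightarrow> \<exists>n. (\<lambda>x. \<Prod>i\<in>I. f i x) \<in> pol_fun G n"
proof (induction I rule: infinite_finite_induct)
  case (insert i I)
  obtain m where m: "f i \<in> pol_fun G m" using insert.prems by blast
  obtain n where n: "(\<lambda>x. \<Prod>i\<in>I. f i x) \<in> pol_fun G n" using insert by blast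
  from pol_fun_mult[OF m n] show ?case using insert.hyps by auto
qed (auto intro!: exI[of _ "Suc 0"])

end

text \<open>
  Left translates of polynomial functions are polynomial, so separating the elements from 1
  separates any two of them.
\<close>

definition pol_separated :: "'k::comm_ring_1 itself \<Rightarrow> ('g, 'm) monoid_scheme \<Rightarrow> bool" where
  "pol_separated _ G \<longleftrightarrow>
     (\<forall>g\<in>carrier G. g \<noteq> \<one>\<^bsub>G\<^esub> \<longrightarrow> (\<exists>n. \<exists>f::'g \<Rightarrow> 'k. f \<in> pol_fun G n \<and> f g \<noteq> f \<one>\<^bsub>G\<^esub>))"

text \<open>
  Right translation by \<open>g\<close> is unipotent for the filtration by \<open>pol_fun\<close>, by the very
  definition of the latter, and it moves every function that separates \<open>g\<close> from 1.
\<close>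

theorem pol_separated_embeds:
  fixes G :: "('g, 'm) monoid_scheme" and e :: "'r::ring_1 \<Rightarrow> 'k::field_char_0"
  assumes G: "group G" and sep: "pol_separated TYPE('k) G"
    and e: "e 0 = 0" "e 1 = 1" "\<And>a b. e (a + b) = e a + e b" "\<And>a b. e (a * b) = e a * e b"
  shows "\<exists>(U :: (('g \<Rightarrow> 'k) \<Rightarrow> 'g \<Rightarrow> 'k, 'r) agroup) R.
           A_group U \<and> R \<in> hom G U \<and> (\<forall>g\<in>carrier G. g \<noteq> \<one>\<^bsub>G\<^esub> \<longrightarrow> R g \<noteq> \<one>\<^bsub>U\<^esub>)"
proof -
  interpret G: group G by fact
  define V :: "nat \<Rightarrow> ('g \<Rightarrow> 'k) set"
    where "V n = {f \<in> pol_fun G n. \<forall>x. x \<notin> carrier G \<longrightarrow> f x = 0}" for n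
  interpret V: function_filtration V
  proof
    show "V 0 = {0}" unfolding V_def by (auto simp: fun_eq_iff) (metis)
  next
    fix f g n assume "f \<in> V n" "g \<in> V n"
    then show "f + g \<in> V n" using G.pol_fun_add[of f n g] by (simp add: V_def plus_fun_def)
  next
    fix f n c assume "f \<in> V n"
    then show "(\<lambda>x. c * f x) \<in> V n" using G.pol_fun_scale[of f n c] by (simp add: V_def)
  next
    fix f n assume "f \<in> V n"
    then show "f \<in> V (Suc n)" using G.pol_fun_Suc[of f n] by (simp add: V_def)
  qed
  define R where "R g = V.pull (carrier G) (\<lambda>x. x \<otimes>\<^bsub>G\<^esub> g)" for g
  have R: "R g \<in> V.unip" if g: "g \<in> carrier G" for g
    unfolding R_def
  proof (rule V.pull_unip)
    fix n f assume f: "f \<in> V (Suc n)"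
    then have "(\<lambda>x. f (x \<otimes>\<^bsub>G\<^esub> g) - f x) \<in> pol_fun G n" using g by (auto simp: V_def)
    then have "(\<lambda>x. if x \<in> carrier G then f (x \<otimes>\<^bsub>G\<^esub> g) - f x else 0) \<in> pol_fun G n"
      by (rule G.pol_fun_cong) simp
    then show "(\<lambda>x. if x \<in> carrier G then f (x \<otimes>\<^bsub>G\<^esub> g) - f x else 0) \<in> V n"
      by (simp add: V_def)
  qed (auto simp: V_def)
  let ?U = "V.unip_group e"
  have "R (g \<otimes>\<^bsub>G\<^esub> h) = (\<lambda>f. R g (R h f))" if gh: "g \<in> carrier G" "h \<in> carrier G" for g h
  proof
    fix f
    have "R g (R h f) = V.pull (carrier G) (\<lambda>x. (x \<otimes>\<^bsub>G\<^esub> g) \<otimes>\<^bsub>G\<^esub> h) f"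
      unfolding R_def using R[OF gh(2)] gh by (intro V.pull_comp) (auto simp: R_def)
    also have "\<dots> = R (g \<otimes>\<^bsub>G\<^esub> h) f"
      using gh by (auto simp: R_def V.pull_def G.m_assoc fun_eq_iff)
    finally show "R (g \<otimes>\<^bsub>G\<^esub> h) f = R g (R h f)" by simp
  qed
  then have "R \<in> hom G ?U"
    using R by (auto simp: hom_def V.unip_group_def)
  moreover have "R g \<noteq> \<one>\<^bsub>?U\<^esub>" if g: "g \<in> carrier G" "g \<noteq> \<one>\<^bsub>G\<^esub>" for g
  proof
    assume eq: "R g = \<one>\<^bsub>?U\<^esub>"
    obtain n and f :: "'g \<Rightarrow> 'k" where f: "f \<in> pol_fun G n" "f g \<noteq> f \<one>\<^bsub>G\<^esub>"
      using sep g unfolding pol_separated_def by blast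
    define f' where "f' x = (if x \<in> carrier G then f x else 0)" for x
    have "f' \<in> pol_fun G n" by (rule G.pol_fun_cong[OF f(1)]) (simp add: f'_def)
    then have "f' \<in> V n" by (simp add: V_def f'_def)
    then have tot: "f' \<in> V.total" by (rule V.V_total)
    then have "R g f' = f'" using eq by (simp add: V.unip_group_def)
    then have "f' (\<one>\<^bsub>G\<^esub> \<otimes>\<^bsub>G\<^esub> g) = f' \<one>\<^bsub>G\<^esub>"
      using tot by (simp add: R_def V.pull_def fun_eq_iff) (metis G.one_closed)
    then show False using f(2) g by (simp add: f'_def)
  qed
  ultimately show ?thesis using V.A_group_unip_group[OF e] by blast
qed

section \<open>Faithfulness\<close>

lemma finite_gens: "finite (gens t)"
  by (induction t) auto

text \<open>
  Every rule of the congruence mentions finitely many elements of \<open>G\<close>, so a derivation stays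
  valid over any subset that contains the elements that it mentions.
\<close>

lemma aterm_eq_subgroup:
  assumes "aterm_eq G t u"
  shows "\<exists>S. finite S \<and> S \<subseteq> carrier G \<and>
    (\<forall>H. S \<subseteq> H \<longrightarrow> aterm_eq (G\<lparr>carrier := H\<rparr>) t u)"
  using assms
proof induction
  case (refl t)
  then show ?case by (intro exI[of _ "gens t"]) (auto simp: aterm_eq.refl finite_gens)
next
  case (sym t u)
  then show ?case by (meson aterm_eq.sym)
next
  case (trans t u v)
  from trans.IH obtain S S' where "finite S" "S \<subseteq> carrier G" "\<forall>H. S \<subseteq> H \<longrightarrow> aterm_eq (G\<lparr>carrier := H\<rparr>) t u"
    "finite S'" "S' \<subseteq> carrier G" "\<forall>H. S' \<subseteq> H \<longrightarrow> aterm_eq (G\<lparr>carrier := H\<rparr>) u v" by blast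
  then show ?case by (intro exI[of _ "S \<union> S'"]) (simp, meson aterm_eq.trans)
next
  case (cong_mult t t' u u')
  from cong_mult.IH obtain S S' where "finite S" "S \<subseteq> carrier G" "\<forall>H. S \<subseteq> H \<longrightarrow> aterm_eq (G\<lparr>carrier := H\<rparr>) t t'"
    "finite S'" "S' \<subseteq> carrier G" "\<forall>H. S' \<subseteq> H \<longrightarrow> aterm_eq (G\<lparr>carrier := H\<rparr>) u u'" by blast
  then show ?case by (intro exI[of _ "S \<union> S'"]) (simp, meson aterm_eq.cong_mult)
next
  case (cong_inv t t')
  from cong_inv.IH obtain S where "finite S" "S \<subseteq> carrier G" "\<forall>H. S \<subseteq> H \<longrightarrow> aterm_eq (G\<lparr>carrier := H\<rparr>) t t'" by blast
  then show ?case by (intro exI[of _ S]) (simp add: aterm_eq.cong_inv)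
next
  case (cong_pow t t' \<alpha>)
  from cong_pow.IH obtain S where "finite S" "S \<subseteq> carrier G" "\<forall>H. S \<subseteq> H \<longrightarrow> aterm_eq (G\<lparr>carrier := H\<rparr>) t t'" by blast
  then show ?case by (intro exI[of _ S]) (simp add: aterm_eq.cong_pow)
next
  case (gen_mult x y)
  have "aterm_eq (G\<lparr>carrier := H\<rparr>) (Gen (x \<otimes>\<^bsub>G\<^esub> y)) (TMult (Gen x) (Gen y))" if "{x, y} \<subseteq> H" for H
    using aterm_eq.gen_mult[of x "G\<lparr>carrier := H\<rparr>" y] that by simp
  with gen_mult show ?case by (intro exI[of _ "{x, y}"]) auto
next
  case (assoc t u v)
  then show ?case
    by (intro exI[of _ "gens t \<union> gens u \<union> gens v"]) (auto simp: aterm_eq.assoc finite_gens)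
next
  case (l_one t)
  then show ?case by (intro exI[of _ "gens t"]) (auto simp: aterm_eq.l_one finite_gens)
next
  case (l_inv t)
  then show ?case by (intro exI[of _ "gens t"]) (auto simp: aterm_eq.l_inv finite_gens)
next
  case (pow_one t)
  then show ?case by (intro exI[of _ "gens t"]) (auto simp: aterm_eq.pow_one finite_gens)
next
  case (pow_zero t)
  then show ?case by (intro exI[of _ "gens t"]) (auto simp: aterm_eq.pow_zero finite_gens)
next
  case (one_pow \<alpha>)
  then show ?case by (intro exI[of _ "{}"]) (auto simp: aterm_eq.one_pow)
next
  case (pow_add t \<alpha> \<beta>)
  then show ?case by (intro exI[of _ "gens t"]) (auto simp: aterm_eq.pow_add finite_gens)
next
  case (pow_mult t \<alpha> \<beta>)
  then show ?case by (intro exI[of _ "gens t"]) (auto simp: aterm_eq.pow_mult finite_gens)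
next
  case (pow_conj t u \<alpha>)
  then show ?case
    by (intro exI[of _ "gens t \<union> gens u"]) (auto simp: aterm_eq.pow_conj finite_gens)
next
  case (pow_comm t u \<alpha>)
  from pow_comm.IH obtain S where "finite S" "S \<subseteq> carrier G" "\<forall>H. S \<subseteq> H \<longrightarrow> aterm_eq (G\<lparr>carrier := H\<rparr>) (TMult t u) (TMult u t)" by blast
  then show ?case by (intro exI[of _ S]) (simp add: aterm_eq.pow_comm)
qed

instance fract :: ("{idom, ring_char_0}") field_char_0
proof
  show "inj (of_nat :: nat \<Rightarrow> 'a fract)"
    by (simp add: inj_def of_nat_fract eq_fract)
qed

text \<open>
  An equality of the images of \<open>a\<close> and \<open>b\<close> in the completion is derivable over some finite set
  \<open>S\<close>. A homomorphism into an \<open>A\<close>-group that is defined on a subgroup containing \<open>S\<close>, \<open>a\<close> and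
  \<open>b\<close> respects the derivation, so it cannot distinguish \<open>a\<close> from \<open>b\<close>. The homomorphism may
  depend on \<open>S\<close>.
\<close>

lemma faithful_overI:
  fixes G :: "'g monoid" and h :: "'h itself"
  assumes G: "group G"
    and sep: "\<And>g S. \<lbrakk>g \<in> carrier G; g \<noteq> \<one>\<^bsub>G\<^esub>; finite S; S \<subseteq> carrier G\<rbrakk> \<Longrightarrow>
      \<exists>H (U :: ('h, 'r::ring_1) agroup) R. subgroup H G \<and> insert g S \<subseteq> H \<and> A_group U \<and>
         R \<in> hom (G\<lparr>carrier := H\<rparr>) U \<and> R g \<noteq> \<one>\<^bsub>U\<^esub>"
  shows "faithful_over TYPE('r) G"
  unfolding faithful_over_def
proof (rule inj_onI)
  interpret G: group G by fact
  fix a b assume ab: "a \<in> carrier G" "b \<in> carrier G"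
    and eq: "completion_map G a = (completion_map G b :: ('g, 'r) aterm set)"
  show "a = b"
  proof (rule ccontr)
    assume "a \<noteq> b"
    let ?g = "a \<otimes>\<^bsub>G\<^esub> inv\<^bsub>G\<^esub> b"
    have g: "?g \<in> carrier G" "?g \<noteq> \<one>\<^bsub>G\<^esub>"
      using ab \<open>a \<noteq> b\<close> by (auto simp: G.inv_solve_right')
    have "aterm_eq G (Gen a) (Gen b :: ('g, 'r) aterm)"
      using eq ab unfolding completion_map_def by (subst (asm) aterm_class_eq_iff) auto
    from aterm_eq_subgroup[OF this] obtain S where S: "finite S" "S \<subseteq> carrier G"
      "\<And>H. S \<subseteq> H \<Longrightarrow> aterm_eq (G\<lparr>carrier := H\<rparr>) (Gen a) (Gen b :: ('g, 'r) aterm)" by blast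
    obtain H and U :: "('h, 'r) agroup" and R where H: "subgroup H G" "insert ?g (insert a (insert b S)) \<subseteq> H"
      and U: "A_group U" and R: "R \<in> hom (G\<lparr>carrier := H\<rparr>) U" "R ?g \<noteq> \<one>\<^bsub>U\<^esub>"
      using sep[OF g, of "insert a (insert b S)"] S ab by auto
    interpret U: A_group U by fact
    have gH: "group (G\<lparr>carrier := H\<rparr>)" using subgroup.subgroup_is_group[OF H(1) G] .
    interpret h: group_hom "G\<lparr>carrier := H\<rparr>" U R
      by (intro group_hom.intro group_hom_axioms.intro gH U.group_axioms R)
    have "aterm_eq (G\<lparr>carrier := H\<rparr>) (Gen a) (Gen b :: ('g, 'r) aterm)"
      using H by (intro S(3)) auto
    from aterm_eval_cong[OF gH U R(1) this] have "R a = R b" by simp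
    moreover have "R ?g = R a \<otimes>\<^bsub>U\<^esub> inv\<^bsub>U\<^esub> R b"
      using h.hom_mult[of a "inv\<^bsub>G\<^esub> b"] h.hom_inv[of b] H G.m_inv_consistent[OF H(1), of b]
      by (auto simp: subgroup.m_inv_closed)
    ultimately show False using R(2) H h.hom_closed[of b] by auto
  qed
qed

theorem faithful_over_if_pol_separated:
  fixes G :: "'g monoid"
  assumes G: "group G" and sep: "pol_separated TYPE('r::{idom,ring_char_0} fract) G"
  shows "faithful_over TYPE('r) G"
proof -
  obtain U :: "(('g \<Rightarrow> 'r fract) \<Rightarrow> 'g \<Rightarrow> 'r fract, 'r) agroup" and R
    where U: "A_group U" "R \<in> hom G U" "\<forall>g\<in>carrier G. g \<noteq> \<one>\<^bsub>G\<^esub> \<longrightarrow> R g \<noteq> \<one>\<^bsub>U\<^esub>"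
    using pol_separated_embeds[OF G sep, of "\<lambda>a. Fract a 1"]
    by (auto simp: One_fract_def Zero_fract_def)
  show ?thesis
  proof (rule faithful_overI[OF G])
    fix g S assume "g \<in> carrier G" "g \<noteq> \<one>\<^bsub>G\<^esub>" "finite S" "S \<subseteq> carrier G"
    with U group.subgroup_self[OF G]
    show "\<exists>H (U :: (('g \<Rightarrow> 'r fract) \<Rightarrow> 'g \<Rightarrow> 'r fract, 'r) agroup) R. subgroup H G \<and> insert g S \<subseteq> H \<and> A_group U \<and> R \<in> hom (G\<lparr>carrier := H\<rparr>) U \<and> R g \<noteq> \<one>\<^bsub>U\<^esub>"
      by (intro exI[of _ "carrier G"] exI[of _ U] exI[of _ R]) auto
  qed
qed


section \<open>Homomorphisms on cyclic extensions\<close>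

context group
begin

lemma mult_inv_cancel:
  assumes "x \<in> carrier G" "y \<in> carrier G"
  shows "x \<otimes> (inv x \<otimes> y) = y" "inv x \<otimes> (x \<otimes> y) = y"
  using assms by (simp_all add: m_assoc[symmetric])

lemma conj_int_pow_closed:
  assumes H: "subgroup H G" and t: "t \<in> carrier G"
    and n1: "\<And>h. h \<in> H \<Longrightarrow> t \<otimes> h \<otimes> inv t \<in> H" and n2: "\<And>h. h \<in> H \<Longrightarrow> inv t \<otimes> h \<otimes> t \<in> H"
    and h: "h \<in> H"
  shows "t [^] (k::int) \<otimes> h \<otimes> inv (t [^] k) \<in> H"
proof -
  have HG: "h \<in> H \<Longrightarrow> h \<in> carrier G" for h using subgroup.mem_carrier[OF H] .
  have nat: "s [^] (n::nat) \<otimes> h \<otimes> inv (s [^] n) \<in> H"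
    if s: "s \<in> carrier G" "\<And>h. h \<in> H \<Longrightarrow> s \<otimes> h \<otimes> inv s \<in> H" and h: "h \<in> H" for s n h
    using h
  proof (induction n arbitrary: h)
    case (Suc n)
    have "s [^] Suc n \<otimes> h \<otimes> inv (s [^] Suc n) = s [^] n \<otimes> (s \<otimes> h \<otimes> inv s) \<otimes> inv (s [^] n)"
      using s(1) HG[OF Suc.prems] by (simp add: inv_mult_group m_assoc)
    then show ?case using Suc.IH[OF s(2)[OF Suc.prems]] by simp
  qed (simp add: HG)
  show ?thesis
  proof (cases "k \<ge> 0")
    case True
    then show ?thesis using nat[OF t n1 h, of "nat k"] by (metis int_pow_int nat_0_le)
  next
    case False
    then have "t [^] k = (inv t) [^] (nat (- k))"
      using t by (metis int_pow_neg int_pow_int nat_0_le nat_le_linear nat_pow_inv add.inverse_inverse less_imp_le neg_0_le_iff_le not_le)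
    then show ?thesis using nat[of "inv t" h "nat (- k)"] t n2 h by simp
  qed
qed

lemma generate_insert_normalizing:
  assumes H: "subgroup H G" and t: "t \<in> carrier G"
    and n1: "\<And>h. h \<in> H \<Longrightarrow> t \<otimes> h \<otimes> inv t \<in> H" and n2: "\<And>h. h \<in> H \<Longrightarrow> inv t \<otimes> h \<otimes> t \<in> H"
    and g: "g \<in> generate G (insert t H)"
  shows "\<exists>h\<in>H. \<exists>k::int. g = h \<otimes> t [^] k"
  using g
proof induction
  have HG: "h \<in> H \<Longrightarrow> h \<in> carrier G" for h using subgroup.mem_carrier[OF H] .
  case one
  show ?case using subgroup.one_closed[OF H] t by (intro bexI[of _ \<one>] exI[of _ 0]) auto
next
  have HG: "h \<in> H \<Longrightarrow> h \<in> carrier G" for h using subgroup.mem_carrier[OF H] .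
  case (incl x)
  show ?case
  proof (cases "x \<in> H")
    case True
    then show ?thesis by (intro bexI[of _ x] exI[of _ 0]) (auto simp: HG)
  next
    case False
    then show ?thesis
      using incl subgroup.one_closed[OF H] t by (intro bexI[of _ \<one>] exI[of _ 1]) (auto simp: int_pow_1)
  qed
next
  have HG: "h \<in> H \<Longrightarrow> h \<in> carrier G" for h using subgroup.mem_carrier[OF H] .
  case (inv x)
  show ?case
  proof (cases "x \<in> H")
    case True
    then show ?thesis using subgroup.m_inv_closed[OF H]
      by (intro bexI[of _ "inv x"] exI[of _ 0]) (auto simp: HG)
  next
    case False
    then show ?thesis
      using inv subgroup.one_closed[OF H] t
      by (intro bexI[of _ \<one>] exI[of _ "-1"]) (auto simp: int_pow_neg int_pow_1)
  qed
next
  have HG: "h \<in> H \<Longrightarrow> h \<in> carrier G" for h using subgroup.mem_carrier[OF H] .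
  case (eng x y)
  then obtain a b and i j :: int where ab: "a \<in> H" "x = a \<otimes> t [^] i" "b \<in> H" "y = b \<otimes> t [^] j" by blast
  have "x \<otimes> y = (a \<otimes> (t [^] i \<otimes> b \<otimes> inv (t [^] i))) \<otimes> t [^] (i + j)"
    using ab t by (simp add: HG int_pow_mult m_assoc inv_solve_left)
  moreover have "a \<otimes> (t [^] i \<otimes> b \<otimes> inv (t [^] i)) \<in> H"
    by (rule subgroup.m_closed[OF H ab(1) conj_int_pow_closed[OF H t n1 n2 ab(3)]])
  ultimately show ?case by blast
qed

end

text \<open>
  Since \<open>t\<close> normalises \<open>H\<close>, every element of the extension has the form \<open>h t^k\<close>, and the
  relation \<open>rel\<close> computes the product of two such images. The representation \<open>h t^k\<close> is unique
  up to the powers of \<open>t\<close> in \<open>H\<close>; on these the two definitions of the image agree by \<open>cons\<close>.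
\<close>

lemma hom_cyclic_extension:
  assumes G: "group G" and U: "group U" and H: "subgroup H G" and t: "t \<in> carrier G"
    and n1: "\<And>h. h \<in> H \<Longrightarrow> t \<otimes>\<^bsub>G\<^esub> h \<otimes>\<^bsub>G\<^esub> inv\<^bsub>G\<^esub> t \<in> H"
    and n2: "\<And>h. h \<in> H \<Longrightarrow> inv\<^bsub>G\<^esub> t \<otimes>\<^bsub>G\<^esub> h \<otimes>\<^bsub>G\<^esub> t \<in> H"
    and r: "\<And>h. h \<in> H \<Longrightarrow> r h \<in> carrier U" "\<And>h h'. h \<in> H \<Longrightarrow> h' \<in> H \<Longrightarrow> r (h \<otimes>\<^bsub>G\<^esub> h') = r h \<otimes>\<^bsub>U\<^esub> r h'"
    and u: "u \<in> carrier U"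
    and rel: "\<And>h. h \<in> H \<Longrightarrow> u \<otimes>\<^bsub>U\<^esub> r h = r (t \<otimes>\<^bsub>G\<^esub> h \<otimes>\<^bsub>G\<^esub> inv\<^bsub>G\<^esub> t) \<otimes>\<^bsub>U\<^esub> u"
    and cons: "\<And>j::int. t [^]\<^bsub>G\<^esub> j \<in> H \<Longrightarrow> u [^]\<^bsub>U\<^esub> j = r (t [^]\<^bsub>G\<^esub> j)"
  shows "\<exists>R\<in>hom (G\<lparr>carrier := generate G (insert t H)\<rparr>) U.
    \<forall>h\<in>H. \<forall>k::int. R (h \<otimes>\<^bsub>G\<^esub> t [^]\<^bsub>G\<^esub> k) = r h \<otimes>\<^bsub>U\<^esub> u [^]\<^bsub>U\<^esub> k"
proof -
  interpret G: group G by fact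
  interpret U: group U by fact
  have HG: "h \<in> H \<Longrightarrow> h \<in> carrier G" for h using subgroup.mem_carrier[OF H] .
  let ?c = "\<lambda>k h. t [^]\<^bsub>G\<^esub> (k::int) \<otimes>\<^bsub>G\<^esub> h \<otimes>\<^bsub>G\<^esub> inv\<^bsub>G\<^esub> (t [^]\<^bsub>G\<^esub> k)"
  have c: "?c k h \<in> H" if "h \<in> H" for k h
    using G.conj_int_pow_closed[OF H t n1 n2 that] .
  have rinv: "r (inv\<^bsub>G\<^esub> h) = inv\<^bsub>U\<^esub> r h" if h: "h \<in> H" for h
  proof -
    have "r \<one>\<^bsub>G\<^esub> = \<one>\<^bsub>U\<^esub>"
      using r(1)[of "\<one>\<^bsub>G\<^esub>"] r(2)[of "\<one>\<^bsub>G\<^esub>" "\<one>\<^bsub>G\<^esub>"] subgroup.one_closed[OF H]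
      by (simp add: U.l_cancel_one')
    then have "r (inv\<^bsub>G\<^esub> h) \<otimes>\<^bsub>U\<^esub> r h = \<one>\<^bsub>U\<^esub>"
      using r(2)[of "inv\<^bsub>G\<^esub> h" h] h subgroup.m_inv_closed[OF H h] HG by simp
    then show ?thesis
      using r(1) h subgroup.m_inv_closed[OF H h] by (simp add: U.inv_equality)
  qed
  have relnat: "u [^]\<^bsub>U\<^esub> (n::nat) \<otimes>\<^bsub>U\<^esub> r h = r (?c (int n) h) \<otimes>\<^bsub>U\<^esub> u [^]\<^bsub>U\<^esub> n" if "h \<in> H" for n h
    using that
  proof (induction n arbitrary: h)
    case (Suc n)
    have h': "t \<otimes>\<^bsub>G\<^esub> h \<otimes>\<^bsub>G\<^esub> inv\<^bsub>G\<^esub> t \<in> H" by (rule n1[OF Suc.prems])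
    have "u [^]\<^bsub>U\<^esub> Suc n \<otimes>\<^bsub>U\<^esub> r h = u [^]\<^bsub>U\<^esub> n \<otimes>\<^bsub>U\<^esub> r (t \<otimes>\<^bsub>G\<^esub> h \<otimes>\<^bsub>G\<^esub> inv\<^bsub>G\<^esub> t) \<otimes>\<^bsub>U\<^esub> u"
      using u r(1) Suc.prems h' rel[OF Suc.prems] by (simp add: U.m_assoc)
    also have "\<dots> = r (?c (int n) (t \<otimes>\<^bsub>G\<^esub> h \<otimes>\<^bsub>G\<^esub> inv\<^bsub>G\<^esub> t)) \<otimes>\<^bsub>U\<^esub> u [^]\<^bsub>U\<^esub> Suc n"
      using Suc.IH[OF h'] u r(1) c[OF h'] by (simp add: U.m_assoc)
    also have "?c (int n) (t \<otimes>\<^bsub>G\<^esub> h \<otimes>\<^bsub>G\<^esub> inv\<^bsub>G\<^esub> t) = ?c (int (Suc n)) h"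
      unfolding int_pow_int using t HG[OF Suc.prems] by (simp add: G.inv_mult_group G.m_assoc)
    finally show ?case .
  qed (use r(1) u HG in simp)
  have relint: "u [^]\<^bsub>U\<^esub> k \<otimes>\<^bsub>U\<^esub> r h = r (?c k h) \<otimes>\<^bsub>U\<^esub> u [^]\<^bsub>U\<^esub> k" if h: "h \<in> H" for k :: int and h
  proof (cases "k \<ge> 0")
    case True
    then show ?thesis using relnat[OF h, of "nat k"] by (metis int_pow_int nat_0_le)
  next
    case False
    define n where "n = nat (- k)"
    have k: "k = - int n" using False by (simp add: n_def)
    have uk: "u [^]\<^bsub>U\<^esub> k = inv\<^bsub>U\<^esub> (u [^]\<^bsub>U\<^esub> n)" and tk: "t [^]\<^bsub>G\<^esub> k = inv\<^bsub>G\<^esub> (t [^]\<^bsub>G\<^esub> n)"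
      using u t by (simp_all add: k U.int_pow_neg G.int_pow_neg int_pow_int)
    let ?h = "?c k h"
    have "?c (int n) ?h = h"
      using t HG[OF h] unfolding tk int_pow_int by (simp add: G.m_assoc G.mult_inv_cancel)
    then have "u [^]\<^bsub>U\<^esub> n \<otimes>\<^bsub>U\<^esub> r ?h = r h \<otimes>\<^bsub>U\<^esub> u [^]\<^bsub>U\<^esub> n"
      using relnat[OF c[OF h], of n k] by simp
    then show ?thesis unfolding uk using u r(1)[OF h] r(1)[OF c[OF h]]
      by (metis U.inv_closed U.inv_solve_left U.inv_solve_right U.m_assoc U.m_closed U.nat_pow_closed)
  qed
  have wd: "r h \<otimes>\<^bsub>U\<^esub> u [^]\<^bsub>U\<^esub> k = r h' \<otimes>\<^bsub>U\<^esub> u [^]\<^bsub>U\<^esub> k'"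
    if hh: "h \<in> H" "h' \<in> H" and eq: "h \<otimes>\<^bsub>G\<^esub> t [^]\<^bsub>G\<^esub> k = h' \<otimes>\<^bsub>G\<^esub> t [^]\<^bsub>G\<^esub> k'" for h h' and k k' :: int
  proof -
    have e: "t [^]\<^bsub>G\<^esub> (k - k') = inv\<^bsub>G\<^esub> h \<otimes>\<^bsub>G\<^esub> h'"
    proof -
      have "t [^]\<^bsub>G\<^esub> k = inv\<^bsub>G\<^esub> h \<otimes>\<^bsub>G\<^esub> (h' \<otimes>\<^bsub>G\<^esub> t [^]\<^bsub>G\<^esub> k')"
        using eq hh t HG by (metis G.inv_solve_left G.int_pow_closed G.m_closed)
      moreover have "t [^]\<^bsub>G\<^esub> (k - k') = t [^]\<^bsub>G\<^esub> k \<otimes>\<^bsub>G\<^esub> inv\<^bsub>G\<^esub> (t [^]\<^bsub>G\<^esub> k')"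
        using t by (simp add: G.int_pow_diff)
      ultimately show ?thesis using hh t HG by (simp add: G.m_assoc)
    qed
    moreover have "inv\<^bsub>G\<^esub> h \<otimes>\<^bsub>G\<^esub> h' \<in> H"
      using hh subgroup.m_inv_closed[OF H] subgroup.m_closed[OF H] by blast
    ultimately have "u [^]\<^bsub>U\<^esub> (k - k') = inv\<^bsub>U\<^esub> r h \<otimes>\<^bsub>U\<^esub> r h'"
      using cons[of "k - k'"] hh subgroup.m_inv_closed[OF H] by (simp add: r(2) rinv)
    moreover have "u [^]\<^bsub>U\<^esub> k = u [^]\<^bsub>U\<^esub> (k - k') \<otimes>\<^bsub>U\<^esub> u [^]\<^bsub>U\<^esub> k'"
      using U.int_pow_mult[OF u, of "k - k'" k'] by simp
    ultimately show ?thesis using hh u r(1) by (simp add: U.m_assoc[symmetric])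
  qed
  define R where "R g = (SOME v. \<exists>h\<in>H. \<exists>k::int. g = h \<otimes>\<^bsub>G\<^esub> t [^]\<^bsub>G\<^esub> k \<and> v = r h \<otimes>\<^bsub>U\<^esub> u [^]\<^bsub>U\<^esub> k)" for g
  have R: "R (h \<otimes>\<^bsub>G\<^esub> t [^]\<^bsub>G\<^esub> k) = r h \<otimes>\<^bsub>U\<^esub> u [^]\<^bsub>U\<^esub> k" if "h \<in> H" for h and k :: int
    unfolding R_def
  proof (rule some_equality)
    fix v assume "\<exists>h'\<in>H. \<exists>k'::int. h \<otimes>\<^bsub>G\<^esub> t [^]\<^bsub>G\<^esub> k = h' \<otimes>\<^bsub>G\<^esub> t [^]\<^bsub>G\<^esub> k' \<and> v = r h' \<otimes>\<^bsub>U\<^esub> u [^]\<^bsub>U\<^esub> k'"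
    then show "v = r h \<otimes>\<^bsub>U\<^esub> u [^]\<^bsub>U\<^esub> k" using wd[OF that] by (metis (no_types))
  qed (use that in blast)
  have "R \<in> hom (G\<lparr>carrier := generate G (insert t H)\<rparr>) U"
  proof (rule homI)
    fix x assume "x \<in> carrier (G\<lparr>carrier := generate G (insert t H)\<rparr>)"
    then obtain a and i :: int where "a \<in> H" "x = a \<otimes>\<^bsub>G\<^esub> t [^]\<^bsub>G\<^esub> i"
      using G.generate_insert_normalizing[OF H t n1 n2, of x] by auto
    then show "R x \<in> carrier U" using r(1) u by (simp add: R)
  next
    fix x y assume "x \<in> carrier (G\<lparr>carrier := generate G (insert t H)\<rparr>)"
      "y \<in> carrier (G\<lparr>carrier := generate G (insert t H)\<rparr>)"
    then obtain a b and i j :: int where ab: "a \<in> H" "x = a \<otimes>\<^bsub>G\<^esub> t [^]\<^bsub>G\<^esub> i" "b \<in> H" "y = b \<otimes>\<^bsub>G\<^esub> t [^]\<^bsub>G\<^esub> j"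
      using G.generate_insert_normalizing[OF H t n1 n2] by (metis monoid.select_convs(1) partial_object.simps(3) partial_object.select_convs(1) partial_object.surjective partial_object.update_convs(1))
    have "x \<otimes>\<^bsub>G\<^esub> y = (a \<otimes>\<^bsub>G\<^esub> ?c i b) \<otimes>\<^bsub>G\<^esub> t [^]\<^bsub>G\<^esub> (i + j)"
      using ab t by (simp add: HG G.int_pow_mult G.m_assoc G.inv_solve_left)
    then have "R (x \<otimes>\<^bsub>G\<^esub> y) = r (a \<otimes>\<^bsub>G\<^esub> ?c i b) \<otimes>\<^bsub>U\<^esub> u [^]\<^bsub>U\<^esub> (i + j)"
      using R[of "a \<otimes>\<^bsub>G\<^esub> ?c i b" "i + j"] ab c[of b i] subgroup.m_closed[OF H] by simp
    also have "\<dots> = r a \<otimes>\<^bsub>U\<^esub> (r (?c i b) \<otimes>\<^bsub>U\<^esub> u [^]\<^bsub>U\<^esub> i) \<otimes>\<^bsub>U\<^esub> u [^]\<^bsub>U\<^esub> j"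
      using ab c[of b i] r(1) u by (simp add: r(2) U.int_pow_mult U.m_assoc)
    also have "\<dots> = R x \<otimes>\<^bsub>U\<^esub> R y"
      using ab r(1) u relint[OF ab(3), of i] by (simp add: R U.m_assoc[symmetric]) (simp add: U.m_assoc)
    finally show "R (x \<otimes>\<^bsub>G\<lparr>carrier := generate G (insert t H)\<rparr>\<^esub> y) = R x \<otimes>\<^bsub>U\<^esub> R y" by simp
  qed
  with R show ?thesis by blast
qed


section \<open>A filtration adapted to a central series\<close>

definition diff_on :: "('g, 'm) monoid_scheme \<Rightarrow> 'g set \<Rightarrow> 'g \<Rightarrow> ('g \<Rightarrow> 'k::comm_ring_1) \<Rightarrow> 'g \<Rightarrow> 'k" where
  "diff_on G H h f = (\<lambda>x. if x \<in> H then f (x \<otimes>\<^bsub>G\<^esub> h) - f x else 0)"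

text \<open>
  For the filtration by \<open>pol_fun\<close>, conjugation is in general not unipotent. It becomes so once
  a difference in the direction of an element that lies \<open>j\<close> steps below the top of the central
  series counts as \<open>j + 1\<close> differences: conjugation changes \<open>h\<close> by a commutator, which lies
  one step deeper. A negative level is truncated to 0, where only the zero function is left.
\<close>

fun weighted :: "('g, 'm) monoid_scheme \<Rightarrow> (nat \<Rightarrow> 'g set) \<Rightarrow> nat \<Rightarrow> nat \<Rightarrow> ('g \<Rightarrow> 'k::comm_ring_1) set" where
  "weighted G Hs m 0 = {\<lambda>x. 0}"
| "weighted G Hs m (Suc k) =
     {f. (\<forall>x. x \<notin> Hs m \<longrightarrow> f x = 0) \<and>
         (\<forall>j\<le>m. \<forall>h\<in>Hs (m - j). diff_on G (Hs m) h f \<in> weighted G Hs m (k - j))}"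

locale central_chain = group G for G (structure) +
  fixes Hs :: "nat \<Rightarrow> 'a set" and m :: nat
  assumes chain_subgroup: "j \<le> m \<Longrightarrow> subgroup (Hs j) G"
    and chain_0: "Hs 0 = {\<one>}"
    and chain_Suc: "j < m \<Longrightarrow> Hs j \<subseteq> Hs (Suc j)"
    and chain_central: "\<lbrakk>j < m; h \<in> Hs (Suc j); x \<in> carrier G\<rbrakk> \<Longrightarrow> inv h \<otimes> (inv x \<otimes> h \<otimes> x) \<in> Hs j"
begin

abbreviation H :: "'a set" where "H \<equiv> Hs m"
abbreviation W :: "nat \<Rightarrow> ('a \<Rightarrow> 'k::comm_ring_1) set" where "W \<equiv> weighted G Hs m"
abbreviation "D \<equiv> diff_on G H"

lemma chain_carrier: "j \<le> m \<Longrightarrow> h \<in> Hs j \<Longrightarrow> h \<in> carrier G"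
  using subgroup.mem_carrier[OF chain_subgroup] by blast

lemma chain_mono: "i \<le> j \<Longrightarrow> j \<le> m \<Longrightarrow> Hs i \<subseteq> Hs j"
proof (induction j rule: dec_induct)
  case (step j)
  then show ?case using chain_Suc[of j] by auto
qed simp

lemma H_mult: "x \<in> H \<Longrightarrow> y \<in> H \<Longrightarrow> x \<otimes> y \<in> H"
  using subgroup.m_closed[OF chain_subgroup[of m]] by simp

lemma H_inv: "x \<in> H \<Longrightarrow> inv x \<in> H"
  using subgroup.m_inv_closed[OF chain_subgroup[of m]] by simp

lemma H_one: "\<one> \<in> H"
  using subgroup.one_closed[OF chain_subgroup[of m]] by simp

lemma H_carrier: "x \<in> H \<Longrightarrow> x \<in> carrier G"
  using chain_carrier[of m] by simp

text \<open>
  Truncated subtraction is harmless here, since the bottom of the chain is the trivial group.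
\<close>

lemma chain_commutator:
  assumes h: "h \<in> Hs (m - j)" and x: "x \<in> carrier G"
  shows "inv h \<otimes> (inv x \<otimes> h \<otimes> x) \<in> Hs (m - Suc j)"
proof (cases "j < m")
  case True
  then have "m - j = Suc (m - Suc j)" by simp
  then show ?thesis using chain_central[of "m - Suc j" h x] h x True by simp
next
  case False
  then have "h = \<one>" using h chain_0 by simp
  then show ?thesis using False x chain_0 by simp
qed

lemma chain_normal:
  assumes h: "h \<in> H" and x: "x \<in> carrier G"
  shows "inv x \<otimes> h \<otimes> x \<in> H"
proof -
  have "inv h \<otimes> (inv x \<otimes> h \<otimes> x) \<in> Hs (m - Suc 0)" using chain_commutator[of h 0 x] h x by simp
  then have "inv h \<otimes> (inv x \<otimes> h \<otimes> x) \<in> H" using chain_mono[of "m - Suc 0" m] by auto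
  from H_mult[OF h this] show ?thesis using H_carrier[OF h] x by (simp add: mult_inv_cancel m_assoc)
qed

lemma D_add: "D h (\<lambda>x. f x + g x) = (\<lambda>x. D h f x + D h g x)"
  by (simp add: diff_on_def fun_eq_iff)

lemma D_scale: "D h (\<lambda>x. c * f x) = (\<lambda>x. c * D h f x)"
  by (simp add: diff_on_def fun_eq_iff algebra_simps)

lemma W_zero: "(\<lambda>x. 0 :: 'k::comm_ring_1) \<in> W k"
proof (induction k rule: less_induct)
  case (less k)
  have "D h (\<lambda>x. 0 :: 'k) = (\<lambda>x. 0)" for h by (simp add: diff_on_def fun_eq_iff)
  with less show ?case by (cases k) (auto simp: less_Suc_eq_le)
qed

lemma W_vanish: "f \<in> W k \<Longrightarrow> x \<notin> H \<Longrightarrow> f x = 0"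
  by (cases k) auto

lemma W_add: "f \<in> W k \<Longrightarrow> g \<in> W k \<Longrightarrow> (\<lambda>x. f x + g x) \<in> W k"
proof (induction k arbitrary: f g rule: less_induct)
  case (less k)
  then show ?case by (cases k) (auto simp: D_add less_Suc_eq_le)
qed

lemma W_scale: "f \<in> W k \<Longrightarrow> (\<lambda>x. c * f x) \<in> W k"
proof (induction k arbitrary: f rule: less_induct)
  case (less k)
  then show ?case by (cases k) (auto simp: D_scale less_Suc_eq_le)
qed

lemma W_Suc: "f \<in> W k \<Longrightarrow> f \<in> W (Suc k)"
proof (induction k arbitrary: f rule: less_induct)
  case (less k)
  show ?case
  proof (cases k)
    case 0
    then show ?thesis using less.prems W_zero[of "Suc 0"] by simp
  next
    case (Suc k')
    have "D h f \<in> W (Suc k' - j)" if j: "j \<le> m" "h \<in> Hs (m - j)" for j h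
    proof -
      have 1: "D h f \<in> W (k' - j)" using less.prems j Suc by simp
      show ?thesis
      proof (cases "j \<le> k'")
        case True
        then show ?thesis using less.IH[OF _ 1] Suc by (simp add: Suc_diff_le)
      next
        case False
        then show ?thesis using 1 by simp
      qed
    qed
    then show ?thesis using less.prems Suc by simp
  qed
qed

lemma W_mono: "i \<le> k \<Longrightarrow> f \<in> W i \<Longrightarrow> f \<in> W k"
  by (induction k rule: dec_induct) (auto intro: W_Suc simp del: weighted.simps)

lemma D_one: "f \<in> W k \<Longrightarrow> D \<one> f = (\<lambda>x. 0)"
  using H_carrier by (auto simp: diff_on_def fun_eq_iff)

lemma W_D: "f \<in> W k \<Longrightarrow> h \<in> Hs (m - j) \<Longrightarrow> D h f \<in> W (k - Suc j)"
proof -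
  assume f: "f \<in> W k" and h: "h \<in> Hs (m - j)"
  show ?thesis
  proof (cases k)
    case 0
    then have "D h f = (\<lambda>x. 0)" using f by (simp add: diff_on_def fun_eq_iff)
    then show ?thesis using W_zero by simp
  next
    case (Suc k')
    show ?thesis
    proof (cases "j \<le> m")
      case True
      then show ?thesis using f h Suc by simp
    next
      case False
      then have "h = \<one>" using h chain_0 by simp
      then show ?thesis using D_one[OF f] W_zero by simp
    qed
  qed
qed

definition rho :: "'a \<Rightarrow> ('a \<Rightarrow> 'k::comm_ring_1) \<Rightarrow> 'a \<Rightarrow> 'k" where
  "rho a f = (\<lambda>x. if x \<in> H then f (x \<otimes> a) else 0)"

definition con :: "'a \<Rightarrow> ('a \<Rightarrow> 'k::comm_ring_1) \<Rightarrow> 'a \<Rightarrow> 'k" where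
  "con a f = (\<lambda>x. if x \<in> H then f (inv a \<otimes> x \<otimes> a) else 0)"

lemma W_rho: "f \<in> W k \<Longrightarrow> a \<in> H \<Longrightarrow> rho a f \<in> W k"
proof -
  assume f: "f \<in> W k" and a: "a \<in> H"
  have "D a f \<in> W k" using W_D[OF f, of a 0] a W_mono[of "k - 1" k] by simp
  from W_add[OF f this] have "(\<lambda>x. f x + D a f x) \<in> W k" .
  moreover have "(\<lambda>x. f x + D a f x) = rho a f"
    using W_vanish[OF f] by (auto simp: rho_def diff_on_def fun_eq_iff)
  ultimately show ?thesis by simp
qed

text \<open>
  With \<open>z = h^-1 a^-1 h a\<close>, one has \<open>a^-1 (x h) a = (a^-1 x a) h z\<close>. So the difference in
  direction \<open>h\<close> of \<open>con a f - f\<close> is the sum of a translate of the \<open>z\<close>-difference of \<open>f\<close>, which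
  is lower because \<open>z\<close> is one step deeper than \<open>h\<close>, and of the same expression for the
  \<open>h\<close>-difference of \<open>f\<close>, which is lower by induction.
\<close>

lemma W_con:
  fixes f :: "'a \<Rightarrow> 'k::comm_ring_1"
  assumes a: "a \<in> carrier G"
  shows "f \<in> W (Suc k) \<Longrightarrow> (\<lambda>x. con a f x - f x) \<in> W k"
proof (induction k arbitrary: f rule: less_induct)
  case (less k)
  have con_W: "con a g \<in> W p" if "p \<le> k" "g \<in> W p" for p and g :: "'a \<Rightarrow> 'k"
  proof (cases p)
    case 0
    then show ?thesis using that by (simp add: con_def fun_eq_iff)
  next
    case (Suc q)
    then have "(\<lambda>x. con a g x - g x) \<in> W q" using less.IH[of q g] that by simp
    from W_add[OF that(2) W_mono[OF _ this, of p]] Suc show ?thesis by simp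
  qed
  have vanish: "con a f x - f x = 0" if "x \<notin> H" for x
    using W_vanish[OF less.prems that] that by (simp add: con_def)
  show ?case
  proof (cases k)
    case 0
    have "con a f x - f x = 0" for x
    proof (cases "x \<in> H")
      case True
      let ?h = "inv x \<otimes> (inv a \<otimes> x \<otimes> a)"
      have h: "?h \<in> H" by (rule H_mult[OF H_inv[OF True] chain_normal[OF True a]])
      have "D ?h f \<in> W 0" using W_D[OF less.prems, of ?h 0] h 0 by simp
      then have "D ?h f x = 0" by simp
      then have "f (x \<otimes> ?h) - f x = 0" using True by (simp add: diff_on_def)
      then show ?thesis using True H_carrier[OF True] a by (simp add: con_def mult_inv_cancel m_assoc)
    qed (rule vanish)
    then show ?thesis using 0 by (simp add: fun_eq_iff)
  next
    case (Suc k')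
    have "D h (\<lambda>x. con a f x - f x) \<in> W (k' - j)" if j: "j \<le> m" and h: "h \<in> Hs (m - j)" for j h
    proof -
      let ?z = "inv h \<otimes> (inv a \<otimes> h \<otimes> a)"
      have z: "?z \<in> Hs (m - Suc j)" by (rule chain_commutator[OF h a])
      have ht: "h \<in> H" using h chain_mono[of "m - j" m] by auto
      have zt: "?z \<in> H" using z chain_mono[of "m - Suc j" m] by auto
      have hG: "h \<in> carrier G" by (rule H_carrier[OF ht])
      have 1: "D ?z f \<in> W (k' - j)" using W_D[OF less.prems z] Suc by simp
      have 2: "D h f \<in> W (k - j)" using W_D[OF less.prems h] by simp
      have "D h (\<lambda>x. con a f x - f x) =
          (\<lambda>x. con a (rho h (D ?z f)) x + (con a (D h f) x - D h f x))" (is "?L = ?R")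
      proof
        fix x
        show "?L x = ?R x"
        proof (cases "x \<in> H")
          case True
          let ?y = "inv a \<otimes> x \<otimes> a"
          have xG: "x \<in> carrier G" by (rule H_carrier[OF True])
          have y: "?y \<in> H" by (rule chain_normal[OF True a])
          have "inv a \<otimes> (x \<otimes> h) \<otimes> a = ?y \<otimes> h \<otimes> ?z"
            using a xG hG by (simp add: m_assoc mult_inv_cancel)
          then show ?thesis
            using True y ht H_mult by (simp add: diff_on_def con_def rho_def)
        next
          case False
          then show ?thesis by (simp add: diff_on_def con_def)
        qed
      qed
      moreover have "con a (rho h (D ?z f)) \<in> W (k' - j)"
        using Suc by (intro con_W W_rho 1 ht) simp
      moreover have "(\<lambda>x. con a (D h f) x - D h f x) \<in> W (k' - j)"
      proof (cases "j \<le> k'")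
        case True
        then show ?thesis using less.IH[of "k' - j" "D h f"] 2 Suc by (simp add: Suc_diff_le)
      next
        case False
        then have "D h f = (\<lambda>x. 0)" using 2 Suc by simp
        then show ?thesis using W_zero by (simp add: con_def)
      qed
      ultimately show ?thesis using W_add by fastforce
    qed
    then show ?thesis using Suc vanish by simp
  qed
qed

text \<open>
  One difference costs at most \<open>m + 1\<close> levels.
\<close>

lemma pol_fun_weighted:
  "f \<in> pol_fun (G\<lparr>carrier := H\<rparr>) d \<Longrightarrow> (\<And>x. x \<notin> H \<Longrightarrow> f x = 0) \<Longrightarrow> f \<in> W (Suc m * d)"
proof (induction d arbitrary: f)
  case 0
  then show ?case by (auto simp: fun_eq_iff)
next
  case (Suc d)
  interpret T: group "G\<lparr>carrier := H\<rparr>"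
    using subgroup.subgroup_is_group[OF chain_subgroup[of m] group_axioms] by simp
  have "D h f \<in> W (m + Suc m * d - j)" if j: "j \<le> m" "h \<in> Hs (m - j)" for j h
  proof -
    have h: "h \<in> H" using j chain_mono[of "m - j" m] by auto
    have "(\<lambda>x. f (x \<otimes> h) - f x) \<in> pol_fun (G\<lparr>carrier := H\<rparr>) d"
      using T.pol_fun_difference[OF Suc.prems(1)] h by simp
    then have "D h f \<in> pol_fun (G\<lparr>carrier := H\<rparr>) d"
      by (rule T.pol_fun_cong) (simp add: diff_on_def)
    then have "D h f \<in> W (Suc m * d)" by (rule Suc.IH) (simp add: diff_on_def)
    then show ?thesis by (rule W_mono[rotated]) (use j(1) in linarith)
  qed
  moreover have "Suc m * Suc d = Suc (m + Suc m * d)" by simp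
  ultimately show ?case using Suc.prems(2) by (simp only: weighted.simps) blast
qed

end


section \<open>Polynomial functions on cyclic extensions\<close>

lemma (in A_group) apow_of_nat: "g \<in> carrier H \<Longrightarrow> g \<up> (of_nat n) = g [^] n"
proof (induction n)
  case (Suc n)
  have "g \<up> (of_nat (Suc n)) = g \<up> (of_nat n + 1)" by (simp add: add.commute)
  also have "\<dots> = g [^] Suc n" using Suc by (simp add: apow_add apow_one del: of_nat_Suc)
  finally show ?case .
qed (simp add: apow_zero)

lemma apow_root:
  fixes H :: "('g, 'k::field_char_0) agroup"
  assumes "A_group H" and g: "g \<in> carrier H" and n: "(n::nat) > 0"
  shows "(g [^]\<^bsub>H\<^esub> n) \<up>\<^bsub>H\<^esub> (1 / of_nat n) = g" and "(g \<up>\<^bsub>H\<^esub> (1 / of_nat n)) [^]\<^bsub>H\<^esub> n = g"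
proof -
  interpret A_group H by fact
  show "(g [^]\<^bsub>H\<^esub> n) \<up>\<^bsub>H\<^esub> (1 / of_nat n) = g"
    using apow_mult[OF g, of "of_nat n" "1 / of_nat n"] n g by (simp add: apow_of_nat apow_one)
  show "(g \<up>\<^bsub>H\<^esub> (1 / of_nat n)) [^]\<^bsub>H\<^esub> n = g"
    using apow_mult[OF g, of "1 / of_nat n" "of_nat n"] n g by (simp add: apow_of_nat apow_one apow_closed)
qed

lemma apow_unique_root:
  fixes H :: "('g, 'k::field_char_0) agroup"
  assumes "A_group H" "g \<in> carrier H" "h \<in> carrier H" "(n::nat) > 0" "g [^]\<^bsub>H\<^esub> n = h [^]\<^bsub>H\<^esub> n"
  shows "g = h"
  by (rule HOL.trans[OF apow_root(1)[OF assms(1,2,4), symmetric] apow_root(1)[OF assms(1,3,4), folded assms(5)]])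

text \<open>
  \<open>H\<close> acts on the space \<open>W\<close> of its own polynomial functions by right translations \<open>r\<close>, the
  whole group acts by conjugations \<open>c\<close>, and all these operators are unipotent. An operator \<open>u\<close>
  for \<open>t\<close> that is compatible with \<open>r\<close> extends the action to \<open>\<langle>H, t\<rangle>\<close>, and
  \<open>x \<mapsto> (x f)(1)\<close> is then a polynomial function on \<open>\<langle>H, t\<rangle>\<close> that
  extends \<open>f\<close>. If no power of \<open>t\<close> lies in \<open>H\<close>, take \<open>u = c t\<close>. If \<open>s = t^n\<close> lies in \<open>H\<close>, the
  choice is forced to be the \<open>n\<close>-th root of \<open>r s\<close>.
\<close>

lemma (in central_chain) pol_separated_cyclic:
  assumes t: "t \<in> carrier G" and sep: "pol_separated TYPE('k::field_char_0) (G\<lparr>carrier := H\<rparr>)"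
    and tf: "torsion_free G"
  shows "pol_separated TYPE('k) (G\<lparr>carrier := generate G (insert t H)\<rparr>)"
proof -
  let ?N = "generate G (insert t H)"
  let ?GN = "G\<lparr>carrier := ?N\<rparr>"
  have Hsub: "subgroup H G" using chain_subgroup[of m] by simp
  have n2: "inv t \<otimes> h \<otimes> t \<in> H" if "h \<in> H" for h by (rule chain_normal[OF that t])
  have n1: "t \<otimes> h \<otimes> inv t \<in> H" if "h \<in> H" for h using chain_normal[OF that, of "inv t"] t by simp
  have tH: "insert t H \<subseteq> carrier G" using t H_carrier by auto
  have Nsub: "subgroup ?N G" by (rule generate_is_subgroup[OF tH])
  interpret N: group ?GN by (rule subgroup.subgroup_is_group[OF Nsub group_axioms])
  have NG: "x \<in> ?N \<Longrightarrow> x \<in> carrier G" for x using subgroup.mem_carrier[OF Nsub] .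
  have HN: "x \<in> H \<Longrightarrow> x \<in> ?N" for x using generate.incl[of x "insert t H" G] by blast
  have N_elem: "\<exists>h\<in>H. \<exists>k::int. g = h \<otimes> t [^] k" if "g \<in> ?N" for g
    using generate_insert_normalizing[OF Hsub t n1 n2 that] .
  interpret V: function_filtration "W :: nat \<Rightarrow> ('a \<Rightarrow> 'k) set"
  proof
    show "W 0 = {0 :: 'a \<Rightarrow> 'k}" by (simp add: zero_fun_def)
  next
    fix f g :: "'a \<Rightarrow> 'k" and n assume "f \<in> W n" "g \<in> W n"
    then show "f + g \<in> W n" using W_add[of f n g] by (simp add: plus_fun_def)
  qed (rule W_Suc W_scale; assumption)+
  let ?U = "V.unip_group (\<lambda>c::'k. c)"
  interpret U: A_group ?U by (rule V.A_group_unip_group) auto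
  have UA: "A_group ?U" by (rule U.A_group_axioms)
  have carr: "carrier ?U = V.unip" and mul: "u \<otimes>\<^bsub>?U\<^esub> w = (\<lambda>f. u (w f))" for u w
    by (simp_all add: V.unip_group_def)
  define r where "r a = V.pull H (\<lambda>x. x \<otimes> a)" for a
  define c where "c a = V.pull H (\<lambda>x. inv a \<otimes> x \<otimes> a)" for a
  define l where "l a = V.pull H (\<lambda>x. inv a \<otimes> x)" for a
  have r: "r a \<in> V.unip" if a: "a \<in> H" for a
    unfolding r_def
  proof (rule V.pull_unip)
    fix n and f :: "'a \<Rightarrow> 'k" assume "f \<in> W (Suc n)"
    then have "D a f \<in> W (Suc n - Suc 0)" by (rule W_D) (use a in simp)
    then show "(\<lambda>x. if x \<in> H then f (x \<otimes> a) - f x else 0) \<in> W n" by (simp add: diff_on_def)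
  qed (rule W_vanish)
  have c: "c a \<in> V.unip" if a: "a \<in> carrier G" for a
    unfolding c_def
  proof (rule V.pull_unip)
    fix n and f :: "'a \<Rightarrow> 'k" assume f: "f \<in> W (Suc n)"
    have "(\<lambda>x. if x \<in> H then f (inv a \<otimes> x \<otimes> a) - f x else 0) = (\<lambda>x. con a f x - f x)"
      using W_vanish[OF f] by (auto simp: con_def)
    with W_con[OF a f] show "(\<lambda>x. if x \<in> H then f (inv a \<otimes> x \<otimes> a) - f x else 0) \<in> W n" by simp
  qed (rule W_vanish)
  have pull_eqI: "V.pull H p = V.pull H q" if "\<And>x. x \<in> H \<Longrightarrow> p x = q x" for p q
    using that by (auto simp: V.pull_def fun_eq_iff)
  have rr: "r (a \<otimes> b) = r a \<otimes>\<^bsub>?U\<^esub> r b" if "a \<in> H" "b \<in> H" for a b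
  proof -
    have "r a (r b f) = V.pull H (\<lambda>x. (x \<otimes> a) \<otimes> b) f" for f
      unfolding r_def by (rule V.pull_comp) (use r[OF that(2)] that H_mult in \<open>auto simp: r_def\<close>)
    moreover have "V.pull H (\<lambda>x. (x \<otimes> a) \<otimes> b) = r (a \<otimes> b)"
      unfolding r_def using that by (intro pull_eqI) (simp add: m_assoc H_carrier)
    ultimately show ?thesis by (simp add: mul fun_eq_iff)
  qed
  have cc: "c (a \<otimes> b) = c a \<otimes>\<^bsub>?U\<^esub> c b" if "a \<in> carrier G" "b \<in> carrier G" for a b
  proof -
    have "c a (c b f) = V.pull H (\<lambda>x. inv b \<otimes> (inv a \<otimes> x \<otimes> a) \<otimes> b) f" for f
      unfolding c_def by (rule V.pull_comp) (use c[OF that(2)] that chain_normal in \<open>auto simp: c_def\<close>)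
    moreover have "V.pull H (\<lambda>x. inv b \<otimes> (inv a \<otimes> x \<otimes> a) \<otimes> b) = c (a \<otimes> b)"
      unfolding c_def using that by (intro pull_eqI) (simp add: m_assoc H_carrier inv_mult_group)
    ultimately show ?thesis by (simp add: mul fun_eq_iff)
  qed
  have cr: "c a \<otimes>\<^bsub>?U\<^esub> r b = r (a \<otimes> b \<otimes> inv a) \<otimes>\<^bsub>?U\<^esub> c a" if "a \<in> carrier G" "b \<in> H" for a b
  proof -
    have b': "a \<otimes> b \<otimes> inv a \<in> H" using chain_normal[OF that(2), of "inv a"] that by simp
    have "c a (r b f) = V.pull H (\<lambda>x. (inv a \<otimes> x \<otimes> a) \<otimes> b) f" for f
      unfolding c_def r_def by (rule V.pull_comp) (use r[OF that(2)] that chain_normal in \<open>auto simp: r_def\<close>)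
    moreover have "r (a \<otimes> b \<otimes> inv a) (c a f) = V.pull H (\<lambda>x. inv a \<otimes> (x \<otimes> (a \<otimes> b \<otimes> inv a)) \<otimes> a) f" for f
      unfolding c_def r_def by (rule V.pull_comp) (use c[OF that(1)] b' H_mult in \<open>auto simp: c_def\<close>)
    moreover have "V.pull H (\<lambda>x. (inv a \<otimes> x \<otimes> a) \<otimes> b) = V.pull H (\<lambda>x. inv a \<otimes> (x \<otimes> (a \<otimes> b \<otimes> inv a)) \<otimes> a)"
      using that by (intro pull_eqI) (simp add: m_assoc H_carrier)
    ultimately show ?thesis by (simp add: mul fun_eq_iff)
  qed
  have l_eq: "l a = r (inv a) \<otimes>\<^bsub>?U\<^esub> c a" if "a \<in> H" for a
  proof -
    have "r (inv a) (c a f) = V.pull H (\<lambda>x. inv a \<otimes> (x \<otimes> inv a) \<otimes> a) f" for f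
      unfolding c_def r_def by (rule V.pull_comp) (use c[of a] that H_carrier H_mult H_inv in \<open>auto simp: c_def\<close>)
    moreover have "V.pull H (\<lambda>x. inv a \<otimes> (x \<otimes> inv a) \<otimes> a) = l a"
      unfolding l_def using that by (intro pull_eqI) (simp add: m_assoc H_carrier)
    ultimately show ?thesis by (simp add: mul fun_eq_iff)
  qed
  have l: "l a \<in> carrier ?U" if "a \<in> H" for a
    unfolding l_eq[OF that] by (rule U.m_closed) (use r c H_inv H_carrier that carr in auto)
  have lr: "l a \<otimes>\<^bsub>?U\<^esub> r b = r b \<otimes>\<^bsub>?U\<^esub> l a" if "a \<in> H" "b \<in> H" for a b
  proof -
    have "l a (r b f) = V.pull H (\<lambda>x. (inv a \<otimes> x) \<otimes> b) f" for f
      unfolding l_def r_def by (rule V.pull_comp) (use r[OF that(2)] that H_mult H_inv in \<open>auto simp: r_def\<close>)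
    moreover have "r b (l a f) = V.pull H (\<lambda>x. inv a \<otimes> (x \<otimes> b)) f" for f
      unfolding l_def r_def by (rule V.pull_comp) (use l[OF that(1)] that H_mult in \<open>auto simp: l_def carr\<close>)
    moreover have "V.pull H (\<lambda>x. (inv a \<otimes> x) \<otimes> b) = V.pull H (\<lambda>x. inv a \<otimes> (x \<otimes> b))"
      using that by (intro pull_eqI) (simp add: m_assoc H_carrier)
    ultimately show ?thesis by (simp add: mul fun_eq_iff)
  qed
  have rU: "r a \<in> carrier ?U" if "a \<in> H" for a using r[OF that] carr by simp
  have cU: "c a \<in> carrier ?U" if "a \<in> carrier G" for a using c[OF that] carr by simp
  have r_hom: "group_hom (G\<lparr>carrier := H\<rparr>) ?U r"
    by (intro group_hom.intro group_hom_axioms.intro homI U.group_axioms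
        subgroup.subgroup_is_group[OF Hsub group_axioms]) (use rU rr in auto)
  have c_hom: "group_hom G ?U c"
    by (intro group_hom.intro group_hom_axioms.intro homI U.group_axioms group_axioms) (use cU cc in auto)
  have Hpow: "a [^]\<^bsub>G\<lparr>carrier := H\<rparr>\<^esub> (n::nat) = a [^] n" for a n
    using nat_pow_consistent[of a n H] by simp
  have Hipow: "a [^]\<^bsub>G\<lparr>carrier := H\<rparr>\<^esub> (n::int) = a [^] n" if "a \<in> H" for a n
    using int_pow_consistent[OF Hsub that, of n] by simp
  \<comment> \<open>The extension of \<open>f\<close> is the matrix coefficient \<open>x \<mapsto> R x f 1\<close>; its level is
    that of \<open>f\<close> because \<open>R h - 1\<close> lowers the level.\<close>
  have extend: "\<exists>f\<in>pol_fun ?GN n. f g \<noteq> (f \<one> :: 'k)"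
    if u: "u \<in> carrier ?U" and rel: "\<And>h. h \<in> H \<Longrightarrow> u \<otimes>\<^bsub>?U\<^esub> r h = r (t \<otimes> h \<otimes> inv t) \<otimes>\<^bsub>?U\<^esub> u"
      and cons: "\<And>j::int. t [^] j \<in> H \<Longrightarrow> u [^]\<^bsub>?U\<^esub> j = r (t [^] j)"
      and g: "g \<in> H" and f: "f \<in> W n" "f g \<noteq> f \<one>" for u g n and f :: "'a \<Rightarrow> 'k"
  proof -
    obtain R where R: "R \<in> hom ?GN ?U" and Rr: "\<forall>h\<in>H. \<forall>k::int. R (h \<otimes> t [^] k) = r h \<otimes>\<^bsub>?U\<^esub> u [^]\<^bsub>?U\<^esub> k"
      using hom_cyclic_extension[OF group_axioms U.group_axioms Hsub t n1 n2 rU rr u rel cons] by blast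
    have RU: "R x \<in> V.unip" if "x \<in> ?N" for x using R that carr by (auto simp: hom_def)
    have RH: "R h = r h" if "h \<in> H" for h
    proof -
      have "R (h \<otimes> t [^] (0::int)) = r h \<otimes>\<^bsub>?U\<^esub> u [^]\<^bsub>?U\<^esub> (0::int)" using Rr that by blast
      then show ?thesis using that H_carrier rU u by simp
    qed
    have coeff: "f \<in> W n \<Longrightarrow> (\<lambda>x. R x f \<one>) \<in> pol_fun ?GN n" for f n
    proof (induction n arbitrary: f)
      case 0
      then have "f = 0" by (simp add: zero_fun_def)
      then have "R x f = 0" if "x \<in> ?N" for x using V.unip_zero[OF RU[OF that]] by metis
      then show ?case by simp
    next
      case (Suc n)
      have "(\<lambda>x. R (x \<otimes> h) f \<one> - R x f \<one>) \<in> pol_fun ?GN n" if h: "h \<in> ?N" for h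
      proof -
        have "V.nilp (R h) f \<in> W n" using V.nilp_V[OF RU[OF h] Suc.prems] by simp
        from Suc.IH[OF this] show ?thesis
        proof (rule N.pol_fun_cong)
          fix x assume "x \<in> carrier ?GN"
          then have x: "x \<in> ?N" by simp
          have tot: "f \<in> V.total" "R h f \<in> V.total"
            using V.V_total[OF Suc.prems] V.unip_total[OF RU[OF h]] by auto
          have "R x (V.nilp (R h) f + f) = R x (V.nilp (R h) f) + R x f"
            using tot V.V_total[OF \<open>V.nilp (R h) f \<in> W n\<close>] by (intro V.unip_add[OF RU[OF x]])
          moreover have "V.nilp (R h) f + f = R h f" by (simp add: V.nilp_def)
          moreover have "R (x \<otimes> h) = R x \<otimes>\<^bsub>?U\<^esub> R h" using R x h by (simp add: hom_def)
          ultimately show "R x (V.nilp (R h) f) \<one> = R (x \<otimes> h) f \<one> - R x f \<one>"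
            by (simp add: mul)
        qed
      qed
      then show ?case by simp
    qed
    have "R x f \<one> = f x" if "x \<in> H" for x
      using V.V_total[OF f(1)] that H_one H_carrier by (simp add: RH r_def V.pull_def)
    then have "R g f \<one> \<noteq> R \<one> f \<one>" using f(2) g H_one by simp
    then show ?thesis by (intro bexI[OF _ coeff[OF f(1)]])
  qed
  have sepH: "\<exists>n. \<exists>f\<in>W n. f g \<noteq> (f \<one> :: 'k)" if g: "g \<in> H" "g \<noteq> \<one>" for g
  proof -
    obtain n and f :: "'a \<Rightarrow> 'k" where f: "f \<in> pol_fun (G\<lparr>carrier := H\<rparr>) n" "f g \<noteq> f \<one>"
      using sep g unfolding pol_separated_def by auto
    interpret T: group "G\<lparr>carrier := H\<rparr>" by (rule subgroup.subgroup_is_group[OF Hsub group_axioms])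
    have "(\<lambda>x. if x \<in> H then f x else 0) \<in> W (Suc m * n)"
      by (rule pol_fun_weighted[OF T.pol_fun_cong[OF f(1)]]) auto
    then show ?thesis using f(2) g H_one by (intro exI bexI) auto
  qed
  show ?thesis
  proof (cases "\<exists>n::nat. n > 0 \<and> t [^] n \<in> H")
    case True
    then obtain n :: nat where n: "n > 0" "t [^] n \<in> H" by blast
    let ?s = "t [^] n"
    \<comment> \<open>Conjugation by \<open>s = t^n\<close> is the product of the right translation \<open>r s\<close> and the
      left translation \<open>l s\<close>, which commute. Hence \<open>c t\<close>, the root of \<open>c s\<close>, is the
      product of the roots \<open>u\<close> and \<open>L\<close>. Since \<open>L\<close> commutes with all right translations,
      \<open>u\<close> conjugates these in the same way as \<open>c t\<close> does.\<close>
    define u where "u = r ?s \<up>\<^bsub>?U\<^esub> (1 / of_nat n)"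
    define L where "L = l ?s \<up>\<^bsub>?U\<^esub> (1 / of_nat n)"
    have u: "u \<in> carrier ?U" and L: "L \<in> carrier ?U"
      unfolding u_def L_def using U.apow_closed rU[OF n(2)] l[OF n(2)] by auto
    have un: "u [^]\<^bsub>?U\<^esub> n = r ?s"
      unfolding u_def using apow_root(2)[OF UA rU[OF n(2)] n(1)] .
    have ct: "c t = u \<otimes>\<^bsub>?U\<^esub> L"
    proof -
      have "c t [^]\<^bsub>?U\<^esub> n = c ?s" using group_hom.hom_nat_pow[OF c_hom t, of n] by simp
      also have "\<dots> = r ?s \<otimes>\<^bsub>?U\<^esub> l ?s"
      proof -
        have "r ?s \<otimes>\<^bsub>?U\<^esub> l ?s = (r ?s \<otimes>\<^bsub>?U\<^esub> r (inv ?s)) \<otimes>\<^bsub>?U\<^esub> c ?s"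
          using l_eq[OF n(2)] rU n(2) H_inv cU t by (simp add: U.m_assoc)
        also have "r ?s \<otimes>\<^bsub>?U\<^esub> r (inv ?s) = \<one>\<^bsub>?U\<^esub>"
          using rr[of ?s "inv ?s"] n(2) H_inv group_hom.hom_one[OF r_hom] t by simp
        finally show ?thesis using cU t by simp
      qed
      finally have "c t = (r ?s \<otimes>\<^bsub>?U\<^esub> l ?s) \<up>\<^bsub>?U\<^esub> (1 / of_nat n)"
        using apow_root(1)[OF UA cU[OF t] n(1)] by simp
      also have "\<dots> = u \<otimes>\<^bsub>?U\<^esub> L"
        unfolding u_def L_def using lr[OF n(2) n(2)] rU[OF n(2)] l[OF n(2)]
        by (intro U.apow_comm) (auto simp: U.commutator_eq_one_iff)
      finally show ?thesis .
    qed
    have Lr: "L \<otimes>\<^bsub>?U\<^esub> r h = r h \<otimes>\<^bsub>?U\<^esub> L" if h: "h \<in> H" for h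
    proof -
      have "inv\<^bsub>?U\<^esub> r h \<otimes>\<^bsub>?U\<^esub> l ?s \<otimes>\<^bsub>?U\<^esub> r h = l ?s"
        using lr[OF n(2) h] rU[OF h] l[OF n(2)] by (simp add: U.m_assoc U.mult_inv_cancel)
      then have "inv\<^bsub>?U\<^esub> r h \<otimes>\<^bsub>?U\<^esub> L \<otimes>\<^bsub>?U\<^esub> r h = L"
        unfolding L_def using U.apow_conj[OF l[OF n(2)] rU[OF h], of "1 / of_nat n"] by simp
      then show ?thesis using rU[OF h] L
        by (metis U.inv_solve_left U.m_assoc U.m_closed U.inv_closed)
    qed
    have rel: "u \<otimes>\<^bsub>?U\<^esub> r h = r (t \<otimes> h \<otimes> inv t) \<otimes>\<^bsub>?U\<^esub> u" if h: "h \<in> H" for h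
    proof -
      have "u \<otimes>\<^bsub>?U\<^esub> r h \<otimes>\<^bsub>?U\<^esub> L = c t \<otimes>\<^bsub>?U\<^esub> r h"
        unfolding ct using u L rU[OF h] Lr[OF h] by (simp add: U.m_assoc)
      also have "\<dots> = r (t \<otimes> h \<otimes> inv t) \<otimes>\<^bsub>?U\<^esub> c t" by (rule cr[OF t h])
      also have "\<dots> = (r (t \<otimes> h \<otimes> inv t) \<otimes>\<^bsub>?U\<^esub> u) \<otimes>\<^bsub>?U\<^esub> L"
        unfolding ct using u L rU[OF n1[OF h]] by (simp add: U.m_assoc)
      finally show ?thesis using u L rU[OF h] rU[OF n1[OF h]] by simp
    qed
    \<comment> \<open>Both sides have the same \<open>n\<close>-th power, and roots are unique.\<close>
    have cons: "u [^]\<^bsub>?U\<^esub> j = r (t [^] j)" if j: "t [^] j \<in> H" for j :: int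
    proof (rule apow_unique_root[OF UA _ _ n(1)])
      have "(u [^]\<^bsub>?U\<^esub> j) [^]\<^bsub>?U\<^esub> n = (u [^]\<^bsub>?U\<^esub> n) [^]\<^bsub>?U\<^esub> j"
        using U.int_pow_pow[OF u, of j "int n"] U.int_pow_pow[OF u, of "int n" j] 
        by (simp add: int_pow_int mult.commute)
      also have "\<dots> = r (?s [^] j)"
        using group_hom.hom_int_pow[OF r_hom, of ?s j] n(2) by (simp add: un Hipow)
      also have "?s [^] j = (t [^] j) [^] n"
        using int_pow_pow[OF t, of j "int n"] int_pow_pow[OF t, of "int n" j]
        by (simp add: int_pow_int mult.commute)
      also have "r ((t [^] j) [^] n) = r (t [^] j) [^]\<^bsub>?U\<^esub> n"
        using group_hom.hom_nat_pow[OF r_hom, of "t [^] j" n] j by (simp add: Hpow)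
      finally show "(u [^]\<^bsub>?U\<^esub> j) [^]\<^bsub>?U\<^esub> n = r (t [^] j) [^]\<^bsub>?U\<^esub> n" .
    qed (use u rU[OF j] in auto)
    \<comment> \<open>A polynomial function that agrees on \<open>g\<close> and 1 together with all its left
      translates is constant on the powers of \<open>g\<close>, but the power \<open>g^n\<close> lies in \<open>H\<close> and
      is nontrivial.\<close>
    have "\<exists>k. \<exists>f::'a \<Rightarrow> 'k. f \<in> pol_fun ?GN k \<and> f g \<noteq> f \<one>" if g: "g \<in> ?N" "g \<noteq> \<one>" for g
    proof (rule ccontr)
      assume "\<not> ?thesis"
      then have none: "\<phi> g = \<phi> \<one>" if "\<phi> \<in> pol_fun ?GN k" for \<phi> :: "'a \<Rightarrow> 'k" and k
        using that by blast
      have gG: "g \<in> carrier G" by (rule NG[OF g(1)])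
      obtain h and k :: int where hk: "h \<in> H" "g = h \<otimes> t [^] k" using N_elem[OF g(1)] by blast
      have "\<exists>h'\<in>H. g [^] i = h' \<otimes> t [^] (k * int i)" for i
      proof (induction i)
        case 0
        then show ?case using H_one by (intro bexI[of _ \<one>]) auto
      next
        case (Suc i)
        then obtain h' where h': "h' \<in> H" "g [^] i = h' \<otimes> t [^] (k * int i)" by blast
        let ?q = "t [^] (k * int i)"
        have "g [^] Suc i = (h' \<otimes> (?q \<otimes> h \<otimes> inv ?q)) \<otimes> t [^] (k * int i + k)"
          using h' hk H_carrier t by (simp add: m_assoc int_pow_mult mult_inv_cancel)
        moreover have "h' \<otimes> (?q \<otimes> h \<otimes> inv ?q) \<in> H"
          by (rule H_mult[OF h'(1) conj_int_pow_closed[OF Hsub t n1 n2 hk(1)]])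
        ultimately show ?case by (intro bexI) (auto simp: algebra_simps)
      qed
      then obtain h' where h': "h' \<in> H" "g [^] n = h' \<otimes> t [^] (k * int n)" by blast
      have "t [^] (k * int n) = ?s [^] k"
        using int_pow_pow[OF t, of "int n" k] by (simp add: int_pow_int mult.commute)
      then have "t [^] (k * int n) \<in> H" using group.int_pow_closed[OF group_hom.axioms(1)[OF r_hom], of ?s k] n(2) by (simp add: Hipow)
      then have gn: "g [^] n \<in> H" using h' H_mult by simp
      have "g [^] n \<noteq> \<one>" using tf g gG n(1) unfolding torsion_free_def by blast
      then obtain d and f :: "'a \<Rightarrow> 'k" where "f \<in> W d" "f (g [^] n) \<noteq> f \<one>" using sepH[OF gn] by blast
      then obtain f :: "'a \<Rightarrow> 'k" where f: "f \<in> pol_fun ?GN d" "f (g [^] n) \<noteq> f \<one>"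
        using extend[OF u rel cons gn] by blast
      have "f (g [^] i) = f \<one>" for i :: nat
      proof (induction i)
        case (Suc i)
        have gi: "g [^] i \<in> ?N" using N.nat_pow_closed[of g i] g(1) nat_pow_consistent[of g i ?N] by simp
        have "(\<lambda>x. f (g [^] i \<otimes> x)) \<in> pol_fun ?GN d"
          using N.pol_fun_left_translate[OF f(1), of "g [^] i"] gi by simp
        from none[OF this] have "f (g [^] i \<otimes> g) = f (g [^] i \<otimes> \<one>)" .
        with Suc gG show ?case by simp
      qed simp
      then show False using f(2) by blast
    qed
    then show ?thesis by (simp add: pol_separated_def)
  next
    case False
    have j0: "j = 0" if j: "t [^] j \<in> H" for j :: int
    proof (rule ccontr)
      assume "j \<noteq> 0"
      have "t [^] nat \<bar>j\<bar> \<in> H"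
      proof (cases "j \<ge> 0")
        case True
        then show ?thesis using j by (metis abs_of_nonneg int_pow_int nat_0_le)
      next
        case False
        then have "t [^] nat \<bar>j\<bar> = t [^] (- j)" by (simp add: int_pow_int[symmetric])
        also have "\<dots> = inv (t [^] j)" using t by (rule int_pow_neg)
        finally show ?thesis using H_inv[OF j] by simp
      qed
      then show False using False \<open>j \<noteq> 0\<close> by (metis zero_less_abs_iff zero_less_nat_eq)
    qed
    have "\<exists>k. \<exists>f::'a \<Rightarrow> 'k. f \<in> pol_fun ?GN k \<and> f g \<noteq> f \<one>" if g: "g \<in> ?N" "g \<noteq> \<one>" for g
    proof (cases "g \<in> H")
      case True
      obtain d and f :: "'a \<Rightarrow> 'k" where "f \<in> W d" "f g \<noteq> f \<one>" using sepH[OF True g(2)] by blast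
      moreover have "c t [^]\<^bsub>?U\<^esub> j = r (t [^] j)" if "t [^] j \<in> H" for j :: int
        using j0[OF that] group_hom.hom_one[OF r_hom] by simp
      ultimately show ?thesis using extend[OF cU[OF t] cr[OF t] _ True] by blast
    next
      case False
      \<comment> \<open>Outside \<open>H\<close> the exponent of \<open>t\<close> separates: it is a homomorphism to the additive
        group of the field.\<close>
      let ?K = "\<lparr>carrier = UNIV, monoid.mult = (+), one = 0\<rparr> :: 'k monoid"
      have K: "group ?K" by (rule groupI) (auto simp: add.assoc intro: exI[of _ "- _"])
      have Knat: "1 [^]\<^bsub>?K\<^esub> n = (of_nat n :: 'k)" for n :: nat
        by (induction n) (simp_all add: nat_pow_def add.commute)
      have Kpow: "1 [^]\<^bsub>?K\<^esub> j = (of_int j :: 'k)" for j :: int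
      proof (cases "j \<ge> 0")
        case True
        then show ?thesis using Knat[of "nat j"] by (metis int_pow_int nat_0_le of_int_of_nat_eq)
      next
        case False
        then have j: "j = - int (nat (- j))" by simp
        have "1 [^]\<^bsub>?K\<^esub> j = inv\<^bsub>?K\<^esub> (1 [^]\<^bsub>?K\<^esub> nat (- j))"
          by (subst j) (simp add: group.int_pow_neg[OF K] int_pow_int del: int_nat_eq)
        also have "\<dots> = - of_nat (nat (- j))"
          unfolding Knat by (rule group.inv_equality[OF K]) auto
        finally show ?thesis using False by simp
      qed
      have "\<exists>R\<in>hom ?GN ?K. \<forall>h\<in>H. \<forall>k::int. R (h \<otimes> t [^] k) = 0 \<otimes>\<^bsub>?K\<^esub> 1 [^]\<^bsub>?K\<^esub> k"
        by (rule hom_cyclic_extension[OF group_axioms K Hsub t n1 n2]) (auto simp: Kpow dest: j0)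
      then obtain R where R: "R \<in> hom ?GN ?K" and Rr: "\<forall>h\<in>H. \<forall>k::int. R (h \<otimes> t [^] k) = of_int k"
        by (auto simp: Kpow)
      have "R \<in> pol_fun ?GN (Suc (Suc 0))"
        using R subgroup.m_closed[OF Nsub] by (auto simp: hom_def)
      moreover obtain h and k :: int where hk: "h \<in> H" "g = h \<otimes> t [^] k" using N_elem[OF g(1)] by blast
      moreover have "k \<noteq> 0" using False hk H_carrier by auto
      moreover have "R \<one> = 0" using R N.one_closed by (auto simp: hom_def) (metis add_cancel_right_right r_one one_closed)
      ultimately show ?thesis using Rr by (intro exI[of _ 2] exI[of _ R]) (auto simp: numeral_2_eq_2)
    qed
    then show ?thesis by (simp add: pol_separated_def)
  qed
qed


section \<open>Commutator calculus\<close>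

declare lower_central.simps(2) [simp del]

lemma (in group) generate_absorb:
  assumes "A \<subseteq> carrier G" "B \<subseteq> carrier G"
  shows "generate G (A \<union> generate G B) = generate G (A \<union> B)"
proof
  have c: "A \<union> generate G B \<subseteq> carrier G" "A \<union> B \<subseteq> carrier G" using assms generate_incl by auto
  have "A \<union> generate G B \<subseteq> generate G (A \<union> B)"
    using generate.incl[of _ "A \<union> B" G] mono_generate[of B "A \<union> B"] by blast
  then show "generate G (A \<union> generate G B) \<subseteq> generate G (A \<union> B)"
    using generate_subgroup_incl[OF _ generate_is_subgroup[OF c(2)]] by blast
  show "generate G (A \<union> B) \<subseteq> generate G (A \<union> generate G B)"
    using generate.incl[of _ B G] by (intro mono_generate) blast
qed

context group
begin

lemma commutator_closed: "x \<in> carrier G \<Longrightarrow> y \<in> carrier G \<Longrightarrow> commutator G x y \<in> carrier G"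
  by (simp add: commutator_def)

lemma commutator_inv: "x \<in> carrier G \<Longrightarrow> y \<in> carrier G \<Longrightarrow> inv (commutator G x y) = commutator G y x"
  by (simp add: commutator_def inv_mult_group m_assoc)

text \<open>
  \<open>[a b, y] = a [b, y] a^-1 [a, y]\<close>, so modulo a subgroup normalised by \<open>H\<close> commuting with \<open>y\<close>
  passes from generators to products.
\<close>

lemma commutator_generate_left:
  assumes H: "subgroup H G" and T: "subgroup T G" and nor: "\<And>h t. h \<in> H \<Longrightarrow> t \<in> T \<Longrightarrow> h \<otimes> t \<otimes> inv h \<in> T"
    and S: "S \<subseteq> H" "\<And>s. s \<in> S \<Longrightarrow> commutator G s y \<in> T" and y: "y \<in> carrier G" and x: "x \<in> generate G S"
  shows "commutator G x y \<in> T"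
proof -
  have HG: "h \<in> carrier G" if "h \<in> H" for h using subgroup.mem_carrier[OF H that] .
  have SH: "x \<in> H" if "x \<in> generate G S" for x
    using generate_subgroup_incl[OF S(1) H] that by blast
  show ?thesis using x
  proof induction
    case one
    then show ?case using y subgroup.one_closed[OF T] by (simp add: commutator_def)
  next
    case (inv s)
    have s: "s \<in> carrier G" "inv s \<in> H" using inv S(1) HG subgroup.m_inv_closed[OF H] by auto
    have "commutator G (inv s) y = inv s \<otimes> inv (commutator G s y) \<otimes> inv (inv s)"
      using s(1) y by (simp add: commutator_def inv_mult_group m_assoc)
    then show ?case using nor[OF s(2) subgroup.m_inv_closed[OF T S(2)[OF inv]]] by simp
  next
    case (eng a b)
    have ab: "a \<in> H" "b \<in> H" using eng SH by auto
    have "commutator G (a \<otimes> b) y = (a \<otimes> commutator G b y \<otimes> inv a) \<otimes> commutator G a y"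
      using ab[THEN HG] y by (simp add: commutator_def inv_mult_group m_assoc mult_inv_cancel)
    then show ?case using subgroup.m_closed[OF T nor[OF ab(1) eng.IH(2)] eng.IH(1)] by simp
  qed (use S(2) in auto)
qed

lemma commutator_generate_right:
  assumes H: "subgroup H G" and T: "subgroup T G" and nor: "\<And>h t. h \<in> H \<Longrightarrow> t \<in> T \<Longrightarrow> h \<otimes> t \<otimes> inv h \<in> T"
    and S: "S \<subseteq> H" "\<And>s. s \<in> S \<Longrightarrow> commutator G y s \<in> T" and y: "y \<in> carrier G" and x: "x \<in> generate G S"
  shows "commutator G y x \<in> T"
proof -
  have HG: "h \<in> carrier G" if "h \<in> H" for h using subgroup.mem_carrier[OF H that] .
  have SG: "s \<in> carrier G" if "s \<in> S" for s using HG S(1) that by blast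
  have xG: "x \<in> carrier G" using generate_subgroup_incl[OF S(1) H] x HG by blast
  have "commutator G s y \<in> T" if "s \<in> S" for s
    using subgroup.m_inv_closed[OF T S(2)[OF that]] commutator_inv[OF y SG[OF that]] by simp
  from commutator_generate_left[OF H T nor S(1) this y x]
  show ?thesis using subgroup.m_inv_closed[OF T] commutator_inv[OF xG y] by metis
qed

lemma lower_central_subgroup_closed:
  assumes H: "subgroup H G"
  shows "subgroup (lower_central G H n) G \<and> lower_central G H n \<subseteq> H \<and>
    (\<forall>h\<in>H. \<forall>x\<in>lower_central G H n. h \<otimes> x \<otimes> inv h \<in> lower_central G H n)"
proof (induction n)
  case 0
  show ?case using H subgroup.m_closed[OF H] subgroup.m_inv_closed[OF H] by simp
next
  case (Suc n)
  have HG: "h \<in> carrier G" if "h \<in> H" for h using subgroup.mem_carrier[OF H that] .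
  let ?L = "lower_central G H n"
  let ?S = "{commutator G x y | x y. x \<in> ?L \<and> y \<in> H}"
  have LH: "?L \<subseteq> H" using Suc by blast
  have SH: "?S \<subseteq> H"
    using LH subgroup.m_closed[OF H] subgroup.m_inv_closed[OF H] by (auto simp: commutator_def subset_iff)
  then have SG: "?S \<subseteq> carrier G" using HG by blast
  have "h \<otimes> x \<otimes> inv h \<in> generate G ?S" if h: "h \<in> H" and x: "x \<in> generate G ?S" for h x
    using x
  proof induction
    case one
    then show ?case using generate.one HG[OF h] by simp
  next
    case (incl s)
    then obtain a b where s: "s = commutator G a b" "a \<in> ?L" "b \<in> H" by blast
    have "h \<otimes> s \<otimes> inv h = commutator G (h \<otimes> a \<otimes> inv h) (h \<otimes> b \<otimes> inv h)"
      using s LH HG h by (simp add: commutator_def inv_mult_group m_assoc subset_iff mult_inv_cancel)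
    moreover have "h \<otimes> a \<otimes> inv h \<in> ?L" "h \<otimes> b \<otimes> inv h \<in> H"
      using Suc h s subgroup.m_closed[OF H] subgroup.m_inv_closed[OF H] by auto
    ultimately show ?case using generate.incl[of _ ?S] by blast
  next
    case (inv s)
    then obtain a b where s: "s = commutator G a b" "a \<in> ?L" "b \<in> H" by blast
    have "h \<otimes> s \<otimes> inv h = commutator G (h \<otimes> a \<otimes> inv h) (h \<otimes> b \<otimes> inv h)"
      using s LH HG h by (simp add: commutator_def inv_mult_group m_assoc subset_iff mult_inv_cancel)
    moreover have "h \<otimes> inv s \<otimes> inv h = inv (h \<otimes> s \<otimes> inv h)"
      using SG inv HG[OF h] by (simp add: inv_mult_group m_assoc subset_iff)
    moreover have "h \<otimes> a \<otimes> inv h \<in> ?L" "h \<otimes> b \<otimes> inv h \<in> H"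
      using Suc h s subgroup.m_closed[OF H] subgroup.m_inv_closed[OF H] by auto
    ultimately show ?case using generate.inv[of _ ?S] by (metis (mono_tags, lifting) mem_Collect_eq)
  next
    case (eng a b)
    have ab: "a \<in> carrier G" "b \<in> carrier G" using eng generate_incl[OF SG] by auto
    have "h \<otimes> (a \<otimes> b) \<otimes> inv h = (h \<otimes> a \<otimes> inv h) \<otimes> (h \<otimes> b \<otimes> inv h)"
      using ab HG[OF h] by (simp add: m_assoc mult_inv_cancel)
    then show ?case using generate.eng[OF eng.IH] by simp
  qed
  then show ?case
    using generate_is_subgroup[OF SG] generate_subgroup_incl[OF SH H]
    by (simp add: lower_central.simps(2))
qed

lemmas lower_central_subgroup = lower_central_subgroup_closed[THEN conjunct1]
  and lower_central_le = lower_central_subgroup_closed[THEN conjunct2, THEN conjunct1]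

lemma lower_central_conj:
  "subgroup H G \<Longrightarrow> h \<in> H \<Longrightarrow> x \<in> lower_central G H n \<Longrightarrow> h \<otimes> x \<otimes> inv h \<in> lower_central G H n"
  using lower_central_subgroup_closed by blast

lemma lower_central_commutator:
  "x \<in> lower_central G H n \<Longrightarrow> y \<in> H \<Longrightarrow> commutator G x y \<in> lower_central G H (Suc n)"
  unfolding lower_central.simps by (rule generate.incl) blast

lemma lower_central_Suc_le:
  assumes H: "subgroup H G"
  shows "lower_central G H (Suc n) \<subseteq> lower_central G H n"
proof -
  let ?L = "lower_central G H n"
  note L = lower_central_subgroup[OF H, of n]
  have HG: "h \<in> carrier G" if "h \<in> H" for h using subgroup.mem_carrier[OF H that] .
  have "commutator G x y \<in> ?L" if "x \<in> ?L" "y \<in> H" for x y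
  proof -
    have x: "x \<in> carrier G" using that(1) subgroup.mem_carrier[OF L] by blast
    have "commutator G x y = x \<otimes> (y \<otimes> inv x \<otimes> inv y)"
      using x HG[OF that(2)] by (simp add: commutator_def m_assoc)
    then show ?thesis
      using subgroup.m_closed[OF L that(1) lower_central_conj[OF H that(2) subgroup.m_inv_closed[OF L that(1)]]] by simp
  qed
  then show ?thesis unfolding lower_central.simps by (intro generate_subgroup_incl[OF _ L]) auto
qed

lemma lower_central_antimono:
  assumes H: "subgroup H G"
  shows "i \<le> j \<Longrightarrow> lower_central G H j \<subseteq> lower_central G H i"
proof (induction j rule: dec_induct)
  case (step j)
  then show ?case using lower_central_Suc_le[OF H, of j] by blast
qed simp

text \<open>
  Conjugation changes an element of the \<open>n\<close>-th term by an element of the next term.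
\<close>

lemma between_lower_central_normal:
  assumes H: "subgroup H G" and T: "subgroup T G" "lower_central G H (Suc n) \<subseteq> T" "T \<subseteq> lower_central G H n"
    and h: "h \<in> H" and t: "t \<in> T"
  shows "h \<otimes> t \<otimes> inv h \<in> T"
proof -
  have G: "h \<in> carrier G" "t \<in> carrier G" using subgroup.mem_carrier[OF H h] subgroup.mem_carrier[OF T(1) t] by auto
  have "inv (commutator G t h) \<in> T"
    using lower_central_commutator[of t H n h] T t h subgroup.m_inv_closed[OF T(1)] by blast
  from subgroup.m_closed[OF T(1) this t] show ?thesis
    using G by (simp add: commutator_inv) (simp add: commutator_def m_assoc)
qed

text \<open>
  Modulo the term after the next, commutators are multiplicative in both arguments, so those
  of generators suffice.
\<close>

lemma lower_central_generators:
  assumes H: "subgroup H G" "generate G S = H" "S \<subseteq> H"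
    and A: "A \<subseteq> lower_central G H n" "lower_central G H n \<subseteq> generate G (A \<union> lower_central G H (Suc n))"
    and T: "subgroup T G" "lower_central G H (Suc (Suc n)) \<subseteq> T" "T \<subseteq> lower_central G H (Suc n)"
    and AS: "\<And>a s. a \<in> A \<Longrightarrow> s \<in> S \<Longrightarrow> commutator G a s \<in> T"
  shows "lower_central G H (Suc n) \<subseteq> T"
proof -
  have HG: "h \<in> carrier G" if "h \<in> H" for h using subgroup.mem_carrier[OF H(1) that] .
  note nor = between_lower_central_normal[OF H(1) T]
  note LH = lower_central_le[OF H(1)]
  have a: "commutator G a y \<in> T" if "a \<in> A" "y \<in> H" for a y
    using commutator_generate_right[OF H(1) T(1) nor H(3) AS[OF that(1)], of y] that H(2) A(1) LH[of n] HG by blast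
  have "commutator G x y \<in> T" if "x \<in> lower_central G H n" "y \<in> H" for x y
  proof (rule commutator_generate_left[OF H(1) T(1) nor])
    show "A \<union> lower_central G H (Suc n) \<subseteq> H" using A(1) LH by blast
    show "x \<in> generate G (A \<union> lower_central G H (Suc n))" using A(2) that(1) by blast
    show "commutator G s y \<in> T" if "s \<in> A \<union> lower_central G H (Suc n)" for s
      using that a[OF _ \<open>y \<in> H\<close>] lower_central_commutator[of s H "Suc n" y] \<open>y \<in> H\<close> T(2) by blast
  qed (use that HG in auto)
  then show ?thesis
    unfolding lower_central.simps by (intro generate_subgroup_incl[OF _ T(1)]) auto
qed

section \<open>Finitely generated torsion-free nilpotent groups\<close>

lemma finitely_generated_lower_central:
  assumes S: "finite S" "S \<subseteq> carrier G" "generate G S = carrier G"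
  shows "\<exists>A. finite A \<and> A \<subseteq> lower_central G (carrier G) n \<and>
    lower_central G (carrier G) n \<subseteq> generate G (A \<union> lower_central G (carrier G) (Suc n))"
proof (induction n)
  case 0
  show ?case using S mono_generate[of S "S \<union> lower_central G (carrier G) (Suc 0)"]
    by (intro exI[of _ S]) auto
next
  case (Suc n)
  let ?g = "lower_central G (carrier G)"
  note sub = lower_central_subgroup[OF subgroup_self]
  obtain A where A: "finite A" "A \<subseteq> ?g n" "?g n \<subseteq> generate G (A \<union> ?g (Suc n))" using Suc by blast
  define B where "B = (\<lambda>(a, s). commutator G a s) ` (A \<times> S)"
  have B: "B \<subseteq> ?g (Suc n)"
    unfolding B_def using A(2) S(2)
    by (auto intro!: lower_central_commutator)
  have c: "B \<union> ?g (Suc (Suc n)) \<subseteq> ?g (Suc n)"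
    using B lower_central_Suc_le[OF subgroup_self, of "Suc n"] by blast
  have cG: "B \<union> ?g (Suc (Suc n)) \<subseteq> carrier G"
    using c lower_central_le[OF subgroup_self, of "Suc n"] by blast
  have "?g (Suc n) \<subseteq> generate G (B \<union> ?g (Suc (Suc n)))"
  proof (rule lower_central_generators[OF subgroup_self S(3,2) A(2,3) generate_is_subgroup[OF cG]])
    show "?g (Suc (Suc n)) \<subseteq> generate G (B \<union> ?g (Suc (Suc n)))"
      using generate.incl[of _ "B \<union> ?g (Suc (Suc n))" G] by blast
    show "generate G (B \<union> ?g (Suc (Suc n))) \<subseteq> ?g (Suc n)"
      by (rule generate_subgroup_incl[OF c sub])
    show "commutator G a s \<in> generate G (B \<union> ?g (Suc (Suc n)))" if "a \<in> A" "s \<in> S" for a s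
      using that by (intro generate.incl) (auto simp: B_def)
  qed
  moreover have "finite B" using A(1) S(1) by (simp add: B_def)
  ultimately show ?case using B by blast
qed

definition cyclic_step :: "'a set \<Rightarrow> 'a set \<Rightarrow> bool" where
  "cyclic_step K K' \<longleftrightarrow> (\<exists>a\<in>carrier G. (\<forall>x\<in>carrier G. commutator G a x \<in> K) \<and> K' = generate G (insert a K))"

text \<open>
  Every factor of the lower central series is finitely generated; its generators are adjoined
  one at a time, starting from the bottom.
\<close>

lemma nilpotent_cyclic_steps:
  assumes S: "finite S" "S \<subseteq> carrier G" "generate G S = carrier G"
    and c: "lower_central G (carrier G) c = {\<one>}"
  shows "cyclic_step\<^sup>*\<^sup>* {\<one>} (carrier G)"
proof -
  let ?g = "lower_central G (carrier G)"
  have sub: "subgroup (?g n) G" for n by (rule lower_central_subgroup[OF subgroup_self])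
  have gG: "?g n \<subseteq> carrier G" for n by (rule lower_central_le[OF subgroup_self])
  have "i \<le> c \<Longrightarrow> cyclic_step\<^sup>*\<^sup>* {\<one>} (?g (c - i))" for i
  proof (induction i)
    case (Suc i)
    define n where "n = c - Suc i"
    have n: "c - i = Suc n" using Suc.prems by (simp add: n_def)
    obtain A where A: "finite A" "A \<subseteq> ?g n" "?g n \<subseteq> generate G (A \<union> ?g (Suc n))"
      using finitely_generated_lower_central[OF S, of n] by blast
    have "finite B \<Longrightarrow> B \<subseteq> ?g n \<Longrightarrow> cyclic_step\<^sup>*\<^sup>* {\<one>} (generate G (B \<union> ?g (Suc n)))" for B
    proof (induction B rule: finite_induct)
      case empty
      have "generate G (?g (Suc n)) = ?g (Suc n)"
        using generate_subgroup_incl[OF order_refl sub[of "Suc n"]] generate.incl[of _ "?g (Suc n)" G] by blast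
      then show ?case using Suc n by simp
    next
      case (insert a B)
      let ?K = "generate G (B \<union> ?g (Suc n))"
      have a: "a \<in> ?g n" "a \<in> carrier G" using insert.prems gG by auto
      have "commutator G a x \<in> ?K" if x: "x \<in> carrier G" for x
        using lower_central_commutator[OF a(1) x] generate.incl[of _ "B \<union> ?g (Suc n)" G] by blast
      moreover have "generate G (insert a ?K) = generate G (insert a B \<union> ?g (Suc n))"
      proof -
        have "B \<union> ?g (Suc n) \<subseteq> carrier G" using insert.prems gG by blast
        from generate_absorb[of "{a}", OF _ this] a(2) show ?thesis by simp
      qed
      ultimately have "cyclic_step ?K (generate G (insert a B \<union> ?g (Suc n)))"
        unfolding cyclic_step_def using a(2) by auto
      with insert show ?case by (meson insert_subset rtranclp.rtrancl_into_rtrancl)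
    qed
    from this[OF A(1,2)] have "cyclic_step\<^sup>*\<^sup>* {\<one>} (generate G (A \<union> ?g (Suc n)))" .
    moreover have "generate G (A \<union> ?g (Suc n)) = ?g n"
      using A(3) generate_subgroup_incl[OF _ sub[of n], of "A \<union> ?g (Suc n)"] A(2)
        lower_central_Suc_le[OF subgroup_self, of n] by blast
    ultimately show ?case by (simp add: n_def)
  qed (simp add: c)
  from this[of c] show ?thesis by simp
qed

theorem nilpotent_pol_separated:
  assumes S: "finite S" "S \<subseteq> carrier G" "generate G S = carrier G"
    and nil: "nilpotent G" and tf: "torsion_free G"
  shows "pol_separated TYPE('k::field_char_0) G"
proof -
  obtain c where "lower_central G (carrier G) c = {\<one>}" using nil by (auto simp: nilpotent_def)
  from nilpotent_cyclic_steps[OF S this]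
  obtain m and Hs :: "nat \<Rightarrow> 'a set" where Hs: "Hs 0 = {\<one>}" "Hs m = carrier G"
    "\<And>i. i < m \<Longrightarrow> cyclic_step (Hs i) (Hs (Suc i))"
    unfolding rtranclp_power relpowp_fun_conv by blast
  have sub: "j \<le> m \<Longrightarrow> subgroup (Hs j) G" for j
  proof (induction j)
    case 0
    then show ?case using Hs(1) triv_subgroup by simp
  next
    case (Suc j)
    then obtain a where "a \<in> carrier G" "Hs (Suc j) = generate G (insert a (Hs j))"
      using Hs(3)[of j] unfolding cyclic_step_def by auto
    then show ?case
      using Suc subgroup.subset[of "Hs j" G] generate_is_subgroup[of "insert a (Hs j)"] by auto
  qed
  have mono: "Hs j \<subseteq> Hs (Suc j)" if "j < m" for j
    using Hs(3)[OF that] generate.incl[of _ "insert _ (Hs j)" G] unfolding cyclic_step_def by blast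
  \<comment> \<open>Centrality of the factors and normality of the terms support each other: normality
    of a term extends centrality from the new generator to the next term, which is
    then normal by centrality.\<close>
  have comm: "commutator G x y \<in> Hs j"
    if j: "j < m" and nor: "\<And>h t. h \<in> carrier G \<Longrightarrow> t \<in> Hs j \<Longrightarrow> h \<otimes> t \<otimes> inv h \<in> Hs j"
      and x: "x \<in> Hs (Suc j)" and y: "y \<in> carrier G" for j x y
  proof -
    have T: "subgroup (Hs j) G" using sub j by simp
    obtain a where a: "a \<in> carrier G" "\<forall>x\<in>carrier G. commutator G a x \<in> Hs j"
      "Hs (Suc j) = generate G (insert a (Hs j))"
      using Hs(3)[OF j] unfolding cyclic_step_def by blast
    have "commutator G s y \<in> Hs j" if s: "s \<in> insert a (Hs j)" for s
    proof (cases "s \<in> Hs j")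
      case True
      then have "s \<otimes> (y \<otimes> inv s \<otimes> inv y) \<in> Hs j"
        using nor[OF y] subgroup.m_closed[OF T] subgroup.m_inv_closed[OF T] by blast
      then show ?thesis
        using y subgroup.mem_carrier[OF T True] by (simp add: commutator_def m_assoc)
    qed (use s a y in auto)
    moreover have "insert a (Hs j) \<subseteq> carrier G" using a(1) subgroup.subset[OF T] by blast
    ultimately show ?thesis
      using commutator_generate_left[OF subgroup_self T nor, of "insert a (Hs j)" y x] x y a(3) by blast
  qed
  have nor: "j \<le> m \<Longrightarrow> h \<in> carrier G \<Longrightarrow> t \<in> Hs j \<Longrightarrow> h \<otimes> t \<otimes> inv h \<in> Hs j" for j h t
  proof (induction j arbitrary: h t)
    case (Suc j)
    have T: "subgroup (Hs (Suc j)) G" "subgroup (Hs j) G" using sub Suc.prems(1) by auto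
    have t: "t \<in> carrier G" using subgroup.mem_carrier[OF T(1)] Suc.prems by blast
    have "commutator G t h \<in> Hs j" using Suc by (intro comm) auto
    then have "inv (commutator G t h) \<in> Hs (Suc j)"
      using subgroup.m_inv_closed[OF T(2)] mono[of j] Suc.prems(1) by auto
    from subgroup.m_closed[OF T(1) this Suc.prems(3)] show ?case
      using t Suc.prems(2) by (simp add: commutator_inv) (simp add: commutator_def m_assoc)
  qed (simp add: Hs(1))
  have central: "inv h \<otimes> (inv x \<otimes> h \<otimes> x) \<in> Hs j" if j: "j < m" and h: "h \<in> Hs (Suc j)" and x: "x \<in> carrier G" for j h x
  proof -
    have T: "subgroup (Hs (Suc j)) G" using sub j by auto
    have "commutator G (inv h) (inv x) \<in> Hs j"
      using j x subgroup.m_inv_closed[OF T h] by (intro comm nor) auto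
    then show ?thesis using subgroup.mem_carrier[OF T h] x by (simp add: commutator_def m_assoc)
  qed
  have chain: "central_chain G Hs j" if "j \<le> m" for j
    using that sub mono central Hs(1)
    by (intro central_chain.intro central_chain_axioms.intro group_axioms) auto
  have "j \<le> m \<Longrightarrow> pol_separated TYPE('k) (G\<lparr>carrier := Hs j\<rparr>)" for j
  proof (induction j)
    case 0
    then show ?case by (simp add: pol_separated_def Hs(1))
  next
    case (Suc j)
    then obtain a where a: "a \<in> carrier G" "Hs (Suc j) = generate G (insert a (Hs j))"
      using Hs(3)[of j] unfolding cyclic_step_def by auto
    from Suc have "central_chain G Hs j" "pol_separated TYPE('k) (G\<lparr>carrier := Hs j\<rparr>)"
      using chain by auto
    from central_chain.pol_separated_cyclic[OF this(1) a(1) this(2) tf] show ?case using a(2) by simp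
  qed
  from this[of m] show ?thesis by (simp add: Hs(2))
qed

end

text \<open>
  The subgroup generated by the finitely many elements of a derivation has a finitely
  generated image in the nilpotent group, which is torsion-free and nilpotent again.
\<close>

theorem faithful_over_if_residually_torsion_free_nilpotent:
  fixes G :: "'g monoid"
  assumes G: "group G" and res: "residually_torsion_free_nilpotent G"
  shows "faithful_over TYPE('r::{idom,ring_char_0}) G"
proof (rule faithful_overI[OF G])
  interpret G: group G by fact
  fix g S assume g: "g \<in> carrier G" "g \<noteq> \<one>\<^bsub>G\<^esub>" and S: "finite S" "S \<subseteq> carrier G"
  obtain N :: "'g set monoid" and \<phi> where N: "group N" "torsion_free N" "nilpotent N"
    and \<phi>: "\<phi> \<in> hom G N" "\<phi> g \<noteq> \<one>\<^bsub>N\<^esub>"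
    using res g unfolding residually_torsion_free_nilpotent_def by blast
  interpret N: group N by fact
  interpret h: group_hom G N \<phi> by (intro group_hom.intro group_hom_axioms.intro G N \<phi>)
  let ?S = "insert g S" and ?H = "generate G (insert g S)" and ?M = "generate N (\<phi> ` insert g S)"
  have SG: "?S \<subseteq> carrier G" using g S by auto
  have H: "subgroup ?H G" by (rule G.generate_is_subgroup[OF SG])
  have SN: "\<phi> ` ?S \<subseteq> carrier N" using SG by auto
  have M: "subgroup ?M N" by (rule N.generate_is_subgroup[OF SN])
  have M_eq: "\<phi> ` ?H = ?M" using h.generate_img[OF SG] by simp
  let ?NM = "N\<lparr>carrier := ?M\<rparr>"
  interpret M: group ?NM by (rule subgroup.subgroup_is_group[OF M N(1)])
  have incl: "group_hom ?NM N (\<lambda>x. x)"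
    using subgroup.subset[OF M] by (intro group_hom.intro group_hom_axioms.intro M.group_axioms N homI) auto
  have "nilpotent ?NM"
  proof -
    obtain c where c: "lower_central N (carrier N) c = {\<one>\<^bsub>N\<^esub>}" using N(3) by (auto simp: nilpotent_def)
    have "lower_central ?NM (carrier ?NM) c \<subseteq> {\<one>\<^bsub>N\<^esub>}"
      using lower_central_hom[OF incl, of c] c by simp
    moreover have "\<one>\<^bsub>N\<^esub> \<in> lower_central ?NM (carrier ?NM) c"
      using subgroup.one_closed[OF M.lower_central_subgroup[OF M.subgroup_self, of c]] by simp
    ultimately show ?thesis unfolding nilpotent_def by (intro exI[of _ c]) auto
  qed
  moreover have "torsion_free ?NM"
    unfolding torsion_free_def
  proof (intro ballI allI impI)
    fix x and n :: nat assume x: "x \<in> carrier ?NM" and n: "n > 0 \<and> x [^]\<^bsub>?NM\<^esub> n = \<one>\<^bsub>?NM\<^esub>"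
    have "x [^]\<^bsub>N\<^esub> n = \<one>\<^bsub>N\<^esub>" using n N.nat_pow_consistent[of x n ?M] by simp
    moreover have "x \<in> carrier N" using x subgroup.mem_carrier[OF M] by simp
    ultimately show "x = \<one>\<^bsub>?NM\<^esub>" using N(2) n unfolding torsion_free_def by auto
  qed
  moreover have "generate ?NM (\<phi> ` ?S) = carrier ?NM"
    using N.generate_consistent[OF _ M, of "\<phi> ` ?S"] generate.incl[of _ "\<phi> ` ?S" N] by auto
  moreover have "\<phi> ` ?S \<subseteq> carrier ?NM" using generate.incl[of _ "\<phi> ` ?S" N] by auto
  ultimately have "pol_separated TYPE('r fract) ?NM"
    using S(1) by (intro M.nilpotent_pol_separated[of "\<phi> ` ?S"]) auto
  then obtain U :: "(('g set \<Rightarrow> 'r fract) \<Rightarrow> 'g set \<Rightarrow> 'r fract, 'r) agroup" and R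
    where U: "A_group U" "R \<in> hom ?NM U" "\<forall>x\<in>carrier ?NM. x \<noteq> \<one>\<^bsub>?NM\<^esub> \<longrightarrow> R x \<noteq> \<one>\<^bsub>U\<^esub>"
    using pol_separated_embeds[OF M.group_axioms, of "\<lambda>a. Fract a 1"]
    by (auto simp: One_fract_def Zero_fract_def)
  have "\<phi> x \<in> ?M" if "x \<in> ?H" for x using M_eq that by blast
  then have "(\<lambda>x. R (\<phi> x)) \<in> hom (G\<lparr>carrier := ?H\<rparr>) U"
    using U(2) subgroup.mem_carrier[OF H] by (auto simp: hom_def Pi_def)
  moreover have "R (\<phi> g) \<noteq> \<one>\<^bsub>U\<^esub>"
    using U(3) \<phi>(2) generate.incl[of "\<phi> g" "\<phi> ` ?S" N] by simp
  moreover have "?S \<subseteq> ?H" using generate.incl[of _ ?S G] by blast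
  ultimately show "\<exists>H (U :: (('g set \<Rightarrow> 'r fract) \<Rightarrow> 'g set \<Rightarrow> 'r fract, 'r) agroup) R. subgroup H G \<and>
      insert g S \<subseteq> H \<and> A_group U \<and> R \<in> hom (G\<lparr>carrier := H\<rparr>) U \<and> R g \<noteq> \<one>\<^bsub>U\<^esub>"
    using H U(1) by (intro exI[of _ ?H] exI[of _ U] exI[of _ "\<lambda>x. R (\<phi> x)"]) auto
qed


section \<open>Power series in non-commuting variables\<close>

typedef ('x, 'k) nc_series = "UNIV :: ('x list \<Rightarrow> 'k) set"
  morphisms ncoeff Series ..

lemma ncoeff_Series [simp]: "ncoeff (Series f) = f"
  by (simp add: Series_inverse)

lemma nc_series_eqI: "(\<And>w. ncoeff x w = ncoeff y w) \<Longrightarrow> x = y"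
  by (simp add: ncoeff_inject[symmetric] fun_eq_iff)

text \<open>
  The sum of \<open>f u * g v\<close> over all factorisations of the word into \<open>u @ v\<close>. Recursion along the
  word turns the ring axioms into one-line inductions.
\<close>

primrec convolve :: "'x list \<Rightarrow> ('x list \<Rightarrow> 'k::comm_ring_1) \<Rightarrow> ('x list \<Rightarrow> 'k) \<Rightarrow> 'k" where
  "convolve [] f g = f [] * g []"
| "convolve (a # w) f g = f [] * g (a # w) + convolve w (\<lambda>v. f (a # v)) g"

lemma convolve_add_left: "convolve w (\<lambda>v. f v + g v) h = convolve w f h + convolve w g h"
  by (induction w arbitrary: f g) (simp_all add: algebra_simps)

lemma convolve_scale_left: "convolve w (\<lambda>v. c * f v) h = c * convolve w f h"
  by (induction w arbitrary: f) (simp_all add: algebra_simps)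

lemma convolve_add_right: "convolve w f (\<lambda>v. g v + h v) = convolve w f g + convolve w f h"
  by (induction w arbitrary: f) (simp_all add: algebra_simps)

lemma convolve_zero_left: "convolve w (\<lambda>v. 0) h = 0"
  by (induction w) simp_all

lemma convolve_one_left: "convolve w (\<lambda>v. if v = [] then 1 else 0) h = h w"
  by (cases w) (simp_all add: convolve_zero_left)

lemma convolve_one_right: "convolve w f (\<lambda>v. if v = [] then 1 else 0) = f w"
  by (induction w arbitrary: f) simp_all

lemma convolve_assoc: "convolve w (\<lambda>v. convolve v f g) h = convolve w f (\<lambda>v. convolve v g h)"
  by (induction w arbitrary: f)
    (simp_all add: convolve_add_left convolve_scale_left algebra_simps)

lemma convolve_eq_sum: "convolve w f g = (\<Sum>k\<le>length w. f (take k w) * g (drop k w))"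
  by (induction w arbitrary: f) (simp_all add: sum.atMost_Suc_shift del: sum.atMost_Suc)

instantiation nc_series :: (type, comm_ring_1) ring_1
begin

definition "0 = Series (\<lambda>w. 0)"
definition "1 = Series (\<lambda>w. if w = [] then 1 else 0)"
definition "x + y = Series (\<lambda>w. ncoeff x w + ncoeff y w)"
definition "- x = Series (\<lambda>w. - ncoeff x w)"
definition "x - y = Series (\<lambda>w. ncoeff x w - ncoeff y w)"
definition "x * y = Series (\<lambda>w. convolve w (ncoeff x) (ncoeff y))"

instance
proof
  show "(0 :: ('a, 'b) nc_series) \<noteq> 1"
    by (simp add: zero_nc_series_def one_nc_series_def Series_inject fun_eq_iff)
qed (simp_all add: zero_nc_series_def one_nc_series_def plus_nc_series_def uminus_nc_series_def
    minus_nc_series_def times_nc_series_def Series_inject convolve_assoc convolve_add_left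
    convolve_add_right convolve_one_left convolve_one_right ncoeff_inverse fun_eq_iff add.assoc add.commute)

end

lemma ncoeff_simps [simp]:
  "ncoeff 0 w = 0" "ncoeff 1 w = (if w = [] then 1 else 0)" "ncoeff (x + y) w = ncoeff x w + ncoeff y w"
  "ncoeff (- x) w = - ncoeff x w" "ncoeff (x - y) w = ncoeff x w - ncoeff y w"
  by (simp_all add: zero_nc_series_def one_nc_series_def plus_nc_series_def uminus_nc_series_def
    minus_nc_series_def)

lemma ncoeff_mult: "ncoeff (x * y) w = (\<Sum>k\<le>length w. ncoeff x (take k w) * ncoeff y (drop k w))"
  by (simp add: times_nc_series_def convolve_eq_sum)

lemma ncoeff_mult_Nil: "ncoeff (x * y) [] = ncoeff x [] * ncoeff y []"
  by (simp add: ncoeff_mult)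

definition letter :: "'x \<Rightarrow> ('x, 'k::comm_ring_1) nc_series" where
  "letter i = Series (\<lambda>w. if w = [i] then 1 else 0)"

definition order_ge :: "nat \<Rightarrow> ('x, 'k::comm_ring_1) nc_series \<Rightarrow> bool" where
  "order_ge n x \<longleftrightarrow> (\<forall>w. length w < n \<longrightarrow> ncoeff x w = 0)"

lemma order_ge_mono: "order_ge n x \<Longrightarrow> m \<le> n \<Longrightarrow> order_ge m x"
  by (simp add: order_ge_def)

lemma order_ge_0: "order_ge 0 x"
  by (simp add: order_ge_def)

lemma order_ge_add: "order_ge n x \<Longrightarrow> order_ge n y \<Longrightarrow> order_ge n (x + y)"
  and order_ge_diff: "order_ge n x \<Longrightarrow> order_ge n y \<Longrightarrow> order_ge n (x - y)"
  and order_ge_uminus: "order_ge n x \<Longrightarrow> order_ge n (- x)"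
  by (simp_all add: order_ge_def)

lemma order_ge_mult:
  assumes "order_ge a x" "order_ge b y"
  shows "order_ge (a + b) (x * y)"
  unfolding order_ge_def
proof (intro allI impI)
  fix w :: "'a list" assume w: "length w < a + b"
  have "ncoeff x (take k w) * ncoeff y (drop k w) = 0" if "k \<le> length w" for k
    using assms w that by (cases "k < a") (auto simp: order_ge_def)
  then show "ncoeff (x * y) w = 0" by (simp add: ncoeff_mult)
qed

text \<open>
  Successive approximation: as long as the order known for \<open>c\<close> is below \<open>n\<close>, the equation
  raises it by one.
\<close>

lemma order_ge_fixpoint:
  assumes c: "c = p - c * z" and p: "order_ge n p" and z: "order_ge 1 z"
  shows "order_ge n c" and "order_ge (Suc n) (c - p)"
proof -
  have "k \<le> n \<Longrightarrow> order_ge k c" for k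
  proof (induction k)
    case (Suc k)
    then have "order_ge (k + 1) (c * z)" by (intro order_ge_mult z) auto
    then have "order_ge (Suc k) (p - c * z)"
      using Suc.prems p by (intro order_ge_diff) (auto intro: order_ge_mono)
    then show ?case using c by simp
  qed (rule order_ge_0)
  then show n: "order_ge n c" by simp
  have "c - p = - (c * z)" using c by (simp add: algebra_simps)
  then show "order_ge (Suc n) (c - p)"
    using order_ge_uminus[OF order_ge_mult[OF n z]] by simp
qed

definition homogeneous :: "nat \<Rightarrow> ('x, 'k::comm_ring_1) nc_series \<Rightarrow> bool" where
  "homogeneous n x \<longleftrightarrow> (\<forall>w. length w \<noteq> n \<longrightarrow> ncoeff x w = 0)"

lemma ncoeff_mult_homogeneous:
  assumes x: "homogeneous a x" and y: "homogeneous b y" and w: "length w = a + b"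
  shows "ncoeff (x * y) w = ncoeff x (take a w) * ncoeff y (drop a w)"
proof -
  have "ncoeff (x * y) w = (\<Sum>k\<in>{a}. ncoeff x (take k w) * ncoeff y (drop k w))"
    unfolding ncoeff_mult using x w by (intro sum.mono_neutral_right) (auto simp: homogeneous_def)
  then show ?thesis by simp
qed

lemma homogeneous_mult:
  assumes x: "homogeneous a x" and y: "homogeneous b y"
  shows "homogeneous (a + b) (x * y)"
  unfolding homogeneous_def
proof (intro allI impI)
  fix w :: "'a list" assume w: "length w \<noteq> a + b"
  have "ncoeff x (take k w) * ncoeff y (drop k w) = 0" if "k \<le> length w" for k
    using x y w that by (cases "k = a") (auto simp: homogeneous_def)
  then show "ncoeff (x * y) w = 0" by (simp add: ncoeff_mult)
qed

lemma homogeneous_diff: "homogeneous n x \<Longrightarrow> homogeneous n y \<Longrightarrow> homogeneous n (x - y)"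
  by (simp add: homogeneous_def)

lemma homogeneous_order_ge: "homogeneous n x \<Longrightarrow> order_ge n x"
  by (simp add: homogeneous_def order_ge_def)


section \<open>Lyndon words and Hall trees\<close>

lemma append_less_append_iff: "u @ x < u @ y \<longleftrightarrow> x < (y :: 'a::linorder list)"
  by (induction u) auto

lemma le_append: "(u :: 'a::linorder list) \<le> u @ x"
  by (induction u) auto

lemma less_prefix_or_mismatch:
  "(u :: 'a::linorder list) < v \<Longrightarrow> (\<exists>z. v = u @ z) \<or> (\<forall>x y. u @ x < v @ y)"
proof (induction u arbitrary: v)
  case (Cons a u)
  show ?case
  proof (cases v)
    case v: (Cons b v')
    then have "a < b \<or> a = b \<and> u < v'" using Cons.prems by simp
    then show ?thesis using Cons.IH[of v'] v by auto
  qed (use Cons.prems in simp)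
qed auto

lemma less_append_mismatch:
  assumes "(u :: 'a::linorder list) < v" "length v \<le> length u"
  shows "u @ x < v @ y"
  using less_prefix_or_mismatch[OF assms(1)] assms by auto

definition lyndon :: "'a::linorder list \<Rightarrow> bool" where
  "lyndon w \<longleftrightarrow> w \<noteq> [] \<and> (\<forall>u v. w = u @ v \<longrightarrow> u \<noteq> [] \<longrightarrow> v \<noteq> [] \<longrightarrow> w < v)"

lemma lyndon_append_less:
  assumes u: "u \<noteq> []" and v: "lyndon v" and uv: "u < v"
  shows "u @ v < v"
proof -
  consider z where "v = u @ z" | "\<forall>x y. u @ x < v @ y"
    using less_prefix_or_mismatch[OF uv] by blast
  then show ?thesis
  proof cases
    case 1
    then have "z \<noteq> []" using uv by auto
    then have "v < z" using v u 1 by (auto simp: lyndon_def)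
    then have "u @ v < u @ z" by (simp add: append_less_append_iff)
    then show ?thesis using 1 by simp
  next
    case 2
    from 2[rule_format, of v "[]"] show ?thesis by simp
  qed
qed

text \<open>
  A proper suffix of \<open>u @ v\<close> that starts inside \<open>u\<close> exceeds \<open>u\<close> at a mismatch, because it
  starts with a proper suffix of the Lyndon word \<open>u\<close>. The other ones are suffixes of \<open>v\<close>, so
  they are at least \<open>v\<close>, which exceeds \<open>u @ v\<close> (\<open>lyndon_append_less\<close>).
\<close>

lemma lyndon_append:
  assumes u: "lyndon u" and v: "lyndon v" and uv: "u < v"
  shows "lyndon (u @ v)"
  unfolding lyndon_def
proof (intro conjI allI impI)
  show "u @ v \<noteq> []" using u by (simp add: lyndon_def)
  have less: "u @ v < v" using lyndon_append_less[OF _ v uv] u by (auto simp: lyndon_def)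
  fix p q assume eq: "u @ v = p @ q" and p: "p \<noteq> []" and q: "q \<noteq> []"
  then consider z where "u = p @ z" "q = z @ v" | z where "p = u @ z" "v = z @ q"
    by (auto simp: append_eq_append_conv2)
  then show "u @ v < q"
  proof cases
    case 1
    show ?thesis
    proof (cases "z = []")
      case False
      then have "u < z" using u 1 p by (auto simp: lyndon_def)
      moreover have "length z \<le> length u" using 1 by simp
      ultimately show ?thesis using 1 less_append_mismatch[of u z v v] by simp
    qed (use less 1 in simp)
  next
    case 2
    show ?thesis
    proof (cases "z = []")
      case False
      then have "v < q" using v 2 q by (auto simp: lyndon_def)
      then show ?thesis using less by simp
    qed (use less 2 in simp)
  qed
qed

datatype ltree = Leaf nat | Node ltree ltree

primrec foliage :: "ltree \<Rightarrow> nat list" where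
  "foliage (Leaf i) = [i]"
| "foliage (Node s t) = foliage s @ foliage t"

text \<open>
  The bracketings of Lyndon words by their standard factorisation: the last condition makes
  the foliage of the right subtree the least proper suffix (\<open>hall_min_suffix\<close>), so that a word
  determines its tree.
\<close>

primrec hall :: "ltree \<Rightarrow> bool" where
  "hall (Leaf i) \<longleftrightarrow> True"
| "hall (Node s t) \<longleftrightarrow> hall s \<and> hall t \<and> foliage s < foliage t \<and>
     (case s of Leaf i \<Rightarrow> True | Node s' s'' \<Rightarrow> foliage t \<le> foliage s'')"

lemma foliage_nonempty: "foliage t \<noteq> []"
  by (induction t) auto

lemma hall_lyndon: "hall t \<Longrightarrow> lyndon (foliage t)"
proof (induction t)
  case (Leaf i)
  then show ?case by (auto simp: lyndon_def Cons_eq_append_conv)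
qed (simp add: lyndon_append)

lemma hall_min_suffix:
  "hall (Node s t) \<Longrightarrow> foliage (Node s t) = a @ b \<Longrightarrow> a \<noteq> [] \<Longrightarrow> b \<noteq> [] \<Longrightarrow> foliage t \<le> b"
proof (induction s arbitrary: t a b)
  case (Leaf i)
  then show ?case using hall_lyndon[of t] by (auto simp: Cons_eq_append_conv lyndon_def) (metis append_self_conv2 foliage_nonempty order_le_less)
next
  case (Node s' s'')
  have t: "lyndon (foliage t)" using Node.prems(1) hall_lyndon by simp
  from Node.prems(2) consider z where "foliage (Node s' s'') = a @ z" "b = z @ foliage t"
    | z where "foliage t = z @ b" "a = foliage (Node s' s'') @ z"
    by (auto simp: append_eq_append_conv2 simp del: foliage.simps simp: foliage.simps(2)[of "Node s' s''" t])
  then show ?case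
  proof cases
    case 1
    show ?thesis
    proof (cases "z = []")
      case False
      have "foliage s'' \<le> z"
        using Node.IH(1)[of s'' a z] Node.prems 1 False by simp
      also have "z \<le> b" using 1 le_append by simp
      finally show ?thesis using Node.prems(1) by (auto intro: order_trans)
    qed (use 1 in simp)
  next
    case 2
    show ?thesis
    proof (cases "z = []")
      case False
      then show ?thesis using t 2 Node.prems(4) by (auto simp: lyndon_def intro: less_imp_le)
    qed (use 2 in simp)
  qed
qed

lemma hall_foliage_inj: "hall s \<Longrightarrow> hall t \<Longrightarrow> foliage s = foliage t \<Longrightarrow> s = t"
proof (induction s arbitrary: t)
  case (Leaf i)
  then show ?case
    by (cases t) (auto simp: Cons_eq_append_conv foliage_nonempty)
next
  case (Node s1 s2)
  show ?case
  proof (cases t)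
    case (Leaf i)
    then show ?thesis using Node.prems(3) foliage_nonempty[of s1] foliage_nonempty[of s2]
      by (auto simp: append_eq_Cons_conv)
  next
    case (Node t1 t2)
    have "foliage s2 \<le> foliage t2"
      using hall_min_suffix[OF Node.prems(1), of "foliage t1" "foliage t2"] Node.prems(3) \<open>t = Node t1 t2\<close>
        foliage_nonempty by simp
    moreover have "foliage t2 \<le> foliage s2"
      using hall_min_suffix[of t1 t2 "foliage s1" "foliage s2"] Node.prems(2,3) \<open>t = Node t1 t2\<close>
        foliage_nonempty by simp
    ultimately have "foliage s2 = foliage t2" by simp
    moreover from this have "foliage s1 = foliage t1" using Node.prems(3) \<open>t = Node t1 t2\<close> by simp
    ultimately show ?thesis using Node.IH Node.prems \<open>t = Node t1 t2\<close> by auto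
  qed
qed

primrec tree_poly :: "ltree \<Rightarrow> (nat, 'k::comm_ring_1) nc_series" where
  "tree_poly (Leaf i) = letter i"
| "tree_poly (Node s t) = tree_poly s * tree_poly t - tree_poly t * tree_poly s"

lemma homogeneous_tree_poly: "homogeneous (length (foliage t)) (tree_poly t)"
proof (induction t)
  case (Leaf i)
  then show ?case by (auto simp: homogeneous_def letter_def)
next
  case (Node s t)
  then show ?case
    using homogeneous_mult[OF Node.IH(1,2)] homogeneous_mult[OF Node.IH(2,1)]
    by (simp add: homogeneous_diff add.commute)
qed

lemma append_le_mono:
  assumes "(u :: 'a::linorder list) \<le> u'" "length u = length u'" "v \<le> v'"
  shows "u @ v \<le> u' @ v'"
proof (cases "u = u'")
  case True
  then show ?thesis using assms(3) append_less_append_iff[of u v v'] by (auto simp: order_le_less)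
next
  case False
  then have "u < u'" using assms(1) by simp
  then show ?thesis using less_append_mismatch[of u u' v v'] assms(2) by (simp add: less_imp_le)
qed

text \<open>
  The word \<open>v @ u\<close> is larger than the Lyndon word \<open>u @ v\<close>, so the second half of the bracket
  does not disturb the leading term of the first.
\<close>

lemma tree_poly_leading:
  "hall t \<Longrightarrow> ncoeff (tree_poly t) (foliage t) = (1::'k::comm_ring_1) \<and>
     (\<forall>w. ncoeff (tree_poly t :: (nat, 'k) nc_series) w \<noteq> 0 \<longrightarrow> foliage t \<le> w)"
proof (induction t)
  case (Leaf i)
  then show ?case by (simp add: letter_def)
next
  case (Node s t)
  let ?p = "tree_poly s :: (nat, 'k) nc_series" and ?q = "tree_poly t :: (nat, 'k) nc_series"
  let ?u = "foliage s" and ?v = "foliage t"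
  let ?a = "length ?u" and ?b = "length ?v"
  note hp = homogeneous_tree_poly[of s, where 'a = 'k] and hq = homogeneous_tree_poly[of t, where 'a = 'k]
  have hs: "hall s" "hall t" "?u < ?v" using Node.prems by auto
  have IHp: "ncoeff ?p ?u = 1" "\<And>w. ncoeff ?p w \<noteq> 0 \<Longrightarrow> ?u \<le> w" using Node.IH(1)[OF hs(1)] by auto
  have IHq: "ncoeff ?q ?v = 1" "\<And>w. ncoeff ?q w \<noteq> 0 \<Longrightarrow> ?v \<le> w" using Node.IH(2)[OF hs(2)] by auto
  have "?u @ ?v < ?v" using lyndon_append_less[OF foliage_nonempty hall_lyndon[OF hs(2)] hs(3)] .
  then have rot: "?u @ ?v < ?v @ ?u"
    using le_append[of ?v ?u] by simp
  have len: "length w = ?a + ?b" if "ncoeff (?p * ?q - ?q * ?p) w \<noteq> 0" for w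
    using homogeneous_tree_poly[of "Node s t", where 'a = 'k] that by (auto simp: homogeneous_def)
  have pq: "ncoeff (?p * ?q) w = ncoeff ?p (take ?a w) * ncoeff ?q (drop ?a w)" if "length w = ?a + ?b" for w
    using ncoeff_mult_homogeneous[OF hp hq that] .
  have qp: "ncoeff (?q * ?p) w = ncoeff ?q (take ?b w) * ncoeff ?p (drop ?b w)" if "length w = ?a + ?b" for w
    using ncoeff_mult_homogeneous[OF hq hp] that by (simp add: add.commute)
  have pq_ge: "?u @ ?v \<le> w" if w: "length w = ?a + ?b" "ncoeff (?p * ?q) w \<noteq> 0" for w
  proof -
    have "ncoeff ?p (take ?a w) \<noteq> 0" "ncoeff ?q (drop ?a w) \<noteq> 0" using w(2) unfolding pq[OF w(1)] by auto
    then have "?u \<le> take ?a w" "?v \<le> drop ?a w" using IHp(2) IHq(2) by auto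
    then have "?u @ ?v \<le> take ?a w @ drop ?a w" using w(1) by (intro append_le_mono) auto
    then show ?thesis by simp
  qed
  have qp_ge: "?u @ ?v < w" if w: "length w = ?a + ?b" "ncoeff (?q * ?p) w \<noteq> 0" for w
  proof -
    have "ncoeff ?q (take ?b w) \<noteq> 0" "ncoeff ?p (drop ?b w) \<noteq> 0" using w(2) unfolding qp[OF w(1)] by auto
    then have "?v \<le> take ?b w" "?u \<le> drop ?b w" using IHp(2) IHq(2) by auto
    then have "?v @ ?u \<le> take ?b w @ drop ?b w" using w(1) by (intro append_le_mono) auto
    then show ?thesis using rot by simp
  qed
  have "ncoeff (?p * ?q) (?u @ ?v) = 1" using pq[of "?u @ ?v"] IHp(1) IHq(1) by simp
  moreover have "ncoeff (?q * ?p) (?u @ ?v) = 0" using qp_ge[of "?u @ ?v"] by fastforce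
  ultimately have "ncoeff (tree_poly (Node s t)) (foliage (Node s t)) = (1::'k)" by simp
  moreover have "foliage (Node s t) \<le> w" if w: "ncoeff (tree_poly (Node s t) :: (nat, 'k) nc_series) w \<noteq> 0" for w
  proof -
    have l: "length w = ?a + ?b" using len w by simp
    have "ncoeff (?p * ?q) w \<noteq> 0 \<or> ncoeff (?q * ?p) w \<noteq> 0" using w by auto
    then show ?thesis using pq_ge[OF l] qp_ge[OF l] by auto
  qed
  ultimately show ?case by blast
qed


section \<open>The theorem of Magnus and Witt\<close>

context group
begin

lemma hall_witt:
  assumes "x \<in> carrier G" "y \<in> carrier G" "z \<in> carrier G"
  shows "commutator G (commutator G x y) (y \<otimes> z \<otimes> inv y) \<otimes>
    (commutator G (commutator G y z) (z \<otimes> x \<otimes> inv z) \<otimes>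
     commutator G (commutator G z x) (x \<otimes> y \<otimes> inv x)) = \<one>"
  using assms by (simp add: commutator_def inv_mult_group m_assoc mult_inv_cancel)

lemma commutator_eq_conj: "x \<in> carrier G \<Longrightarrow> y \<in> carrier G \<Longrightarrow> x \<otimes> y \<otimes> inv x = commutator G x y \<otimes> y"
  by (simp add: commutator_def m_assoc)

text \<open>
  The three subgroups lemma: by Hall and Witt's identity \<open>[[a, h], x]\<close> is a product of
  commutators of the forms \<open>[[h, x], a]\<close> and \<open>[[x, a], h]\<close>, to which the induction hypothesis
  applies.
\<close>

lemma commutator_lower_central:
  assumes H: "subgroup H G"
  shows "x \<in> lower_central G H i \<Longrightarrow> y \<in> lower_central G H j \<Longrightarrow>
    commutator G x y \<in> lower_central G H (Suc (i + j))"
proof (induction j arbitrary: i x y)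
  case 0
  then show ?case using lower_central_commutator[of x H i y] by simp
next
  case (Suc j)
  let ?g = "lower_central G H"
  note sub = lower_central_subgroup[OF H]
  have HG: "h \<in> carrier G" if "h \<in> H" for h using subgroup.mem_carrier[OF H that] .
  have gH: "z \<in> H" if "z \<in> ?g k" for z k using lower_central_le[OF H] that by blast
  have T: "h \<otimes> t \<otimes> inv h \<in> ?g (Suc (i + Suc j))" if "h \<in> H" "t \<in> ?g (Suc (i + Suc j))" for h t
    using lower_central_conj[OF H that] .
  have "commutator G x (commutator G a h) \<in> ?g (Suc (i + Suc j))" if a: "a \<in> ?g j" and h: "h \<in> H" for a h
  proof -
    define x' where "x' = inv h \<otimes> x \<otimes> h"
    have x': "x' \<in> ?g i"
      using lower_central_conj[OF H subgroup.m_inv_closed[OF H h] Suc.prems(1)] HG[OF h] by (simp add: x'_def)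
    have c: "x \<in> carrier G" "a \<in> carrier G" "h \<in> carrier G" "x' \<in> carrier G"
      using Suc.prems(1) a h x' gH HG by auto
    have hx: "h \<otimes> x' \<otimes> inv h = x" using c by (simp add: x'_def m_assoc mult_inv_cancel)
    have "commutator G h x' \<in> ?g (Suc i)"
      using subgroup.m_inv_closed[OF sub lower_central_commutator[OF x' h]] c by (simp add: commutator_inv)
    then have 1: "commutator G (commutator G h x') (x' \<otimes> a \<otimes> inv x') \<in> ?g (Suc (i + Suc j))"
      using Suc.IH[of _ "Suc i" "x' \<otimes> a \<otimes> inv x'"] lower_central_conj[OF H gH[OF x'] a] by simp
    have 2: "commutator G (commutator G x' a) (a \<otimes> h \<otimes> inv a) \<in> ?g (Suc (i + Suc j))"
      using lower_central_commutator[OF Suc.IH[OF x' a], of "a \<otimes> h \<otimes> inv a"]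
        lower_central_conj[OF H gH[OF a], of h 0] h by simp
    let ?p = "commutator G (commutator G a h) x"
    let ?q = "commutator G (commutator G h x') (x' \<otimes> a \<otimes> inv x') \<otimes> commutator G (commutator G x' a) (a \<otimes> h \<otimes> inv a)"
    have q: "?q \<in> ?g (Suc (i + Suc j))" by (rule subgroup.m_closed[OF sub 1 2])
    have "?p \<otimes> ?q = \<one>" using hall_witt[OF c(2,3,4)] unfolding hx .
    then have "?p = inv ?q"
      using q subgroup.mem_carrier[OF sub] c by (intro inv_equality[symmetric]) (auto simp: commutator_closed)
    then have "?p \<in> ?g (Suc (i + Suc j))" using subgroup.m_inv_closed[OF sub q] by simp
    from subgroup.m_inv_closed[OF sub this] show ?thesis using c by (simp add: commutator_inv commutator_closed)
  qed
  moreover have "y \<in> generate G {commutator G a h | a h. a \<in> ?g j \<and> h \<in> H}"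
    using Suc.prems(2) by (simp add: lower_central.simps(2))
  moreover have "{commutator G a h | a h. a \<in> ?g j \<and> h \<in> H} \<subseteq> H"
    using lower_central_commutator gH by blast
  ultimately show ?case
    using commutator_generate_right[OF H sub T, of "{commutator G a h | a h. a \<in> ?g j \<and> h \<in> H}" x y]
      HG[OF gH[OF Suc.prems(1)]] by blast
qed

text \<open>
  Jacobi's identity in the Lie ring of the lower central series. It is the identity of Hall
  and Witt, whose conjugations only contribute commutators that lie in \<open>T\<close> for reasons of
  weight.
\<close>

lemma commutator_jacobi:
  assumes H: "subgroup H G" and abc: "a \<in> lower_central G H i" "b \<in> lower_central G H j" "c \<in> lower_central G H k"
    and T: "subgroup T G" "lower_central G H (i + j + k + 3) \<subseteq> T" "T \<subseteq> lower_central G H (i + j + k + 2)"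
    and 1: "commutator G (commutator G a c) b \<in> T" and 2: "commutator G a (commutator G b c) \<in> T"
  shows "commutator G (commutator G a b) c \<in> T"
proof -
  let ?g = "lower_central G H"
  have HG: "h \<in> carrier G" if "h \<in> H" for h using subgroup.mem_carrier[OF H that] .
  have gH: "z \<in> H" if "z \<in> ?g l" for z l using lower_central_le[OF H] that by blast
  have abcH: "a \<in> H" "b \<in> H" "c \<in> H" using abc gH by auto
  have abcG: "a \<in> carrier G" "b \<in> carrier G" "c \<in> carrier G" using abcH HG by auto
  have ab: "commutator G a b \<in> ?g (Suc (i + j))" and bc: "commutator G b c \<in> ?g (Suc (j + k))"
    and ca: "commutator G c a \<in> ?g (Suc (k + i))"
    using commutator_lower_central[OF H] abc by auto
  have nor: "h \<otimes> t \<otimes> inv h \<in> T" if "h \<in> H" "t \<in> T" for h t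
    using between_lower_central_normal[OF H T(1), of "i + j + k + 2"] T(2,3) that by (simp add: eval_nat_numeral)
  have deep: "commutator G x y \<in> T"
    if "x \<in> ?g p" "y \<in> ?g q" "i + j + k + 3 \<le> Suc (p + q)" for x y p q
    using commutator_lower_central[OF H that(1,2)] lower_central_antimono[OF H that(3)] T(2) by blast
  have right: "commutator G y (u \<otimes> v) \<in> T"
    if "commutator G y u \<in> T" "commutator G y v \<in> T" "y \<in> carrier G" "u \<in> H" "v \<in> H" for y u v
  proof (rule commutator_generate_right[OF H T(1) nor, of "{u, v}"])
    show "u \<otimes> v \<in> generate G {u, v}" by (intro generate.eng generate.incl) auto
  qed (use that in auto)
  have A: "commutator G (commutator G b c) (c \<otimes> a \<otimes> inv c) \<in> T"
  proof -
    have "commutator G (commutator G b c) a \<in> T"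
      using subgroup.m_inv_closed[OF T(1) 2] abcG by (simp add: commutator_inv commutator_closed)
    moreover have "commutator G (commutator G b c) (commutator G c a) \<in> T"
      by (rule deep[OF bc ca]) simp
    ultimately show ?thesis
      using abcG abcH gH[OF ca] by (simp add: commutator_eq_conj right commutator_closed)
  qed
  have B: "commutator G (commutator G c a) (a \<otimes> b \<otimes> inv a) \<in> T"
  proof -
    have "commutator G (commutator G c a) b \<in> T"
    proof (rule commutator_generate_left[OF H T(1) nor, of "{commutator G a c}"])
      have "inv (commutator G a c) \<in> generate G {commutator G a c}" by (rule generate.inv) simp
      then show "commutator G c a \<in> generate G {commutator G a c}" using abcG by (simp add: commutator_inv)
      show "{commutator G a c} \<subseteq> H" using commutator_lower_central[OF H abc(1,3)] gH by blast
    qed (use 1 abcG in auto)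
    moreover have "commutator G (commutator G c a) (commutator G a b) \<in> T"
      by (rule deep[OF ca ab]) simp
    ultimately show ?thesis
      using abcG abcH gH[OF ab] by (simp add: commutator_eq_conj right commutator_closed)
  qed
  let ?q = "commutator G (commutator G b c) (c \<otimes> a \<otimes> inv c) \<otimes> commutator G (commutator G c a) (a \<otimes> b \<otimes> inv a)"
  have q: "?q \<in> T" by (rule subgroup.m_closed[OF T(1) A B])
  have "commutator G (commutator G a b) (b \<otimes> c \<otimes> inv b) \<otimes> ?q = \<one>"
    by (rule hall_witt[OF abcG])
  then have "commutator G (commutator G a b) (b \<otimes> c \<otimes> inv b) = inv ?q"
    using q subgroup.mem_carrier[OF T(1)] abcG by (intro inv_equality[symmetric]) (auto simp: commutator_closed)
  then have C: "commutator G (commutator G a b) (b \<otimes> c \<otimes> inv b) \<in> T"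
    using subgroup.m_inv_closed[OF T(1) q] by simp
  have bc': "inv (commutator G b c) \<in> ?g (Suc (j + k))"
    by (rule subgroup.m_inv_closed[OF lower_central_subgroup[OF H] bc])
  have M1: "commutator G (commutator G a b) (inv (commutator G b c)) \<in> T"
    by (rule deep[OF ab bc']) simp
  have M2: "b \<otimes> c \<otimes> inv b \<in> H"
    using lower_central_conj[OF H abcH(2), of c 0] abcH(3) by simp
  have "commutator G (commutator G a b) (inv (commutator G b c) \<otimes> (b \<otimes> c \<otimes> inv b)) \<in> T"
    by (rule right[OF M1 C _ gH[OF bc'] M2]) (simp add: abcG commutator_closed)
  also have "inv (commutator G b c) \<otimes> (b \<otimes> c \<otimes> inv b) = c"
    using abcG by (simp add: commutator_eq_conj mult_inv_cancel commutator_closed)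
  finally show ?thesis .
qed

end

locale series_hom = group G for G (structure) +
  fixes H :: "'a set" and m :: "'a \<Rightarrow> ('x, 'k::comm_ring_1) nc_series"
  assumes H_subgroup: "subgroup H G"
    and m_mult: "x \<in> H \<Longrightarrow> y \<in> H \<Longrightarrow> m (x \<otimes> y) = m x * m y"
    and m_one: "m \<one> = 1"
    and m_Nil: "x \<in> H \<Longrightarrow> ncoeff (m x) [] = 1"
begin

lemma sub_carrier: "x \<in> H \<Longrightarrow> x \<in> carrier G"
  using subgroup.mem_carrier[OF H_subgroup] .

lemma gH: "x \<in> lower_central G H n \<Longrightarrow> x \<in> H"
  using lower_central_le[OF H_subgroup] by blast

lemma sub_closed: "x \<in> H \<Longrightarrow> y \<in> H \<Longrightarrow> x \<otimes> y \<in> H" "x \<in> H \<Longrightarrow> inv x \<in> H"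
  using subgroup.m_closed[OF H_subgroup] subgroup.m_inv_closed[OF H_subgroup] by auto

lemma m_inv: "x \<in> H \<Longrightarrow> m (inv x) * m x = 1"
  using m_mult[of "inv x" x] sub_closed(2) sub_carrier m_one by simp

lemma m_order_1: "x \<in> H \<Longrightarrow> order_ge 1 (m x - 1)"
  by (simp add: order_ge_def m_Nil)

text \<open>
  The leading part of a group commutator is the ring commutator \<open>p\<close> of the leading parts.
  Indeed \<open>[x, y] y x = x y\<close> says that \<open>c = m [x, y] - 1\<close> solves \<open>c = p - c z\<close> with
  \<open>z = m (y x) - 1\<close>.
\<close>

lemma m_commutator:
  assumes x: "x \<in> H" "order_ge a (m x - 1)" and y: "y \<in> H" "order_ge b (m y - 1)"
  defines "p \<equiv> (m x - 1) * (m y - 1) - (m y - 1) * (m x - 1)"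
  shows "order_ge (a + b) (m (commutator G x y) - 1)"
    and "order_ge (Suc (a + b)) (m (commutator G x y) - 1 - p)"
proof -
  let ?c = "m (commutator G x y) - 1"
  have xy: "commutator G x y \<in> H" using x(1) y(1) sub_closed by (simp add: commutator_def)
  have "commutator G x y \<otimes> (y \<otimes> x) = x \<otimes> y"
    using sub_carrier x(1) y(1) by (simp add: commutator_def m_assoc mult_inv_cancel)
  then have "m (commutator G x y) * (m y * m x) = m x * m y"
    using xy x(1) y(1) sub_closed by (simp add: m_mult[symmetric])
  then have c: "?c = p - ?c * (m y * m x - 1)"
    by (simp add: p_def algebra_simps)
  have p: "order_ge (a + b) p"
    unfolding p_def using order_ge_mult[OF x(2) y(2)] order_ge_mult[OF y(2) x(2)]
    by (simp add: order_ge_diff add.commute)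
  have z: "order_ge 1 (m y * m x - 1)"
    using m_order_1[OF sub_closed(1)[OF y(1) x(1)]] x(1) y(1) by (simp add: m_mult)
  show "order_ge (a + b) ?c" "order_ge (Suc (a + b)) (?c - p)"
    by (rule order_ge_fixpoint[OF c p z])+
qed

lemma gamma_order: "x \<in> lower_central G H n \<Longrightarrow> order_ge (Suc n) (m x - 1)"
proof (induction n arbitrary: x)
  case 0
  then show ?case using m_order_1 by simp
next
  case (Suc n)
  have sub: "{commutator G x y | x y. x \<in> lower_central G H n \<and> y \<in> H} \<subseteq> H"
    using lower_central_commutator gH by blast
  have gen: "order_ge (Suc (Suc n)) (m s - 1)" if "s \<in> {commutator G x y | x y. x \<in> lower_central G H n \<and> y \<in> H}" for s
    using that m_commutator(1)[OF gH Suc.IH _ m_order_1] by auto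
  have HS: "y \<in> H" if "y \<in> generate G {commutator G x y | x y. x \<in> lower_central G H n \<and> y \<in> H}" for y
    using generate_subgroup_incl[OF sub H_subgroup] that by blast
  from Suc.prems show ?case
    unfolding lower_central.simps(2)
  proof induction
    case (inv s)
    have sH: "s \<in> H" using inv sub by blast
    have "m (inv s) - 1 = - (m s - 1) - (m (inv s) - 1) * (m s - 1)"
      using m_inv[OF sH] by (simp add: algebra_simps)
    from order_ge_fixpoint(1)[OF this order_ge_uminus[OF gen[OF inv]] m_order_1[OF sH]] show ?case .
  next
    case (eng x y)
    have E: "m (x \<otimes> y) - 1 = (m x - 1) + (m y - 1) + (m x - 1) * (m y - 1)"
      using eng HS by (simp add: m_mult algebra_simps)
    have O: "order_ge (Suc (Suc n)) ((m x - 1) * (m y - 1))"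
      using order_ge_mult[OF eng.IH] by (rule order_ge_mono) simp
    show ?case unfolding E by (intro order_ge_add eng.IH O)
  qed (use gen in \<open>auto simp: m_one order_ge_def\<close>)
qed

end

primrec tree_commutator :: "('g, 'm) monoid_scheme \<Rightarrow> (nat \<Rightarrow> 'g) \<Rightarrow> ltree \<Rightarrow> 'g" where
  "tree_commutator G \<phi> (Leaf i) = \<phi> i"
| "tree_commutator G \<phi> (Node s t) = commutator G (tree_commutator G \<phi> s) (tree_commutator G \<phi> t)"

definition hall_trees :: "nat \<Rightarrow> nat \<Rightarrow> ltree set" where
  "hall_trees r n = {t. hall t \<and> length (foliage t) = n \<and> set (foliage t) \<subseteq> {..<r}}"

lemma finite_hall_trees: "finite (hall_trees r n)"
proof (rule finite_imageD)
  show "finite (foliage ` hall_trees r n)"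
    by (rule finite_subset[OF _ finite_lists_length_eq[of "{..<r}" n]]) (auto simp: hall_trees_def)
  show "inj_on foliage (hall_trees r n)"
    by (auto intro!: inj_onI hall_foliage_inj simp: hall_trees_def)
qed

locale generated_group = group G for G (structure) +
  fixes \<phi> :: "nat \<Rightarrow> 'a" and r :: nat
  assumes gen_closed: "i < r \<Longrightarrow> \<phi> i \<in> carrier G"
begin

definition "H = generate G (\<phi> ` {..<r})"
abbreviation "\<gamma> \<equiv> lower_central G H"
abbreviation "P \<equiv> tree_commutator G \<phi>"

text \<open>
  For \<open>n\<close> positive, a subgroup between the terms \<open>n - 1\<close> and \<open>n\<close> of the lower central series,
  since the term with index \<open>n - 1\<close> contains the commutators of \<open>n\<close> generators.
\<close>

definition hall_span :: "nat \<Rightarrow> ltree set \<Rightarrow> 'a set" where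
  "hall_span n F = generate G (P ` (F \<inter> hall_trees r n) \<union> \<gamma> n)"

lemma gens_carrier: "\<phi> ` {..<r} \<subseteq> carrier G"
  using gen_closed by auto

lemma H_subgroup: "subgroup H G"
  unfolding H_def by (rule generate_is_subgroup[OF gens_carrier])

lemma gens_H: "\<phi> ` {..<r} \<subseteq> H"
  by (auto simp: H_def intro: generate.incl)

lemma gamma_H: "x \<in> \<gamma> n \<Longrightarrow> x \<in> H"
  using lower_central_le[OF H_subgroup] by blast

lemma H_carrier: "x \<in> H \<Longrightarrow> x \<in> carrier G"
  using subgroup.mem_carrier[OF H_subgroup] .

lemma P_gamma: "set (foliage t) \<subseteq> {..<r} \<Longrightarrow> P t \<in> \<gamma> (length (foliage t) - 1)"
proof (induction t)
  case (Leaf i)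
  then show ?case using gens_H by auto
next
  case (Node s t)
  have "length (foliage s) > 0" "length (foliage t) > 0" using foliage_nonempty by auto
  then have "length (foliage (Node s t)) - 1 = Suc (length (foliage s) - 1 + (length (foliage t) - 1))"
    unfolding foliage.simps length_append by linarith
  moreover have "P s \<in> \<gamma> (length (foliage s) - 1)" "P t \<in> \<gamma> (length (foliage t) - 1)"
    using Node.IH Node.prems by simp_all
  ultimately show ?case
    unfolding tree_commutator.simps using commutator_lower_central[OF H_subgroup] by metis
qed

lemma hall_trees_gamma: "t \<in> hall_trees r (Suc n) \<Longrightarrow> P t \<in> \<gamma> n"
  using P_gamma[of t] by (simp add: hall_trees_def)

lemma hall_span_mono: "F \<subseteq> F' \<Longrightarrow> hall_span n F \<subseteq> hall_span n F'"
  unfolding hall_span_def by (intro mono_generate) blast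

lemma hall_span:
  shows "subgroup (hall_span (Suc n) F) G" and "\<gamma> (Suc n) \<subseteq> hall_span (Suc n) F"
    and "hall_span (Suc n) F \<subseteq> \<gamma> n" and "t \<in> F \<Longrightarrow> t \<in> hall_trees r (Suc n) \<Longrightarrow> P t \<in> hall_span (Suc n) F"
proof -
  have c: "P ` (F \<inter> hall_trees r (Suc n)) \<union> \<gamma> (Suc n) \<subseteq> \<gamma> n"
    using hall_trees_gamma lower_central_Suc_le[OF H_subgroup] by blast
  then have "P ` (F \<inter> hall_trees r (Suc n)) \<union> \<gamma> (Suc n) \<subseteq> carrier G"
    using gamma_H H_carrier by blast
  then show "subgroup (hall_span (Suc n) F) G" unfolding hall_span_def by (rule generate_is_subgroup)
  show "hall_span (Suc n) F \<subseteq> \<gamma> n"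
    unfolding hall_span_def by (rule generate_subgroup_incl[OF c lower_central_subgroup[OF H_subgroup]])
  show "\<gamma> (Suc n) \<subseteq> hall_span (Suc n) F" "t \<in> F \<Longrightarrow> t \<in> hall_trees r (Suc n) \<Longrightarrow> P t \<in> hall_span (Suc n) F"
    by (auto simp: hall_span_def intro: generate.incl)
qed

abbreviation below :: "nat list \<Rightarrow> ltree set" where
  "below v \<equiv> {t. foliage t < v}"

lemma hall_span_below_mono: "u < v \<Longrightarrow> hall_span n (below u) \<subseteq> hall_span n (below v)"
  by (rule hall_span_mono) auto

text \<open>
  The lexicographic order on words of unbounded length is not well-founded. The rank counts
  the smaller words of length at most \<open>n\<close>, so it can serve as a measure for induction.
\<close>

definition word_rank :: "nat \<Rightarrow> nat list \<Rightarrow> nat" where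
  "word_rank n v = card {w. set w \<subseteq> {..<r} \<and> length w \<le> n \<and> w < v}"

lemma word_rank_less:
  assumes "u < v" "set u \<subseteq> {..<r}" "length u \<le> n"
  shows "word_rank n u < word_rank n v"
  unfolding word_rank_def
proof (rule psubset_card_mono)
  show "finite {w. set w \<subseteq> {..<r} \<and> length w \<le> n \<and> w < v}"
    by (rule finite_subset[OF _ finite_lists_length_le[of "{..<r}" n]]) auto
  show "{w. set w \<subseteq> {..<r} \<and> length w \<le> n \<and> w < u} \<subset> {w. set w \<subseteq> {..<r} \<and> length w \<le> n \<and> w < v}"
    using assms by auto
qed

lemma commutator_self: "x \<in> carrier G \<Longrightarrow> commutator G x x = \<one>"
  by (simp add: commutator_def m_assoc mult_inv_cancel)

text \<open>
  Rewriting a bracket of Hall trees in terms of Hall trees. If \<open>Node s t\<close> is not a Hall tree,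
  then \<open>s = Node s1 s2\<close> with \<open>foliage s2 < foliage t\<close>, and by Jacobi's identity
  \<open>[[s1, s2], t]\<close> reduces to \<open>[[s1, t], s2]\<close> and \<open>[s1, [s2, t]]\<close>. The inner brackets have
  lower weight, so they expand into trees with foliage below that of \<open>t\<close>. What remains are
  brackets of two trees that both lie below \<open>t\<close>, to which the induction on the rank of the
  larger foliage applies.
\<close>

lemma hall_commutator:
  assumes "s \<in> hall_trees r a" "t \<in> hall_trees r b" "foliage s < foliage t" "a + b = n"
  shows "commutator G (P s) (P t) \<in> hall_span n (below (foliage t))"
  using assms
proof (induction n arbitrary: a b s t rule: less_induct)
  case (less n)
  note IHn = less.IH
  show ?case using less.prems
  proof (induction "word_rank n (foliage t)" arbitrary: s t a b rule: less_induct)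
    case less
    note IHr = less.hyps
    let ?v = "foliage t"
    have s: "hall s" "length (foliage s) = a" "set (foliage s) \<subseteq> {..<r}"
      and t: "hall t" "length ?v = b" "set ?v \<subseteq> {..<r}"
      using less.prems by (auto simp: hall_trees_def)
    have pos: "a > 0" "b > 0" using s(2) t(2) foliage_nonempty by auto
    then obtain p where p: "n = Suc p" using less.prems(4) by (cases n) auto
    let ?T = "hall_span n (below ?v)"
    note T = hall_span[where n = p and F = "below ?v", folded p]
    have T2: "\<gamma> (Suc p) \<subseteq> ?T" using T(2) by (simp only: p[symmetric])
    have nor: "h \<otimes> x \<otimes> inv h \<in> ?T" if "h \<in> H" "x \<in> ?T" for h x
      using between_lower_central_normal[OF H_subgroup T(1) T2 T(3) that] .
    have PG: "P q \<in> carrier G" if "q \<in> hall_trees r c" for q c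
      using P_gamma[of q] gamma_H H_carrier that by (auto simp: hall_trees_def)
    have ext: "commutator G (P q1) (P q2) \<in> ?T"
      if q: "q1 \<in> hall_trees r a'" "q2 \<in> hall_trees r b'" "a' + b' = n" "foliage q1 < ?v" "foliage q2 < ?v"
      for q1 q2 a' b'
    proof -
      consider "foliage q1 < foliage q2" | "foliage q2 < foliage q1" | "foliage q1 = foliage q2" by fastforce
      then show ?thesis
      proof cases
        case 1
        have "word_rank n (foliage q2) < word_rank n ?v"
          using q by (intro word_rank_less) (auto simp: hall_trees_def)
        from IHr[OF this q(1,2) 1 q(3)]
        show ?thesis by (rule subsetD[OF hall_span_below_mono[OF q(5)]])
      next
        case 2
        have "word_rank n (foliage q1) < word_rank n ?v"
          using q by (intro word_rank_less) (auto simp: hall_trees_def)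
        from IHr[OF this q(2,1) 2] q(3) have "commutator G (P q2) (P q1) \<in> hall_span n (below (foliage q1))"
          by (simp add: add.commute)
        then have "commutator G (P q2) (P q1) \<in> ?T"
          by (rule subsetD[OF hall_span_below_mono[OF q(4)]])
        from subgroup.m_inv_closed[OF T(1) this] show ?thesis
          using PG q by (simp add: commutator_inv)
      next
        case 3
        then have "q1 = q2" using q hall_foliage_inj by (auto simp: hall_trees_def)
        then show ?thesis using PG[OF q(1)] subgroup.one_closed[OF T(1)] by (simp add: commutator_self)
      qed
    qed
    have node: "commutator G (P s) (P t) \<in> ?T" if h: "hall (Node s t)"
    proof -
      have "Node s t \<in> hall_trees r n" using h s t less.prems(4) by (simp add: hall_trees_def)
      moreover have "Node s t \<in> below ?v"
        using lyndon_append_less[OF foliage_nonempty hall_lyndon[OF t(1)] less.prems(3)] by simp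
      ultimately show ?thesis using T(4)[of "Node s t"] by simp
    qed
    show ?case
    proof (cases s)
      case (Leaf i)
      then show ?thesis using node t less.prems(3) by simp
    next
      case sN: (Node s1 s2)
      show ?thesis
      proof (cases "?v \<le> foliage s2")
        case True
        then show ?thesis using node s t less.prems(3) sN by simp
      next
        case False
        let ?a1 = "length (foliage s1)" and ?a2 = "length (foliage s2)"
        have s12: "s1 \<in> hall_trees r ?a1" "s2 \<in> hall_trees r ?a2" "foliage s1 < foliage s2"
          using s sN by (auto simp: hall_trees_def)
        have v: "foliage s2 < ?v" "foliage s1 < ?v" using False s12(3) by auto
        have n: "?a1 + ?a2 + b = n" using s(2) sN less.prems(4) by simp
        have a12: "?a1 > 0" "?a2 > 0" using foliage_nonempty by auto
        have tb: "t \<in> hall_trees r b" by (rule less.prems(2))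
        have gens: "P ` (below ?v \<inter> hall_trees r c) \<union> \<gamma> c \<subseteq> H" for c
          using P_gamma gamma_H by (auto simp: hall_trees_def)
        have low: "x \<in> \<gamma> (length (foliage q) - 1)" "x \<in> carrier G"
          if "x = P q" "q \<in> hall_trees r (length (foliage q))" for x q
          using that P_gamma[of q] PG by (auto simp: hall_trees_def)
        have A: "commutator G (commutator G (P s1) (P t)) (P s2) \<in> ?T"
        proof (rule commutator_generate_left[OF H_subgroup T(1) nor gens[of "?a1 + b"]])
          show "commutator G (P s1) (P t) \<in> generate G (P ` (below ?v \<inter> hall_trees r (?a1 + b)) \<union> \<gamma> (?a1 + b))"
            using IHn[OF _ s12(1) tb v(2) HOL.refl] n a12 by (simp add: hall_span_def)
          fix x assume "x \<in> P ` (below ?v \<inter> hall_trees r (?a1 + b)) \<union> \<gamma> (?a1 + b)"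
          then show "commutator G x (P s2) \<in> ?T"
          proof
            assume "x \<in> P ` (below ?v \<inter> hall_trees r (?a1 + b))"
            then show ?thesis using ext[OF _ s12(2)] n v by auto
          next
            assume "x \<in> \<gamma> (?a1 + b)"
            then have "commutator G x (P s2) \<in> \<gamma> (Suc (?a1 + b + (?a2 - 1)))"
              using commutator_lower_central[OF H_subgroup _ low(1)[OF HOL.refl s12(2)]] by blast
            moreover have "Suc (?a1 + b + (?a2 - 1)) = n" using n a12 by linarith
            ultimately show ?thesis using T(2) by auto
          qed
        qed (use PG s12 in auto)
        have B: "commutator G (P s1) (commutator G (P s2) (P t)) \<in> ?T"
        proof (rule commutator_generate_right[OF H_subgroup T(1) nor gens[of "?a2 + b"]])
          show "commutator G (P s2) (P t) \<in> generate G (P ` (below ?v \<inter> hall_trees r (?a2 + b)) \<union> \<gamma> (?a2 + b))"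
            using IHn[OF _ s12(2) tb v(1) HOL.refl] n a12 by (simp add: hall_span_def)
          fix x assume "x \<in> P ` (below ?v \<inter> hall_trees r (?a2 + b)) \<union> \<gamma> (?a2 + b)"
          then show "commutator G (P s1) x \<in> ?T"
          proof
            assume "x \<in> P ` (below ?v \<inter> hall_trees r (?a2 + b))"
            then show ?thesis using ext[OF s12(1)] n v by auto
          next
            assume "x \<in> \<gamma> (?a2 + b)"
            then have "commutator G (P s1) x \<in> \<gamma> (Suc (?a1 - 1 + (?a2 + b)))"
              using commutator_lower_central[OF H_subgroup low(1)[OF HOL.refl s12(1)]] by blast
            moreover have "Suc (?a1 - 1 + (?a2 + b)) = n" using n a12 by linarith
            ultimately show ?thesis using T(2) by auto
          qed
        qed (use PG s12 in auto)
        have t': "t \<in> hall_trees r (length (foliage t))" using tb t(2) by simp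
        have i3: "?a1 - 1 + (?a2 - 1) + (length ?v - 1) + 3 = n" and i2: "?a1 - 1 + (?a2 - 1) + (length ?v - 1) + 2 = p"
          using n a12 pos t(2) p by linarith+
        have "commutator G (commutator G (P s1) (P s2)) (P t) \<in> ?T"
          using commutator_jacobi[OF H_subgroup low(1)[OF HOL.refl s12(1)] low(1)[OF HOL.refl s12(2)]
              low(1)[OF HOL.refl t'] T(1) _ _ A B] T(2,3) unfolding i3 i2 by blast
        then show ?thesis using sN by simp
      qed
    qed
  qed
qed

lemma hall_span_UNIV: "hall_span (Suc n) UNIV = \<gamma> n"
proof
  show "hall_span (Suc n) UNIV \<subseteq> \<gamma> n" by (rule hall_span)
  show "\<gamma> n \<subseteq> hall_span (Suc n) UNIV"
  proof (induction n)
    case 0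
    have "\<phi> i \<in> hall_span (Suc 0) UNIV" if "i < r" for i
      using hall_span(4)[of "Leaf i" UNIV 0] that by (simp add: hall_trees_def)
    then have "H \<subseteq> hall_span (Suc 0) UNIV"
      unfolding H_def by (intro generate_subgroup_incl hall_span) auto
    then show ?case by simp
  next
    case (Suc n)
    let ?T = "hall_span (Suc (Suc n)) UNIV"
    show ?case
    proof (rule lower_central_generators[OF H_subgroup H_def[symmetric] gens_H])
      show "P ` hall_trees r (Suc n) \<subseteq> \<gamma> n" using hall_trees_gamma by blast
      show "\<gamma> n \<subseteq> generate G (P ` hall_trees r (Suc n) \<union> \<gamma> (Suc n))"
        using Suc by (simp add: hall_span_def)
      show "subgroup ?T G" "\<gamma> (Suc (Suc n)) \<subseteq> ?T" "?T \<subseteq> \<gamma> (Suc n)" by (rule hall_span)+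
      fix x y assume "x \<in> P ` hall_trees r (Suc n)" "y \<in> \<phi> ` {..<r}"
      then obtain s i where s: "s \<in> hall_trees r (Suc n)" "x = P s" and i: "i < r" "y = P (Leaf i)" by auto
      have l: "Leaf i \<in> hall_trees r (Suc 0)" using i by (simp add: hall_trees_def)
      have G: "P s \<in> carrier G" "P (Leaf i) \<in> carrier G"
        using hall_trees_gamma[OF s(1)] hall_trees_gamma[OF l] gamma_H H_carrier by blast+
      consider "foliage s < foliage (Leaf i)" | "foliage (Leaf i) < foliage s" | "foliage s = foliage (Leaf i)" by fastforce
      then show "commutator G x y \<in> ?T"
      proof cases
        case 1
        from hall_commutator[OF s(1) l 1] have "commutator G x y \<in> hall_span (Suc (Suc n)) (below (foliage (Leaf i)))"
          using s i by simp
        then show ?thesis using hall_span_mono[of "below (foliage (Leaf i))" UNIV] by auto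
      next
        case 2
        from hall_commutator[OF l s(1) 2] have "commutator G y x \<in> hall_span (Suc (Suc n)) (below (foliage s))"
          using s i by simp
        then have "commutator G y x \<in> ?T" using hall_span_mono[of "below (foliage s)" UNIV] by auto
        from subgroup.m_inv_closed[OF hall_span(1) this] show ?thesis using s i G by (simp add: commutator_inv)
      next
        case 3
        then have "s = Leaf i" using s l hall_foliage_inj[of s "Leaf i"] by (simp add: hall_trees_def)
        then show ?thesis using s i G subgroup.one_closed[OF hall_span(1)] by (simp add: commutator_self)
      qed
    qed
  qed
qed

end

text \<open>
  The homomorphism \<open>m\<close>, which sends each generator to one plus a letter, takes the place of
  freeness of the group that the \<open>\<phi> i\<close> generate.
\<close>

locale magnus_map = generated_group +
  fixes m :: "'a \<Rightarrow> (nat, 'k::{comm_ring_1,ring_char_0}) nc_series"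
  assumes m_mult: "x \<in> H \<Longrightarrow> y \<in> H \<Longrightarrow> m (x \<otimes> y) = m x * m y"
    and m_one: "m \<one> = 1"
    and m_gen: "i < r \<Longrightarrow> m (\<phi> i) = 1 + letter i"
begin

lemma m_inverse: "x \<in> H \<Longrightarrow> m (inv x) * m x = 1"
  using m_mult[of "inv x" x] subgroup.m_inv_closed[OF H_subgroup] H_carrier m_one by simp

lemma m_Nil:
  assumes "x \<in> H"
  shows "ncoeff (m x) [] = 1"
  using assms unfolding H_def
proof induction
  case (incl s)
  then show ?case by (auto simp: m_gen letter_def)
next
  case (inv s)
  then have "ncoeff (m s) [] = 1" "s \<in> H" using gens_H by (auto simp: m_gen letter_def)
  then show ?case using arg_cong[OF m_inverse, of s "\<lambda>x. ncoeff x []"] by (simp add: ncoeff_mult_Nil)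
next
  case (eng x y)
  then show ?case by (simp add: m_mult[unfolded H_def] ncoeff_mult_Nil)
qed (simp add: m_one)

sublocale series_hom G H m
  by (intro series_hom.intro series_hom_axioms.intro group_axioms H_subgroup m_mult m_one m_Nil)

lemma m_tree:
  "set (foliage t) \<subseteq> {..<r} \<Longrightarrow> order_ge (Suc (length (foliage t))) (m (P t) - 1 - tree_poly t)"
proof (induction t)
  case (Leaf i)
  then show ?case by (simp add: m_gen order_ge_def)
next
  case (Node s t)
  let ?a = "length (foliage s)" and ?b = "length (foliage t)"
  let ?X = "m (P s) - 1" and ?Y = "m (P t) - 1"
  let ?S = "tree_poly s :: (nat, 'k) nc_series" and ?T = "tree_poly t :: (nat, 'k) nc_series"
  have st: "set (foliage s) \<subseteq> {..<r}" "set (foliage t) \<subseteq> {..<r}" using Node.prems by auto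
  have H: "P s \<in> H" "P t \<in> H" using P_gamma gamma_H st by blast+
  have X: "order_ge ?a ?X" and Y: "order_ge ?b ?Y"
    using gamma_order[OF P_gamma[OF st(1)]] gamma_order[OF P_gamma[OF st(2)]] foliage_nonempty by simp_all
  have U: "order_ge (Suc ?a) (?X - ?S)" and W: "order_ge (Suc ?b) (?Y - ?T)" using Node.IH st by auto
  have S: "order_ge ?a ?S" and T: "order_ge ?b ?T"
    using homogeneous_tree_poly homogeneous_order_ge by blast+
  have "order_ge (Suc (?a + ?b)) ((?X - ?S) * ?Y + ?S * (?Y - ?T) - ((?Y - ?T) * ?X + ?T * (?X - ?S)))"
    using order_ge_mult[OF U Y] order_ge_mult[OF S W] order_ge_mult[OF W X] order_ge_mult[OF T U]
    by (intro order_ge_diff order_ge_add) (simp_all add: add.commute)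
  also have "(?X - ?S) * ?Y + ?S * (?Y - ?T) - ((?Y - ?T) * ?X + ?T * (?X - ?S)) =
      (?X * ?Y - ?Y * ?X) - tree_poly (Node s t)"
    by (simp add: algebra_simps)
  finally have "order_ge (Suc (?a + ?b)) ((?X * ?Y - ?Y * ?X) - tree_poly (Node s t))" .
  from order_ge_add[OF m_commutator(2)[OF H(1) X H(2) Y] this] show ?case by (simp add: algebra_simps)
qed

lemma ncoeff_gamma_mult:
  assumes "x \<in> \<gamma> n" "y \<in> \<gamma> n" "length w = Suc n"
  shows "ncoeff (m (x \<otimes> y)) w = ncoeff (m x) w + ncoeff (m y) w"
proof -
  have "m (x \<otimes> y) = m x + m y - 1 + (m x - 1) * (m y - 1)"
    using gamma_H assms by (simp add: m_mult algebra_simps)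
  moreover have "ncoeff ((m x - 1) * (m y - 1)) w = 0"
    using order_ge_mult[OF gamma_order[OF assms(1)] gamma_order[OF assms(2)]] assms(3) by (simp add: order_ge_def)
  moreover have "w \<noteq> []" using assms(3) by auto
  ultimately show ?thesis by simp
qed

lemma ncoeff_gamma_inv:
  assumes "x \<in> \<gamma> n" "length w = Suc n"
  shows "ncoeff (m (inv x)) w = - ncoeff (m x) w"
proof -
  have "ncoeff (m (inv x \<otimes> x)) w = 0"
    using gamma_H[OF assms(1)] H_carrier assms(2) by (auto simp: m_one)
  then show ?thesis
    using ncoeff_gamma_mult[OF subgroup.m_inv_closed[OF lower_central_subgroup[OF H_subgroup] assms(1)] assms]
    by (simp add: eq_neg_iff_add_eq_0)
qed

lemma ncoeff_gamma_int_pow: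
  assumes x: "x \<in> \<gamma> n" and w: "length w = Suc n"
  shows "ncoeff (m (x [^] (k::int))) w = of_int k * ncoeff (m x) w"
proof -
  note sub = lower_central_subgroup[OF H_subgroup, of n]
  have xG: "x \<in> carrier G" using gamma_H[OF x] H_carrier by blast
  have nat: "x [^] (j::nat) \<in> \<gamma> n \<and> ncoeff (m (x [^] j)) w = of_nat j * ncoeff (m x) w" for j
  proof (induction j)
    case 0
    then show ?case using subgroup.one_closed[OF sub] w by (auto simp: m_one)
  next
    case (Suc j)
    then show ?case using ncoeff_gamma_mult[OF _ x w, of "x [^] j"] subgroup.m_closed[OF sub _ x]
      by (simp add: algebra_simps)
  qed
  show ?thesis
  proof (cases "k \<ge> 0")
    case True
    then show ?thesis using nat[of "nat k"] by (metis int_pow_int nat_0_le of_int_of_nat_eq)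
  next
    case False
    define j where "j = nat (- k)"
    have k: "k = - int j" using False by (simp add: j_def)
    have "x [^] k = inv (x [^] j)" using xG by (simp add: k int_pow_neg int_pow_int)
    then show ?thesis using nat[of j] ncoeff_gamma_inv[OF _ w, of "x [^] j"] by (simp add: k)
  qed
qed

text \<open>
  Let \<open>q\<close> be the tree in \<open>F\<close> with the least foliage \<open>v\<close>, and write \<open>g\<close> as a power \<open>k\<close> of its
  commutator up to an element of the span of the others. By triangularity
  (\<open>tree_poly_leading\<close>) only \<open>q\<close> has a coefficient at \<open>v\<close>, which is 1, so the coefficient of
  \<open>g\<close> at \<open>v\<close> is \<open>k\<close>. It vanishes, and \<open>q\<close> can be removed from \<open>F\<close>.
\<close>

lemma hall_span_elimination:
  "\<lbrakk>finite F; F \<subseteq> hall_trees r (Suc n); g \<in> hall_span (Suc n) F; order_ge (Suc (Suc n)) (m g - 1)\<rbrakk>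
    \<Longrightarrow> g \<in> \<gamma> (Suc n)"
proof (induction "card F" arbitrary: F rule: less_induct)
  case less
  show ?case
  proof (cases "F = {}")
    case True
    then have "g \<in> generate G (\<gamma> (Suc n))" using less.prems(3) by (simp add: hall_span_def)
    then show ?thesis
      using generate_subgroup_incl[OF order_refl lower_central_subgroup[OF H_subgroup]] by blast
  next
    case False
    define v where "v = Min (foliage ` F)"
    have "v \<in> foliage ` F" unfolding v_def using False less.prems(1) by (intro Min_in) auto
    then obtain q where q: "q \<in> F" "foliage q = v" by blast
    have qT: "q \<in> hall_trees r (Suc n)" using q(1) less.prems(2) by blast
    then have qv: "hall q" "length v = Suc n" "set v \<subseteq> {..<r}" using q(2) by (auto simp: hall_trees_def)
    let ?F = "F - {q}" and ?K = "hall_span (Suc n) (F - {q})"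
    note K = hall_span[where n = n and F = ?F]
    have Kn: "x \<in> \<gamma> n" if "x \<in> ?K" for x using K(3) that by blast
    have lead: "ncoeff (m (P t)) v = ncoeff (tree_poly t) v" if "t \<in> hall_trees r (Suc n)" for t
    proof -
      have t: "set (foliage t) \<subseteq> {..<r}" "length (foliage t) = Suc n" using that by (auto simp: hall_trees_def)
      have "ncoeff (m (P t) - 1 - tree_poly t) v = 0"
        using m_tree[OF t(1)] t(2) qv(2) by (simp add: order_ge_def)
      moreover have "v \<noteq> []" using qv(2) by auto
      ultimately show ?thesis by simp
    qed
    have K0: "ncoeff (m x) v = 0" if "x \<in> ?K" for x
      using that unfolding hall_span_def
    proof induction
      let ?S = "P ` (?F \<inter> hall_trees r (Suc n)) \<union> \<gamma> (Suc n)"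
      have S0: "ncoeff (m s) v = 0" if "s \<in> ?S" for s
        using that
      proof
        assume "s \<in> P ` (?F \<inter> hall_trees r (Suc n))"
        then obtain t where t: "t \<in> F" "t \<noteq> q" "t \<in> hall_trees r (Suc n)" "s = P t" by blast
        have "foliage t \<noteq> v" using hall_foliage_inj[of t q] t qT q(2) by (auto simp: hall_trees_def)
        moreover have "v \<le> foliage t" unfolding v_def using t(1) less.prems(1) by simp
        ultimately have "\<not> foliage t \<le> v" by simp
        moreover have "hall t" using t(3) by (simp add: hall_trees_def)
        ultimately have "ncoeff (tree_poly t :: (nat, 'k) nc_series) v = 0"
          using tree_poly_leading[of t, where 'k = 'k] by blast
        then show ?thesis using lead[OF t(3)] t(4) by simp
      next
        assume "s \<in> \<gamma> (Suc n)"
        from gamma_order[OF this] have "ncoeff (m s - 1) v = 0" using qv(2) by (simp add: order_ge_def)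
        moreover have "v \<noteq> []" using qv(2) by auto
        ultimately show ?thesis by simp
      qed
      have mem: "x \<in> \<gamma> n" if "x \<in> generate G ?S" for x using Kn that by (simp add: hall_span_def)
      {
        case one
        show ?case using qv(2) by (auto simp: m_one)
      next
        case (incl s)
        then show ?case by (rule S0)
      next
        case (inv s)
        have "s \<in> \<gamma> n" by (rule mem[OF generate.incl[OF inv]])
        then show ?case using ncoeff_gamma_inv[OF _ qv(2)] S0[OF inv] by simp
      next
        case (eng x y)
        then show ?case using ncoeff_gamma_mult[OF mem mem qv(2)] by simp
      }
    qed
    have norK: "h \<otimes> x \<otimes> inv h \<in> ?K" if "h \<in> H" "x \<in> ?K" for h x
      using between_lower_central_normal[OF H_subgroup K(1,2,3) that] .
    have Pq: "P q \<in> \<gamma> n" by (rule hall_trees_gamma[OF qT])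
    have PqH: "P q \<in> H" "P q \<in> carrier G" using gamma_H[OF Pq] H_carrier by auto
    have "g \<in> generate G (insert (P q) ?K)"
    proof -
      have "P ` (F \<inter> hall_trees r (Suc n)) \<union> \<gamma> (Suc n) \<subseteq> insert (P q) ?K"
        using K(2,4) by blast
      then show ?thesis using less.prems(3) mono_generate unfolding hall_span_def[of _ F] by blast
    qed
    then obtain h and k :: int where hk: "h \<in> ?K" "g = h \<otimes> P q [^] k"
      using generate_insert_normalizing[OF K(1) PqH(2), of g] norK PqH sub_closed(2) norK[of "inv (P q)"] by auto
    have Pqk: "P q [^] k \<in> \<gamma> n"
      using group.int_pow_closed[OF subgroup.subgroup_is_group[OF lower_central_subgroup[OF H_subgroup] group_axioms, of n], of "P q" k]
        int_pow_consistent[OF lower_central_subgroup[OF H_subgroup] Pq, of k] Pq by simp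
    have "ncoeff (m g) v = 0"
    proof -
      have "ncoeff (m g - 1) v = 0" using less.prems(4) qv(2) by (simp add: order_ge_def)
      moreover have "v \<noteq> []" using qv(2) by auto
      ultimately show ?thesis by simp
    qed
    moreover have "ncoeff (m g) v = of_int k"
      using ncoeff_gamma_mult[OF Kn[OF hk(1)] Pqk qv(2)] ncoeff_gamma_int_pow[OF Pq qv(2)] K0[OF hk(1)]
        lead[OF qT] tree_poly_leading[OF qv(1), where 'k = 'k] q(2) hk(2) by simp
    ultimately have "k = 0" by simp
    moreover have "h \<in> carrier G" using H_carrier[OF gamma_H[OF Kn[OF hk(1)]]] .
    ultimately have "g \<in> ?K" using hk by simp
    moreover have "card ?F < card F" using q(1) less.prems(1) by (rule card_Diff1_less[rotated])
    ultimately show ?thesis using less.hyps[of ?F] less.prems by auto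
  qed
qed

text \<open>
  The commutators of Hall trees span each factor of the lower central series, and their
  leading parts are linearly independent. So if an element of the \<open>c\<close>-th term has too large an
  order, it lies in the next term.
\<close>

theorem magnus_witt:
  "g \<in> H \<Longrightarrow> order_ge (Suc c) (m g - 1) \<Longrightarrow> g \<in> \<gamma> c"
proof (induction c)
  case (Suc c)
  have "g \<in> \<gamma> c" using Suc order_ge_mono[OF Suc.prems(2), of "Suc c"] by simp
  then have "g \<in> hall_span (Suc c) UNIV" by (simp add: hall_span_UNIV)
  then have "g \<in> hall_span (Suc c) (hall_trees r (Suc c))" by (simp add: hall_span_def)
  from hall_span_elimination[OF finite_hall_trees order_refl this Suc.prems(2)] show ?case .
qed simp

end


section \<open>Groups of units and wreath products\<close>

definition series_units :: "('x, 'k::comm_ring_1) nc_series monoid" where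
  "series_units = \<lparr>carrier = {u. \<exists>v. u * v = 1 \<and> v * u = 1}, monoid.mult = (*), one = 1\<rparr>"

lemma group_series_units: "group (series_units :: ('x, 'k::comm_ring_1) nc_series monoid)"
proof (rule groupI)
  fix x y :: "('x, 'k) nc_series" assume "x \<in> carrier series_units" "y \<in> carrier series_units"
  then obtain x' y' where "x * x' = 1" "x' * x = 1" "y * y' = 1" "y' * y = 1"
    by (auto simp: series_units_def)
  then have "(x * y) * (y' * x') = 1" "(y' * x') * (x * y) = 1"
    by (metis mult.assoc mult.right_neutral)+
  then show "x \<otimes>\<^bsub>series_units\<^esub> y \<in> carrier series_units" by (auto simp: series_units_def)
next
  fix x :: "('x, 'k) nc_series" assume "x \<in> carrier series_units"
  then obtain x' where "x * x' = 1" "x' * x = 1" by (auto simp: series_units_def)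
  then show "\<exists>y\<in>carrier series_units. y \<otimes>\<^bsub>series_units\<^esub> x = \<one>\<^bsub>series_units\<^esub>"
    by (auto simp: series_units_def)
qed (auto simp: series_units_def mult.assoc)

definition linear_series :: "('x \<Rightarrow> 'k::comm_ring_1) \<Rightarrow> ('x, 'k) nc_series" where
  "linear_series \<omega> = Series (\<lambda>w. case w of [i] \<Rightarrow> \<omega> i | _ \<Rightarrow> 0)"

lemma ncoeff_linear_series:
  "ncoeff (linear_series \<omega>) [] = 0" "ncoeff (linear_series \<omega>) [i] = \<omega> i"
  "ncoeff (linear_series \<omega>) (i # j # w) = 0" "ncoeff (linear_series \<omega>) (i # w) = (if w = [] then \<omega> i else 0)"
  by (simp_all add: linear_series_def split: list.split)

lemma one_plus_linear_unit: "1 + linear_series \<omega> \<in> carrier (series_units :: ('x, 'k::comm_ring_1) nc_series monoid)"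
proof -
  \<comment> \<open>The geometric series of the negated linear part.\<close>
  define v where "v = Series (\<lambda>w. prod_list (map (\<lambda>i. - \<omega> i) w))"
  let ?u = "1 + linear_series \<omega>"
  have "ncoeff (?u * v) w = ncoeff 1 w" for w
  proof (cases w)
    case (Cons a w')
    have "convolve w' (\<lambda>u. ncoeff ?u (a # u)) (ncoeff v) = convolve w' (\<lambda>u. \<omega> a * (if u = [] then 1 else 0)) (ncoeff v)"
      by (rule arg_cong[where f = "\<lambda>f. convolve w' f (ncoeff v)"]) (auto simp: fun_eq_iff ncoeff_linear_series(4))
    also have "\<dots> = \<omega> a * ncoeff v w'" by (simp only: convolve_scale_left convolve_one_left)
    finally show ?thesis using Cons
      by (simp add: times_nc_series_def ncoeff_linear_series v_def)
  qed (simp add: ncoeff_mult ncoeff_linear_series v_def)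
  moreover have "ncoeff (v * ?u) w = ncoeff 1 w" for w
  proof (induction w)
    case (Cons a w)
    have "convolve w (\<lambda>u. ncoeff v (a # u)) (ncoeff ?u) = - \<omega> a * convolve w (ncoeff v) (ncoeff ?u)"
      unfolding convolve_scale_left[symmetric] by (simp add: v_def)
    then show ?case using Cons
      by (simp add: times_nc_series_def ncoeff_linear_series(1,4) v_def)
  qed (simp add: ncoeff_mult ncoeff_linear_series v_def)
  ultimately have "?u * v = 1" "v * ?u = 1" by (auto intro: nc_series_eqI)
  then show ?thesis by (auto simp: series_units_def)
qed

text \<open>
  The unrestricted wreath product; \<open>F\<close> acts on functions by translation of the argument.
\<close>

definition wreath :: "('b, 'm) monoid_scheme \<Rightarrow> ('f, 'n) monoid_scheme \<Rightarrow> (('f \<Rightarrow> 'b) \<times> 'f) monoid" where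
  "wreath B F = \<lparr>carrier = (carrier F \<rightarrow>\<^sub>E carrier B) \<times> carrier F,
     monoid.mult = (\<lambda>p q. (\<lambda>a\<in>carrier F. fst p a \<otimes>\<^bsub>B\<^esub> fst q (a \<otimes>\<^bsub>F\<^esub> snd p), snd p \<otimes>\<^bsub>F\<^esub> snd q)),
     one = (\<lambda>a\<in>carrier F. \<one>\<^bsub>B\<^esub>, \<one>\<^bsub>F\<^esub>)\<rparr>"

lemma group_wreath:
  assumes B: "group B" and F: "group F"
  shows "group (wreath B F)"
proof (rule groupI)
  interpret B: group B by fact
  interpret F: group F by fact
  fix p q r assume p: "p \<in> carrier (wreath B F)" and q: "q \<in> carrier (wreath B F)" and r: "r \<in> carrier (wreath B F)"
  then have c: "snd p \<in> carrier F" "snd q \<in> carrier F" "snd r \<in> carrier F"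
    and f: "\<And>a. a \<in> carrier F \<Longrightarrow> fst p a \<in> carrier B" "\<And>a. a \<in> carrier F \<Longrightarrow> fst q a \<in> carrier B"
      "\<And>a. a \<in> carrier F \<Longrightarrow> fst r a \<in> carrier B"
    by (auto simp: wreath_def)
  then show "p \<otimes>\<^bsub>wreath B F\<^esub> q \<otimes>\<^bsub>wreath B F\<^esub> r = p \<otimes>\<^bsub>wreath B F\<^esub> (q \<otimes>\<^bsub>wreath B F\<^esub> r)"
    by (auto simp: wreath_def F.m_assoc B.m_assoc intro!: restrict_ext)
next
  interpret B: group B by fact
  interpret F: group F by fact
  fix p q assume "p \<in> carrier (wreath B F)" "q \<in> carrier (wreath B F)"
  then show "p \<otimes>\<^bsub>wreath B F\<^esub> q \<in> carrier (wreath B F)" by (auto simp: wreath_def PiE_iff)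
next
  interpret B: group B by fact
  interpret F: group F by fact
  show "\<one>\<^bsub>wreath B F\<^esub> \<in> carrier (wreath B F)" by (auto simp: wreath_def)
  fix p assume "p \<in> carrier (wreath B F)"
  then obtain s w where p: "p = (s, w)" "s \<in> carrier F \<rightarrow>\<^sub>E carrier B" "w \<in> carrier F"
    by (auto simp: wreath_def)
  show "\<one>\<^bsub>wreath B F\<^esub> \<otimes>\<^bsub>wreath B F\<^esub> p = p"
    using p by (auto simp: wreath_def fun_eq_iff PiE_def Pi_def extensional_def)
  let ?q = "(\<lambda>a\<in>carrier F. inv\<^bsub>B\<^esub> (s (a \<otimes>\<^bsub>F\<^esub> inv\<^bsub>F\<^esub> w)), inv\<^bsub>F\<^esub> w)"
  have "?q \<otimes>\<^bsub>wreath B F\<^esub> p = \<one>\<^bsub>wreath B F\<^esub>"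
    using p by (auto simp: wreath_def PiE_iff intro!: restrict_ext)
  moreover have "?q \<in> carrier (wreath B F)" using p by (auto simp: wreath_def PiE_iff)
  ultimately show "\<exists>q\<in>carrier (wreath B F). q \<otimes>\<^bsub>wreath B F\<^esub> p = \<one>\<^bsub>wreath B F\<^esub>" by blast
qed

text \<open>
  \<open>I a w\<close> is the product of the weights \<open>\<omega>\<close> of the edges on the path in the Cayley
  graph that starts at \<open>a\<close> and spells \<open>w\<close>. The cocycle equation says that
  \<open>w \<mapsto> (\<lambda>a. I a w, w)\<close> is a homomorphism to the wreath product, and such a
  homomorphism may be prescribed on a basis.
\<close>

lemma path_products_exist:
  fixes \<omega> :: "'f \<Rightarrow> 'f \<Rightarrow> 'b" and F :: "('f, 'm) monoid_scheme" and B :: "('b, 'n) monoid_scheme"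
  assumes F: "group F" and X: "free_basis F X" and B: "group B"
    and \<omega>: "\<And>a x. a \<in> carrier F \<Longrightarrow> x \<in> X \<Longrightarrow> \<omega> a x \<in> carrier B"
  shows "\<exists>I. (\<forall>a\<in>carrier F. \<forall>w\<in>carrier F. I a w \<in> carrier B) \<and>
    (\<forall>a\<in>carrier F. \<forall>w\<in>carrier F. \<forall>w'\<in>carrier F. I a (w \<otimes>\<^bsub>F\<^esub> w') = I a w \<otimes>\<^bsub>B\<^esub> I (a \<otimes>\<^bsub>F\<^esub> w) w') \<and>
    (\<forall>a\<in>carrier F. \<forall>x\<in>X. I a x = \<omega> a x)"
proof -
  interpret F: group F by fact
  interpret B: group B by fact
  let ?W = "wreath B F"
  interpret W: group ?W by (rule group_wreath[OF B F])
  have XF: "X \<subseteq> carrier F" and gen: "generate F X = carrier F" using X by (auto simp: free_basis_def)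
  have "(\<lambda>x. (\<lambda>a\<in>carrier F. \<omega> a x, x)) \<in> X \<rightarrow> carrier ?W"
    using \<omega> XF by (auto simp: wreath_def)
  from free_basis_universal[OF F X W.group_axioms this]
  obtain h where h: "h \<in> hom F ?W" "\<forall>x\<in>X. h x = (\<lambda>a\<in>carrier F. \<omega> a x, x)" by blast
  have snd_hom: "(\<lambda>w. snd (h w)) \<in> hom F F"
    using h(1) by (auto simp: hom_def wreath_def Pi_def)
  interpret s: group_hom F F "\<lambda>w. snd (h w)"
    by (intro group_hom.intro group_hom_axioms.intro F snd_hom)
  have snd_h: "snd (h w) = w" if "w \<in> carrier F" for w
    using that unfolding gen[symmetric]
  proof induction
    case (inv x)
    then show ?case using s.hom_inv[of x] h(2) XF by auto
  next
    case (eng x y)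
    then show ?case using s.hom_mult[of x y] gen by simp
  qed (use h(2) s.hom_one in auto)
  define I where "I a w = fst (h w) a" for a w
  have "I a (w \<otimes>\<^bsub>F\<^esub> w') = I a w \<otimes>\<^bsub>B\<^esub> I (a \<otimes>\<^bsub>F\<^esub> w) w'"
    if "a \<in> carrier F" "w \<in> carrier F" "w' \<in> carrier F" for a w w'
  proof -
    have "h (w \<otimes>\<^bsub>F\<^esub> w') = h w \<otimes>\<^bsub>?W\<^esub> h w'" using h(1) that by (simp add: hom_def)
    then show ?thesis using that snd_h[of w] by (simp add: I_def wreath_def)
  qed
  moreover have "I a w \<in> carrier B" if "a \<in> carrier F" "w \<in> carrier F" for a w
  proof -
    have "h w \<in> carrier ?W" using h(1) that by (auto simp: hom_def)
    then show ?thesis using that by (auto simp: I_def wreath_def)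
  qed
  moreover have "I a x = \<omega> a x" if "a \<in> carrier F" "x \<in> X" for a x
    using h(2) that by (simp add: I_def)
  ultimately show ?thesis by (intro exI[of _ I]) simp
qed

lemma lower_central_hom_subset:
  assumes f: "group_hom G K f" and H: "subgroup H G" and R: "subgroup R K" and sub: "f ` H \<subseteq> R"
  shows "f ` lower_central G H n \<subseteq> lower_central K R n"
proof -
  interpret group_hom G K f by fact
  show ?thesis
  proof (induction n)
    case 0
    then show ?case using sub by simp
  next
    case (Suc n)
    let ?S = "{commutator G x y | x y. x \<in> lower_central G H n \<and> y \<in> H}"
    let ?S' = "{commutator K x y | x y. x \<in> lower_central K R n \<and> y \<in> R}"
    have HG: "x \<in> carrier G" if "x \<in> H" for x using subgroup.mem_carrier[OF H that] .
    have lH: "x \<in> H" if "x \<in> lower_central G H n" for x using G.lower_central_le[OF H] that by blast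
    have S: "?S \<subseteq> carrier G" using HG lH by (auto simp: commutator_def)
    have "f s \<in> ?S'" if s: "s \<in> ?S" for s
    proof -
      obtain x y where s: "s = commutator G x y" and x: "x \<in> lower_central G H n" and y: "y \<in> H" using s by blast
      have "f s = commutator K (f x) (f y)" using HG[OF lH[OF x]] HG[OF y] by (simp add: s commutator_def)
      moreover have "f x \<in> lower_central K R n" "f y \<in> R" using Suc x y sub by auto
      ultimately show ?thesis by blast
    qed
    then have "generate K (f ` ?S) \<subseteq> generate K ?S'" by (intro H.mono_generate) blast
    then show ?case unfolding lower_central.simps(2) generate_img[OF S] .
  qed
qed

lemma (in group) generate_finite:
  "g \<in> generate G S \<Longrightarrow> \<exists>S0. finite S0 \<and> S0 \<subseteq> S \<and> g \<in> generate G S0"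
proof (induction rule: generate.induct)
  case one
  then show ?case by (intro exI[of _ "{}"]) (auto intro: generate.one)
next
  case (incl s)
  then show ?case by (intro exI[of _ "{s}"]) (auto intro: generate.incl)
next
  case (inv s)
  then show ?case by (intro exI[of _ "{s}"]) (auto intro: generate.inv)
next
  case (eng x y)
  then obtain S1 S2 where "finite S1" "S1 \<subseteq> S" "x \<in> generate G S1" "finite S2" "S2 \<subseteq> S" "y \<in> generate G S2" by blast
  then show ?case
    using mono_generate[of S1 "S1 \<union> S2"] mono_generate[of S2 "S1 \<union> S2"]
    by (intro exI[of _ "S1 \<union> S2"]) (auto intro: generate.eng)
qed

text \<open>
  The substitution that replaces the variable \<open>x\<close> by the formal sum of all \<open>y\<close> with \<open>e y = x\<close>.
\<close>

definition pull_series :: "('y \<Rightarrow> 'x) \<Rightarrow> ('x, 'k::comm_ring_1) nc_series \<Rightarrow> ('y, 'k) nc_series" where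
  "pull_series e x = Series (\<lambda>w. ncoeff x (map e w))"

lemma pull_series_mult: "pull_series e (x * y) = pull_series e x * pull_series e y"
  by (rule nc_series_eqI) (simp add: pull_series_def ncoeff_mult take_map drop_map)

lemma pull_series_one: "pull_series e 1 = 1"
  by (rule nc_series_eqI) (simp add: pull_series_def)


section \<open>Polynomial separation modulo a normal subgroup\<close>

definition invariant_pol :: "('f, 'm) monoid_scheme \<Rightarrow> 'f set \<Rightarrow> ('f \<Rightarrow> 'k::comm_ring_1) set" where
  "invariant_pol F R = {f. (\<exists>n. f \<in> pol_fun F n) \<and> (\<forall>x\<in>carrier F. \<forall>r\<in>R. f (x \<otimes>\<^bsub>F\<^esub> r) = f x)}"

definition pol_separated_mod :: "'k::comm_ring_1 itself \<Rightarrow> ('f, 'm) monoid_scheme \<Rightarrow> 'f set \<Rightarrow> bool" where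
  "pol_separated_mod _ F R \<longleftrightarrow>
     (\<forall>g\<in>carrier F. g \<notin> R \<longrightarrow> (\<exists>f\<in>invariant_pol F R. f g \<noteq> (f \<one>\<^bsub>F\<^esub> :: 'k)))"

text \<open>
  \<open>I a w\<close> is the product along the path that starts at \<open>a\<close> and spells \<open>w\<close>. There is one
  variable for every pair of a polynomial function \<open>p\<close> that is constant on the cosets of \<open>R\<close>
  and a generator \<open>x\<close>; in the weight of the edge from \<open>a\<close> to \<open>a x\<close> it has the coefficient
  \<open>p a\<close>.
\<close>

locale path_series = group F for F :: "('f, 'm) monoid_scheme" (structure) +
  fixes X :: "'f set" and R :: "'f set"
    and I :: "'f \<Rightarrow> 'f \<Rightarrow> (('f \<Rightarrow> 'k::field_char_0) \<times> 'f, 'k) nc_series"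
  assumes X_carrier: "X \<subseteq> carrier F" and X_gen: "generate F X = carrier F"
    and R_sub: "subgroup R F" and R_conj: "a \<in> carrier F \<Longrightarrow> r \<in> R \<Longrightarrow> a \<otimes> r \<otimes> inv a \<in> R"
    and I_mult: "\<lbrakk>a \<in> carrier F; w \<in> carrier F; w' \<in> carrier F\<rbrakk> \<Longrightarrow> I a (w \<otimes> w') = I a w * I (a \<otimes> w) w'"
    and I_one: "a \<in> carrier F \<Longrightarrow> I a \<one> = 1"
    and I_gen: "\<lbrakk>a \<in> carrier F; x \<in> X\<rbrakk> \<Longrightarrow>
      I a x = 1 + linear_series (\<lambda>l. if fst l \<in> invariant_pol F R \<and> snd l = x then fst l a else 0)"
begin

abbreviation "Q \<equiv> (invariant_pol F R :: ('f \<Rightarrow> 'k) set)"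

lemma R_carrier: "r \<in> R \<Longrightarrow> r \<in> carrier F"
  using subgroup.mem_carrier[OF R_sub] .

lemma R_conj': "a \<in> carrier F \<Longrightarrow> r \<in> R \<Longrightarrow> inv a \<otimes> r \<otimes> a \<in> R"
  using R_conj[of "inv a" r] by simp

lemma I_inv:
  assumes "a \<in> carrier F" "w \<in> carrier F"
  shows "I a (inv w) * I (a \<otimes> inv w) w = 1" "I (a \<otimes> inv w) w * I a (inv w) = 1"
  using I_mult[of a "inv w" w] I_mult[of "a \<otimes> inv w" w "inv w"] assms by (simp_all add: I_one m_assoc)

text \<open>
  The weights only depend on the coset of the starting point, and since \<open>R\<close> is normal, paths
  that start in the same coset stay in the same cosets.
\<close>

lemma I_invariant:
  assumes w: "w \<in> carrier F"
  shows "a \<in> carrier F \<Longrightarrow> r \<in> R \<Longrightarrow> I (a \<otimes> r) w = I a w"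
  using w unfolding X_gen[symmetric]
proof (induction arbitrary: a r)
  case one
  then show ?case using R_carrier X_gen by (simp add: I_one)
next
  case (incl x)
  then have "(\<lambda>l. if fst l \<in> Q \<and> snd l = x then fst l (a \<otimes> r) else 0) =
      (\<lambda>l. if fst l \<in> Q \<and> snd l = x then fst l a else 0)"
    by (auto simp: fun_eq_iff invariant_pol_def X_gen)
  then show ?case using incl R_carrier X_gen by (simp add: I_gen)
next
  case (inv x)
  have x: "x \<in> carrier F" and a: "a \<in> carrier F" and r: "r \<in> R" using inv X_carrier X_gen by auto
  define b where "b = a \<otimes> inv x"
  define s where "s = x \<otimes> r \<otimes> inv x"
  have b: "b \<in> carrier F" and s: "s \<in> R" using x a R_conj[OF x r] by (simp_all add: b_def s_def)
  have bs: "a \<otimes> r \<otimes> inv x = b \<otimes> s"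
    using x a R_carrier[OF r] by (simp add: b_def s_def m_assoc mult_inv_cancel)
  have "(\<lambda>l. if fst l \<in> Q \<and> snd l = x then fst l (b \<otimes> s) else 0) =
      (\<lambda>l. if fst l \<in> Q \<and> snd l = x then fst l b else 0)"
    using b s by (auto simp: fun_eq_iff invariant_pol_def)
  then have eq: "I (b \<otimes> s) x = I b x" using inv(1) b s R_carrier by (simp add: I_gen)
  have "I (a \<otimes> r) (inv x) = I (a \<otimes> r) (inv x) * (I b x * I a (inv x))"
    using I_inv(2)[OF a x] by (simp add: b_def)
  also have "\<dots> = (I (a \<otimes> r) (inv x) * I (b \<otimes> s) x) * I a (inv x)"
    by (simp add: eq mult.assoc)
  also have "\<dots> = I a (inv x)"
    using I_inv(1)[of "a \<otimes> r" x] a x R_carrier[OF r] by (simp add: bs)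
  finally show ?case .
next
  case (eng u v)
  have uv: "u \<in> carrier F" "v \<in> carrier F" and a: "a \<in> carrier F" and r: "r \<in> R"
    using eng X_gen by auto
  have s: "inv u \<otimes> r \<otimes> u \<in> R" by (rule R_conj'[OF uv(1) r])
  have "a \<otimes> r \<otimes> u = a \<otimes> u \<otimes> (inv u \<otimes> r \<otimes> u)"
    using a uv R_carrier[OF r] by (simp add: m_assoc mult_inv_cancel)
  then show ?case
    using eng.IH(1)[of a r] eng.IH(2)[of "a \<otimes> u" "inv u \<otimes> r \<otimes> u"] s a uv r R_carrier X_gen
    by (simp add: I_mult)
qed

lemma I_Nil:
  assumes w: "w \<in> carrier F"
  shows "a \<in> carrier F \<Longrightarrow> ncoeff (I a w) [] = 1"
  using w unfolding X_gen[symmetric]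
proof (induction arbitrary: a)
  case (inv x)
  then have "ncoeff (I (a \<otimes> inv x) x) [] = 1" "a \<in> carrier F" "x \<in> carrier F"
    using X_carrier X_gen by (auto simp: I_gen ncoeff_linear_series)
  then show ?case using arg_cong[OF I_inv(1)[of a x], of "\<lambda>u. ncoeff u []"] by (simp add: ncoeff_mult_Nil)
qed (use X_gen in \<open>auto simp: I_one I_gen I_mult ncoeff_mult_Nil ncoeff_linear_series\<close>)

definition pol_degree :: "('f \<Rightarrow> 'k) \<Rightarrow> nat" where
  "pol_degree p = (LEAST d. p \<in> pol_fun F (Suc d))"

text \<open>
  Each variable contributes the degree of its polynomial function, which bounds the degree of
  the coefficients as functions of the starting point.
\<close>

definition weight :: "(('f \<Rightarrow> 'k) \<times> 'f) list \<Rightarrow> nat" where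
  "weight bs = sum_list (map (\<lambda>l. pol_degree (fst l)) bs)"

lemma pol_degree: "p \<in> Q \<Longrightarrow> p \<in> pol_fun F (Suc (pol_degree p))"
proof -
  assume "p \<in> Q"
  then obtain n where "p \<in> pol_fun F n" by (auto simp: invariant_pol_def)
  from LeastI[of "\<lambda>d. p \<in> pol_fun F (Suc d)", OF pol_fun_Suc[OF this]]
  show ?thesis by (simp add: pol_degree_def)
qed

lemma weight_append: "weight (as @ bs) = weight as + weight bs"
  by (simp add: weight_def)

lemma weight_take_drop: "weight (take k bs) + weight (drop k bs) = weight bs"
  using weight_append[of "take k bs" "drop k bs"] by simp

lemma pol_fun_mult_split:
  assumes "f \<in> pol_fun F (Suc (weight (take k bs)))" "g \<in> pol_fun F (Suc (weight (drop k bs)))"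
  shows "(\<lambda>a. f a * g a :: 'k) \<in> pol_fun F (Suc (weight bs))"
  using pol_fun_mult_Suc[OF assms] by (simp only: weight_take_drop)

lemma pol_fun_start_gen:
  assumes x: "x \<in> X" and "fst ` set bs \<subseteq> Q"
  shows "(\<lambda>a. ncoeff (I a x) bs) \<in> pol_fun F (Suc (weight bs))"
proof -
  consider "bs = []" | p y where "bs = [(p, y)]" | l l' bs' where "bs = l # l' # bs'"
    by (metis neq_Nil_conv surj_pair)
  then show ?thesis
  proof cases
    case 1
    show ?thesis
      by (rule pol_fun_cong[OF pol_fun_const[of 1]]) (use 1 x assms(2) in \<open>simp add: I_gen ncoeff_linear_series\<close>)
  next
    case 2
    then have p: "p \<in> Q" using assms(2) by simp
    have "(\<lambda>a. (if y = x then 1 else 0) * p a) \<in> pol_fun F (Suc (weight bs))"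
      using pol_fun_scale[OF pol_degree[OF p], of "if y = x then 1 else 0"] by (simp only: weight_def 2 list.map sum_list_simps fst_conv add_0_right)
    then show ?thesis
      by (rule pol_fun_cong) (use 2 p x in \<open>simp add: I_gen ncoeff_linear_series\<close>)
  next
    case 3
    show ?thesis
      by (rule pol_fun_cong[OF pol_fun_zero]) (use 3 x assms(2) in \<open>simp add: I_gen ncoeff_linear_series\<close>)
  qed
qed

text \<open>
  Along a product the coefficient at \<open>bs\<close> is a sum of products of coefficients at the two
  parts of \<open>bs\<close>, and weights add up. For the inverse of a generator the same formula is solved
  for the coefficient at \<open>bs\<close>.
\<close>

lemma pol_fun_start:
  assumes "w \<in> carrier F"
  shows "fst ` set bs \<subseteq> Q \<Longrightarrow> (\<lambda>a. ncoeff (I a w) bs) \<in> pol_fun F (Suc (weight bs))"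
  using assms unfolding X_gen[symmetric]
proof (induction arbitrary: bs)
  case one
  show ?case
    by (rule pol_fun_cong[OF pol_fun_const[of "if bs = [] then 1 else 0"]]) (simp add: I_one)
next
  case (incl x)
  show ?case by (rule pol_fun_start_gen[OF incl])
next
  case (inv x)
  have x: "x \<in> carrier F" using inv X_carrier by blast
  have px: "(\<lambda>a. ncoeff (I a x) bs) \<in> pol_fun F (Suc (weight bs))" if "fst ` set bs \<subseteq> Q" for bs
    by (rule pol_fun_start_gen[OF inv(1) that])
  show ?case using inv.prems
  proof (induction "length bs" arbitrary: bs rule: less_induct)
    case less
    show ?case
    proof (cases "bs = []")
      case True
      show ?thesis
        by (rule pol_fun_cong[OF pol_fun_const[of 1]]) (use True x in \<open>simp add: I_Nil\<close>)
    next
      case False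
      let ?g = "\<lambda>k a. ncoeff (I a (inv x)) (take k bs) * ncoeff (I (a \<otimes> inv x) x) (drop k bs)"
      have "(\<lambda>a. - (\<Sum>k<length bs. ?g k a)) \<in> pol_fun F (Suc (weight bs))"
      proof (intro pol_fun_uminus pol_fun_sum)
        fix k assume k: "k \<in> {..<length bs}"
        have "(\<lambda>a. ncoeff (I a (inv x)) (take k bs)) \<in> pol_fun F (Suc (weight (take k bs)))"
          using less.prems k by (intro less.hyps) (auto dest: in_set_takeD)
        moreover have "(\<lambda>a. ncoeff (I (a \<otimes> inv x) x) (drop k bs)) \<in> pol_fun F (Suc (weight (drop k bs)))"
          using less.prems x by (intro pol_fun_right_translate px) (auto dest: in_set_dropD)
        ultimately show "?g k \<in> pol_fun F (Suc (weight bs))"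
          by (rule pol_fun_mult_split)
      qed
      then show ?thesis
      proof (rule pol_fun_cong)
        fix a assume a: "a \<in> carrier F"
        have "0 = ncoeff (I a (inv x) * I (a \<otimes> inv x) x) bs" using I_inv(1)[OF a x] False by simp
        also have "\<dots> = (\<Sum>k<length bs. ?g k a) + ncoeff (I a (inv x)) bs"
          using I_Nil[OF x, of "a \<otimes> inv x"] a x by (simp add: ncoeff_mult lessThan_Suc_atMost[symmetric])
        finally show "- (\<Sum>k<length bs. ?g k a) = ncoeff (I a (inv x)) bs" by (simp add: eq_neg_iff_add_eq_0 neg_eq_iff_add_eq_0)
      qed
    qed
  qed
next
  case (eng u v)
  have uv: "u \<in> carrier F" "v \<in> carrier F" using eng X_gen by auto
  have "(\<lambda>a. \<Sum>k\<le>length bs. ncoeff (I a u) (take k bs) * ncoeff (I (a \<otimes> u) v) (drop k bs)) \<in> pol_fun F (Suc (weight bs))"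
  proof (rule pol_fun_sum)
    fix k
    have "(\<lambda>a. ncoeff (I a u) (take k bs)) \<in> pol_fun F (Suc (weight (take k bs)))"
      using eng.prems by (intro eng.IH) (auto dest: in_set_takeD)
    moreover have "(\<lambda>a. ncoeff (I (a \<otimes> u) v) (drop k bs)) \<in> pol_fun F (Suc (weight (drop k bs)))"
      using eng.prems uv by (intro pol_fun_right_translate[where f = "\<lambda>a. ncoeff (I a v) (drop k bs)"] eng.IH) (auto dest: in_set_dropD)
    ultimately show "(\<lambda>a. ncoeff (I a u) (take k bs) * ncoeff (I (a \<otimes> u) v) (drop k bs)) \<in> pol_fun F (Suc (weight bs))"
      by (rule pol_fun_mult_split)
  qed
  then show ?case by (rule pol_fun_cong) (use uv in \<open>simp add: I_mult ncoeff_mult\<close>)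
qed

text \<open>
  Appending \<open>h\<close> to \<open>w\<close> changes the coefficient at \<open>bs\<close> by coefficients at shorter words, times
  coefficients of \<open>h\<close> with the starting point \<open>w\<close>, which are polynomial in \<open>w\<close> by
  \<open>pol_fun_start\<close>. So every variable raises the degree by one in addition to its weight.
\<close>

lemma pol_fun_word:
  "fst ` set bs \<subseteq> Q \<Longrightarrow> (\<lambda>w. ncoeff (I \<one> w) bs) \<in> pol_fun F (Suc (weight bs + length bs))"
proof (induction "length bs" arbitrary: bs rule: less_induct)
  case less
  have "(\<lambda>w. ncoeff (I \<one> (w \<otimes> h)) bs - ncoeff (I \<one> w) bs) \<in> pol_fun F (weight bs + length bs)"
    if h: "h \<in> carrier F" for h
  proof -
    let ?g = "\<lambda>k w. ncoeff (I \<one> w) (take k bs) * ncoeff (I w h) (drop k bs)"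
    have "(\<lambda>w. \<Sum>k<length bs. ?g k w) \<in> pol_fun F (weight bs + length bs)"
    proof (rule pol_fun_sum)
      fix k assume k: "k \<in> {..<length bs}"
      have "(\<lambda>w. ncoeff (I \<one> w) (take k bs)) \<in> pol_fun F (Suc (weight (take k bs) + length (take k bs)))"
        using less.prems k by (intro less.hyps) (auto dest: in_set_takeD)
      moreover have "(\<lambda>w. ncoeff (I w h) (drop k bs)) \<in> pol_fun F (Suc (weight (drop k bs)))"
        using less.prems by (intro pol_fun_start[OF h]) (auto dest: in_set_dropD)
      ultimately have "?g k \<in> pol_fun F (Suc (weight (take k bs) + length (take k bs) + weight (drop k bs)))"
        by (rule pol_fun_mult_Suc)
      moreover have "Suc (weight (take k bs) + length (take k bs) + weight (drop k bs)) \<le> weight bs + length bs"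
        using weight_take_drop[of k bs] k by simp
      ultimately show "?g k \<in> pol_fun F (weight bs + length bs)" using pol_fun_mono by blast
    qed
    then show ?thesis
    proof (rule pol_fun_cong)
      fix w assume w: "w \<in> carrier F"
      have "ncoeff (I \<one> (w \<otimes> h)) bs = (\<Sum>k\<le>length bs. ?g k w)" using w h by (simp add: I_mult ncoeff_mult)
      also have "\<dots> = (\<Sum>k<length bs. ?g k w) + ncoeff (I \<one> w) bs"
        using I_Nil[OF h w] by (simp add: lessThan_Suc_atMost[symmetric])
      finally show "(\<Sum>k<length bs. ?g k w) = ncoeff (I \<one> (w \<otimes> h)) bs - ncoeff (I \<one> w) bs" by simp
    qed
  qed
  then show ?case by simp
qed

lemma series_hom_R: "a \<in> carrier F \<Longrightarrow> series_hom F R (I a)"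
proof (intro series_hom.intro series_hom_axioms.intro group_axioms R_sub)
  assume a: "a \<in> carrier F"
  fix r s assume rs: "r \<in> R" "s \<in> R"
  show "I a (r \<otimes> s) = I a r * I a s"
    using I_mult[OF a R_carrier[OF rs(1)] R_carrier[OF rs(2)]] I_invariant[OF R_carrier[OF rs(2)] a rs(1)] by simp
  show "ncoeff (I a r) [] = 1" by (rule I_Nil[OF R_carrier[OF rs(1)] a])
qed (simp add: I_one)

text \<open>
  From any starting point, an element of \<open>lower_central F R c\<close> has a path product that differs
  from 1 by terms of degree greater than \<open>c\<close> only (\<open>gamma_order\<close>).
\<close>

lemma invariant_word:
  assumes bs: "fst ` set bs \<subseteq> Q" "length bs \<le> c"
  shows "(\<lambda>w. ncoeff (I \<one> w) bs) \<in> invariant_pol F (lower_central F R c)"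
proof -
  have "ncoeff (I \<one> (x \<otimes> r)) bs = ncoeff (I \<one> x) bs" if x: "x \<in> carrier F" and r: "r \<in> lower_central F R c" for x r
  proof -
    have rF: "r \<in> carrier F" using lower_central_le[OF R_sub] r R_carrier by blast
    have o: "order_ge (Suc c) (I x r - 1)" by (rule series_hom.gamma_order[OF series_hom_R[OF x] r])
    have "I \<one> (x \<otimes> r) = I \<one> x + I \<one> x * (I x r - 1)"
      using x rF by (simp add: I_mult algebra_simps)
    moreover have "ncoeff (I \<one> x * (I x r - 1)) bs = 0"
      using order_ge_mult[OF order_ge_0 o] bs(2) by (simp add: order_ge_def)
    ultimately show ?thesis by simp
  qed
  then show ?thesis using pol_fun_word[OF bs(1)] unfolding invariant_pol_def by blast
qed

end


section \<open>Separation modulo a term of the lower central series\<close>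

context path_series
begin

definition rep :: "'f \<Rightarrow> 'f" where
  "rep a = (SOME b. b \<in> carrier F \<and> inv a \<otimes> b \<in> R)"

lemma rep: "a \<in> carrier F \<Longrightarrow> rep a \<in> carrier F \<and> inv a \<otimes> rep a \<in> R"
  unfolding rep_def by (rule someI[of _ a]) (simp add: subgroup.one_closed[OF R_sub])

lemma rep_invariant:
  assumes a: "a \<in> carrier F" and r: "r \<in> R"
  shows "rep (a \<otimes> r) = rep a"
proof -
  have "inv (a \<otimes> r) \<otimes> b \<in> R \<longleftrightarrow> inv a \<otimes> b \<in> R" if b: "b \<in> carrier F" for b
  proof -
    have "inv (a \<otimes> r) \<otimes> b = inv r \<otimes> (inv a \<otimes> b)" "inv a \<otimes> b = r \<otimes> (inv (a \<otimes> r) \<otimes> b)"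
      using a r b R_carrier by (simp_all add: inv_mult_group m_assoc mult_inv_cancel)
    then show ?thesis
      using subgroup.m_closed[OF R_sub] subgroup.m_inv_closed[OF R_sub r] r by metis
  qed
  then show ?thesis unfolding rep_def by (intro arg_cong[where f = Eps]) auto
qed

lemma rep_eqI:
  assumes "a \<in> carrier F" "b \<in> carrier F" "inv a \<otimes> b \<in> R"
  shows "rep b = rep a"
  using rep_invariant[OF assms(1,3)] assms by (simp add: mult_inv_cancel)

lemma rep_rep: "a \<in> carrier F \<Longrightarrow> rep (rep a) = rep a"
  using rep[of a] by (intro rep_eqI) auto

text \<open>
  Translate a function that separates \<open>b^-1 a\<close> from 1.
\<close>

lemma separate_cosets:
  assumes sep: "pol_separated_mod TYPE('k) F R" and ab: "a \<in> carrier F" "b \<in> carrier F" "rep a \<noteq> rep b"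
  shows "\<exists>q\<in>Q. q a \<noteq> q b"
proof -
  have "inv b \<otimes> a \<notin> R" using rep_eqI[of b a] ab by auto
  then obtain f where f: "f \<in> Q" "f (inv b \<otimes> a) \<noteq> f \<one>"
    using sep ab unfolding pol_separated_mod_def by (metis inv_closed m_closed)
  then obtain n where n: "f \<in> pol_fun F n" by (auto simp: invariant_pol_def)
  have "(\<lambda>x. f (inv b \<otimes> x)) \<in> Q"
    unfolding invariant_pol_def
  proof (intro CollectI conjI ballI)
    show "\<exists>n. (\<lambda>x. f (inv b \<otimes> x)) \<in> pol_fun F n" using pol_fun_left_translate[OF n] ab by blast
    fix x r assume "x \<in> carrier F" "r \<in> R"
    then show "f (inv b \<otimes> (x \<otimes> r)) = f (inv b \<otimes> x)"
      using f(1) ab R_carrier by (simp add: invariant_pol_def m_assoc[symmetric])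
  qed
  then show ?thesis using f(2) ab by (intro bexI) auto
qed

text \<open>
  Lagrange interpolation.
\<close>

lemma interpolate_cosets:
  assumes sep: "pol_separated_mod TYPE('k) F R" and A: "finite A" "A \<subseteq> rep ` carrier F" and a: "a \<in> A"
  shows "\<exists>p\<in>Q. p a = 1 \<and> (\<forall>b\<in>A - {a}. p b = 0)"
proof -
  have repA: "b \<in> carrier F \<and> rep b = b" if "b \<in> A" for b using A(2) that rep rep_rep by auto
  have "\<forall>b\<in>A - {a}. \<exists>q\<in>Q. q a \<noteq> q b"
    using separate_cosets[OF sep] repA a by (metis Diff_iff insertI1)
  then obtain q where q: "\<forall>b\<in>A - {a}. q b \<in> Q \<and> q b a \<noteq> q b b" by metis
  define p where "p x = (\<Prod>b\<in>A - {a}. (1 / (q b a - q b b)) * (q b x - q b b))" for x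
  have "p \<in> Q"
    unfolding invariant_pol_def
  proof (intro CollectI conjI ballI)
    have "\<exists>n. (\<lambda>x. (1 / (q b a - q b b)) * (q b x - q b b)) \<in> pol_fun F n" if "b \<in> A - {a}" for b
    proof -
      have "q b \<in> Q" using q that by blast
      then obtain n where "q b \<in> pol_fun F n" by (auto simp: invariant_pol_def)
      from pol_fun_scale[OF pol_fun_diff[OF pol_fun_Suc[OF this] pol_fun_const]] show ?thesis by blast
    qed
    then show "\<exists>n. p \<in> pol_fun F n" unfolding p_def[abs_def] by (rule pol_fun_prod)
    fix x r assume "x \<in> carrier F" "r \<in> R"
    then show "p (x \<otimes> r) = p x"
      unfolding p_def using q by (intro prod.cong) (auto simp: invariant_pol_def)
  qed
  moreover have "p a = 1" unfolding p_def using q by (intro prod.neutral) auto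
  moreover have "p b = 0" if "b \<in> A - {a}" for b
    unfolding p_def using that A(1) by (intro prod_zero) auto
  ultimately show ?thesis by blast
qed

text \<open>
  The elements \<open>rep a * x * (rep (a * x))^-1\<close> are Schreier generators of \<open>R\<close>. Each is paired
  with the weight of its edge, and the product of the pairs along the path of \<open>w\<close> is \<open>w\<close>, up
  to conjugation, paired with its path product. Only finitely many edges occur. For each of
  them, choose a polynomial function that is 1 on the coset of its starting point and 0 on
  those of the other starting points; keeping only the corresponding variables sends the
  \<open>i\<close>-th pair to one plus the \<open>i\<close>-th letter. Magnus and Witt's theorem, applied to the group
  generated by the pairs, shows that the pair of \<open>w\<close> lies in the lower central series, and the
  first projection maps it into that of \<open>R\<close>.
\<close>

lemma kernel_lower_central:
  assumes sep: "pol_separated_mod TYPE('k) F R" and w: "w \<in> R"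
    and zero: "\<And>bs. fst ` set bs \<subseteq> Q \<Longrightarrow> bs \<noteq> [] \<Longrightarrow> length bs \<le> c \<Longrightarrow> ncoeff (I \<one> w) bs = 0"
  shows "w \<in> lower_central F R c"
proof -
  let ?S = "series_units :: (('f \<Rightarrow> 'k) \<times> 'f, 'k) nc_series monoid"
  let ?B = "F \<times>\<times> ?S"
  interpret S: group ?S by (rule group_series_units)
  interpret B: group ?B by (rule DirProd_group[OF group_axioms S.group_axioms])
  have fst_hom: "group_hom ?B F fst"
    by (intro group_hom.intro group_hom_axioms.intro B.group_axioms group_axioms) (auto simp: hom_def DirProd_def)
  \<comment> \<open>Both components are products along paths: \<open>\<beta> a (u v) = \<beta> a u * \<beta>
    (a u) v\<close>.\<close>
  define \<beta> where "\<beta> a u = (rep a \<otimes> u \<otimes> inv (rep (a \<otimes> u)), I a u)" for a u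
  have I_unit: "I a u \<in> carrier ?S" if "a \<in> carrier F" "u \<in> carrier F" for a u
    using I_inv[of "a \<otimes> u" u] that by (auto simp: series_units_def m_assoc)
  have \<beta>_closed: "\<beta> a u \<in> carrier ?B" if "a \<in> carrier F" "u \<in> carrier F" for a u
    using that I_unit rep by (simp add: \<beta>_def DirProd_def)
  have \<beta>_mult: "\<beta> a (u \<otimes> v) = \<beta> a u \<otimes>\<^bsub>?B\<^esub> \<beta> (a \<otimes> u) v"
    if "a \<in> carrier F" "u \<in> carrier F" "v \<in> carrier F" for a u v
  proof -
    have "rep a \<in> carrier F" "rep (a \<otimes> u) \<in> carrier F" "rep (a \<otimes> u \<otimes> v) \<in> carrier F" using that rep by auto
    then show ?thesis
      using that I_mult[of a u v] by (simp add: \<beta>_def DirProd_def series_units_def m_assoc mult_inv_cancel)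
  qed
  have \<beta>_one: "\<beta> a \<one> = \<one>\<^bsub>?B\<^esub>" if "a \<in> carrier F" for a
    using that rep I_one by (simp add: \<beta>_def DirProd_def series_units_def)
  have \<beta>_rep: "\<beta> (rep a) u = \<beta> a u" if a: "a \<in> carrier F" and u: "u \<in> carrier F" for a u
  proof -
    have ra: "rep a \<in> carrier F" "inv a \<otimes> rep a \<in> R" using rep a by auto
    have eq: "a \<otimes> (inv a \<otimes> rep a) = rep a" using a ra(1) by (simp add: mult_inv_cancel)
    have "I (rep a) u = I a u" using I_invariant[OF u a ra(2)] eq by simp
    moreover have "rep (rep a \<otimes> u) = rep (a \<otimes> u)"
    proof (rule rep_eqI)
      have "inv (a \<otimes> u) \<otimes> (rep a \<otimes> u) = inv u \<otimes> (inv a \<otimes> rep a) \<otimes> u"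
        using a u ra(1) by (simp add: inv_mult_group m_assoc)
      then show "inv (a \<otimes> u) \<otimes> (rep a \<otimes> u) \<in> R" using R_conj'[OF u ra(2)] by simp
    qed (use a u ra in auto)
    ultimately show ?thesis using rep_rep[OF a] by (simp add: \<beta>_def)
  qed
  let ?E = "rep ` carrier F \<times> X"
  let ?T = "(\<lambda>(a, x). \<beta> a x) ` ?E"
  have gen_step: "\<beta> a x \<in> ?T" if "a \<in> carrier F" "x \<in> X" for a x
  proof (rule image_eqI)
    show "\<beta> a x = (\<lambda>(a, x). \<beta> a x) (rep a, x)" using \<beta>_rep[of a x] that X_carrier by auto
  qed (use that in simp)
  have gen: "a \<in> carrier F \<Longrightarrow> \<beta> a u \<in> generate ?B ?T" if "u \<in> generate F X" for a u
    using that
  proof (induction arbitrary: a)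
    case one
    then show ?case using \<beta>_one[OF one] generate.one[of ?B ?T] by simp
  next
    case (incl x)
    then show ?case by (intro generate.incl gen_step)
  next
    case (inv x)
    have x: "x \<in> carrier F" "a \<in> carrier F" using inv X_carrier by auto
    let ?b = "a \<otimes> inv x"
    have "inv\<^bsub>?B\<^esub> (\<beta> ?b x) \<in> generate ?B ?T" using x inv(1) by (intro generate.inv gen_step) auto
    moreover have "\<beta> a (inv x) \<otimes>\<^bsub>?B\<^esub> \<beta> ?b x = \<one>\<^bsub>?B\<^esub>" using \<beta>_mult[of a "inv x" x] \<beta>_one x by simp
    then have "inv\<^bsub>?B\<^esub> (\<beta> ?b x) = \<beta> a (inv x)" using \<beta>_closed x by (intro B.inv_equality) auto
    ultimately show ?case by simp
  next
    case (eng u v)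
    then have c: "u \<in> carrier F" "v \<in> carrier F" "a \<in> carrier F" using X_gen by auto
    from generate.eng[OF eng.IH(1)[OF c(3)] eng.IH(2)[of "a \<otimes> u"]] show ?case
      using c \<beta>_mult[of a u v] by simp
  qed
  have wF: "w \<in> carrier F" by (rule R_carrier[OF w])
  obtain S0 where S0: "finite S0" "S0 \<subseteq> (\<lambda>(a, x). \<beta> a x) ` ?E" "\<beta> \<one> w \<in> generate ?B S0"
    using B.generate_finite[OF gen[OF wF[folded X_gen] one_closed]] by blast
  obtain E0 where E0: "E0 \<subseteq> ?E" "finite E0" "S0 = (\<lambda>(a, x). \<beta> a x) ` E0"
    using finite_subset_image[OF S0(1,2)] by blast
  obtain e where e: "bij_betw e {..<card E0} E0"
    using ex_bij_betw_nat_finite[OF E0(2)] by (auto simp: atLeast0LessThan)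
  let ?r = "card E0"
  have eE: "fst (e i) \<in> rep ` carrier F" "snd (e i) \<in> X" "e i \<in> E0" if "i < ?r" for i
    using bij_betwE[OF e] E0(1) that by force+
  have eC: "fst (e i) \<in> carrier F \<and> rep (fst (e i)) = fst (e i)" if i: "i < ?r" for i
  proof -
    obtain a where "a \<in> carrier F" "fst (e i) = rep a" using eE(1)[OF i] by blast
    then show ?thesis using rep[of a] rep_rep[of a] by simp
  qed
  have "\<forall>a\<in>fst ` E0. \<exists>p\<in>Q. p a = 1 \<and> (\<forall>b\<in>fst ` E0 - {a}. p b = 0)"
    using E0 by (intro ballI interpolate_cosets[OF sep]) auto
  then obtain p where p: "\<And>a. a \<in> fst ` E0 \<Longrightarrow> p a \<in> Q \<and> p a a = 1 \<and> (\<forall>b\<in>fst ` E0 - {a}. p a b = 0)" by metis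
  define \<phi> where "\<phi> i = \<beta> (fst (e i)) (snd (e i))" for i
  \<comment> \<open>Letters beyond the number of edges have to be absent from all images, so their
    function is 0.\<close>
  define l where "l i = (if i < ?r then p (fst (e i)) else (\<lambda>x. 0), snd (e i))" for i
  have lQ: "fst (l i) \<in> Q" for i
  proof -
    have "(\<lambda>x. 0) \<in> Q" unfolding invariant_pol_def by (auto intro!: exI[of _ 0])
    then show ?thesis using p[of "fst (e i)"] eE(3)[of i] by (auto simp: l_def)
  qed
  define m where "m g = pull_series l (snd g)" for g :: "'f \<times> (('f \<Rightarrow> 'k) \<times> 'f, 'k) nc_series"
  have m_gen: "m (\<phi> i) = 1 + letter i" if i: "i < ?r" for i
  proof (rule nc_series_eqI)
    fix v :: "nat list"
    let ?a = "fst (e i)" and ?x = "snd (e i)"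
    have ax: "?a \<in> carrier F" "?x \<in> X" using eC[OF i] eE(2)[OF i] by auto
    have I: "I ?a ?x = 1 + linear_series (\<lambda>l. if fst l \<in> Q \<and> snd l = ?x then fst l ?a else 0)"
      by (rule I_gen[OF ax])
    consider "v = []" | j where "v = [j]" | j j' v' where "v = j # j' # v'"
      by (cases v; cases "tl v") auto
    then show "ncoeff (m (\<phi> i)) v = ncoeff (1 + letter i) v"
    proof cases
      case 2
      have "(if snd (l j) = ?x then fst (l j) ?a else 0) = (if j = i then 1 else 0)"
      proof (cases "j < ?r")
        case True
        show ?thesis
        proof (cases "j = i")
          case False
          then have "e j \<noteq> e i" using bij_betw_imp_inj_on[OF e] True i by (auto simp: inj_on_def)
          then show ?thesis
            using True False p[of "fst (e j)"] eE(3)[OF True] eE(3)[OF i] by (auto simp: l_def prod_eq_iff)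
        next
          case True
          then show ?thesis using i p[of ?a] eE(3)[OF i] by (simp add: l_def)
        qed
      qed (use i in \<open>auto simp: l_def\<close>)
      then show ?thesis using 2 lQ[of j]
        by (simp add: m_def \<phi>_def \<beta>_def pull_series_def I ncoeff_linear_series letter_def)
    qed (simp_all add: m_def \<phi>_def \<beta>_def pull_series_def I ncoeff_linear_series letter_def)
  qed
  interpret M: magnus_map ?B \<phi> ?r m
  proof (intro magnus_map.intro magnus_map_axioms.intro generated_group.intro generated_group_axioms.intro B.group_axioms)
    show "\<phi> i \<in> carrier ?B" if "i < ?r" for i
      using eC[OF that] eE(2)[OF that] X_carrier unfolding \<phi>_def by (intro \<beta>_closed) auto
    show "m (x \<otimes>\<^bsub>?B\<^esub> y) = m x * m y" for x y
      by (simp add: m_def DirProd_def series_units_def pull_series_mult split: prod.split)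
    show "m \<one>\<^bsub>?B\<^esub> = 1" by (simp add: m_def DirProd_def series_units_def pull_series_one)
  qed (rule m_gen)
  have "e ` {..<?r} = E0" using e by (simp add: bij_betw_def)
  moreover have "\<phi> ` {..<?r} = (\<lambda>(a, x). \<beta> a x) ` e ` {..<?r}"
    unfolding image_image by (intro image_cong) (simp_all add: \<phi>_def split_beta)
  ultimately have \<phi>E: "\<phi> ` {..<?r} = S0" using E0(3) by simp
  have wH: "\<beta> \<one> w \<in> M.H" using S0(3) by (simp add: M.H_def \<phi>E)
  have "order_ge (Suc c) (m (\<beta> \<one> w) - 1)"
    unfolding order_ge_def
  proof (intro allI impI)
    fix v :: "nat list" assume v: "length v < Suc c"
    show "ncoeff (m (\<beta> \<one> w) - 1) v = 0"
    proof (cases "v = []")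
      case True
      then show ?thesis using I_Nil[OF wF, of \<one>] by (simp add: m_def \<beta>_def pull_series_def)
    next
      case False
      then have "ncoeff (I \<one> w) (map l v) = 0" using v lQ by (intro zero) auto
      then show ?thesis using False by (simp add: m_def \<beta>_def pull_series_def)
    qed
  qed
  from M.magnus_witt[OF wH this] have "\<beta> \<one> w \<in> lower_central ?B M.H c" .
  moreover have "fst ` M.H \<subseteq> R"
  proof -
    have "fst (\<phi> i) \<in> R" if i: "i < ?r" for i
    proof -
      let ?a = "fst (e i)" and ?x = "snd (e i)"
      have ax: "?a \<in> carrier F" "?x \<in> carrier F" "rep ?a = ?a" using eC[OF i] eE(2)[OF i] X_carrier by auto
      have r: "inv (?a \<otimes> ?x) \<otimes> rep (?a \<otimes> ?x) \<in> R" "rep (?a \<otimes> ?x) \<in> carrier F" using rep ax by auto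
      have "inv (inv (?a \<otimes> ?x) \<otimes> rep (?a \<otimes> ?x)) \<in> R" by (rule subgroup.m_inv_closed[OF R_sub r(1)])
      moreover have "fst (\<phi> i) = rep (?a \<otimes> ?x) \<otimes> inv (inv (?a \<otimes> ?x) \<otimes> rep (?a \<otimes> ?x)) \<otimes> inv (rep (?a \<otimes> ?x))"
        using ax r(2) by (simp add: \<phi>_def \<beta>_def inv_mult_group m_assoc mult_inv_cancel)
      ultimately show ?thesis using R_conj[OF r(2)] by simp
    qed
    then have "fst ` \<phi> ` {..<?r} \<subseteq> R" by auto
    then have "generate F (fst ` \<phi> ` {..<?r}) \<subseteq> R" by (rule generate_subgroup_incl[OF _ R_sub])
    then show ?thesis
      using group_hom.generate_img[OF fst_hom M.gens_carrier] by (simp add: M.H_def)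
  qed
  ultimately have "fst (\<beta> \<one> w) \<in> lower_central F R c"
    using lower_central_hom_subset[OF fst_hom M.H_subgroup R_sub] by blast
  moreover have rep1: "rep w = rep \<one>" using w wF by (intro rep_eqI) auto
  moreover have r1: "rep \<one> \<in> R" "rep \<one> \<in> carrier F" using rep[of \<one>] by auto
  ultimately have "rep \<one> \<otimes> w \<otimes> inv (rep \<one>) \<in> lower_central F R c" using wF by (simp add: \<beta>_def)
  from lower_central_conj[OF R_sub subgroup.m_inv_closed[OF R_sub r1(1)] this]
  show ?thesis using wF r1(2) by (simp add: m_assoc mult_inv_cancel)
qed

theorem pol_separated_mod_step:
  assumes sep: "pol_separated_mod TYPE('k) F R"
  shows "pol_separated_mod TYPE('k) F (lower_central F R c)"
  unfolding pol_separated_mod_def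
proof (intro ballI impI)
  fix g assume g: "g \<in> carrier F" "g \<notin> lower_central F R c"
  show "\<exists>f\<in>invariant_pol F (lower_central F R c). f g \<noteq> (f \<one> :: 'k)"
  proof (cases "g \<in> R")
    case True
    obtain bs where bs: "fst ` set bs \<subseteq> Q" "bs \<noteq> []" "length bs \<le> c" "ncoeff (I \<one> g) bs \<noteq> 0"
      using kernel_lower_central[OF sep True, of c] g(2) by blast
    then show ?thesis using invariant_word[OF bs(1,3)] by (intro bexI) (auto simp: I_one)
  next
    case False
    then obtain f where f: "f \<in> Q" "f g \<noteq> f \<one>" using sep g(1) unfolding pol_separated_mod_def by blast
    then have "f \<in> invariant_pol F (lower_central F R c)"
      using lower_central_le[OF R_sub, of c] unfolding invariant_pol_def by blast
    then show ?thesis using f(2) by blast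
  qed
qed

end


section \<open>Free polynilpotent groups\<close>

lemma path_series_exists:
  fixes F :: "('f, 'm) monoid_scheme"
  assumes F: "group F" and X: "free_basis F X" and R: "subgroup R F"
    and conj: "\<And>a r. a \<in> carrier F \<Longrightarrow> r \<in> R \<Longrightarrow> a \<otimes>\<^bsub>F\<^esub> r \<otimes>\<^bsub>F\<^esub> inv\<^bsub>F\<^esub> a \<in> R"
  shows "\<exists>I :: 'f \<Rightarrow> 'f \<Rightarrow> (('f \<Rightarrow> 'k::field_char_0) \<times> 'f, 'k) nc_series. path_series F X R I"
proof -
  interpret F: group F by fact
  let ?S = "series_units :: (('f \<Rightarrow> 'k) \<times> 'f, 'k) nc_series monoid"
  let ?\<omega> = "\<lambda>a x. 1 + linear_series (\<lambda>l :: ('f \<Rightarrow> 'k) \<times> 'f. if fst l \<in> invariant_pol F R \<and> snd l = x then fst l a else 0)"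
  have "?\<omega> a x \<in> carrier ?S" for a x by (rule one_plus_linear_unit)
  from path_products_exist[OF F X group_series_units, where \<omega> = ?\<omega>, OF this]
  obtain I where I: "\<forall>a\<in>carrier F. \<forall>w\<in>carrier F. I a w \<in> carrier ?S"
    "\<forall>a\<in>carrier F. \<forall>w\<in>carrier F. \<forall>w'\<in>carrier F. I a (w \<otimes>\<^bsub>F\<^esub> w') = I a w \<otimes>\<^bsub>?S\<^esub> I (a \<otimes>\<^bsub>F\<^esub> w) w'"
    "\<forall>a\<in>carrier F. \<forall>x\<in>X. I a x = ?\<omega> a x" by auto
  have "path_series F X R I"
  proof (intro path_series.intro path_series_axioms.intro F R conj)
    show "X \<subseteq> carrier F" "generate F X = carrier F" using X by (auto simp: free_basis_def)
    show "I a (w \<otimes>\<^bsub>F\<^esub> w') = I a w * I (a \<otimes>\<^bsub>F\<^esub> w) w'"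
      if "a \<in> carrier F" "w \<in> carrier F" "w' \<in> carrier F" for a w w'
      using I(2) that by (simp add: series_units_def)
    show "I a \<one>\<^bsub>F\<^esub> = 1" if a: "a \<in> carrier F" for a
    proof -
      obtain v where v: "I a \<one>\<^bsub>F\<^esub> * v = 1" using I(1) a by (auto simp: series_units_def)
      have "I a \<one>\<^bsub>F\<^esub> = I a \<one>\<^bsub>F\<^esub> * I a \<one>\<^bsub>F\<^esub>"
        using I(2)[rule_format, OF a F.one_closed F.one_closed] a by (simp add: series_units_def)
      then have "I a \<one>\<^bsub>F\<^esub> * v = I a \<one>\<^bsub>F\<^esub> * (I a \<one>\<^bsub>F\<^esub> * v)" by (metis mult.assoc)
      then show ?thesis using v by simp
    qed
    show "I a x = ?\<omega> a x" if "a \<in> carrier F" "x \<in> X" for a x using I(3) that by blast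
  qed
  then show ?thesis by blast
qed

lemma lower_central_normal:
  assumes F: "group F" and R: "subgroup R F"
    and conj: "\<And>a r. a \<in> carrier F \<Longrightarrow> r \<in> R \<Longrightarrow> a \<otimes>\<^bsub>F\<^esub> r \<otimes>\<^bsub>F\<^esub> inv\<^bsub>F\<^esub> a \<in> R"
    and a: "a \<in> carrier F" and r: "r \<in> lower_central F R c"
  shows "a \<otimes>\<^bsub>F\<^esub> r \<otimes>\<^bsub>F\<^esub> inv\<^bsub>F\<^esub> a \<in> lower_central F R c"
proof -
  interpret F: group F by fact
  have "group_hom F F (\<lambda>x. a \<otimes>\<^bsub>F\<^esub> x \<otimes>\<^bsub>F\<^esub> inv\<^bsub>F\<^esub> a)"
    using a by (intro group_hom.intro group_hom_axioms.intro F homI) (simp_all add: F.m_assoc F.mult_inv_cancel)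
  from lower_central_hom_subset[OF this R R, of c] show ?thesis using conj a r by blast
qed

text \<open>
  The induction along the list of classes starts at an arbitrary normal subgroup; terms of its
  lower central series are normal again.
\<close>

lemma pol_separated_mod_polynilpotent:
  assumes F: "group F" and X: "free_basis F X"
  shows "\<lbrakk>subgroup R F; \<And>a r. a \<in> carrier F \<Longrightarrow> r \<in> R \<Longrightarrow> a \<otimes>\<^bsub>F\<^esub> r \<otimes>\<^bsub>F\<^esub> inv\<^bsub>F\<^esub> a \<in> R;
      pol_separated_mod TYPE('k::field_char_0) F R; N = fold (\<lambda>c H. lower_central F H c) cs R\<rbrakk>
    \<Longrightarrow> N \<lhd> F \<and> pol_separated_mod TYPE('k) F N"
proof (induction cs arbitrary: R)
  case Nil
  then show ?case using group.normal_inv_iff[OF F] by simp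
next
  case (Cons c cs)
  obtain I :: "'a \<Rightarrow> 'a \<Rightarrow> (('a \<Rightarrow> 'k) \<times> 'a, 'k) nc_series" where "path_series F X R I"
    using path_series_exists[OF F X Cons.prems(1,2)] by blast
  then have "pol_separated_mod TYPE('k) F (lower_central F R c)"
    by (rule path_series.pol_separated_mod_step[OF _ Cons.prems(3)])
  moreover have "subgroup (lower_central F R c) F"
    by (rule group.lower_central_subgroup[OF F Cons.prems(1)])
  ultimately show ?case
    using Cons.IH[of "lower_central F R c"] lower_central_normal[OF F Cons.prems(1,2)] Cons.prems(4) by simp
qed

text \<open>
  A function that is constant on the cosets of \<open>N\<close> may be evaluated at representatives, and
  its differences are constant on the cosets again because \<open>N\<close> is normal.
\<close>

lemma pol_separated_quotient:
  fixes F :: "('f, 'm) monoid_scheme" and G :: "('g, 'n) monoid_scheme"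
  assumes F: "group F" and G: "group G" and N: "N \<lhd> F" and iso: "G \<cong> F Mod N"
    and sep: "pol_separated_mod TYPE('k::comm_ring_1) F N"
  shows "pol_separated TYPE('k) G"
proof -
  interpret F: group F by fact
  interpret G: group G by fact
  interpret N: normal N F by fact
  interpret Q: group "F Mod N" by (rule N.factorgroup_is_group)
  obtain h where h: "h \<in> Group.iso G (F Mod N)" using iso by (auto simp: is_iso_def)
  then have hom: "h \<in> hom G (F Mod N)" and inj: "inj_on h (carrier G)" by (auto simp: Group.iso_def bij_betw_def)
  interpret h: group_hom G "F Mod N" h by (intro group_hom.intro group_hom_axioms.intro G Q.group_axioms hom)
  have "\<exists>x\<in>carrier F. h g = N #>\<^bsub>F\<^esub> x" if "g \<in> carrier G" for g
    using h.hom_closed[OF that] by (auto simp: FactGroup_def RCOSETS_def)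
  then obtain rep where rep: "\<And>g. g \<in> carrier G \<Longrightarrow> rep g \<in> carrier F \<and> h g = N #>\<^bsub>F\<^esub> rep g" by metis
  have same: "f y = f x" if f: "f \<in> invariant_pol F N" and xy: "x \<in> carrier F" "y \<in> carrier F" "N #>\<^bsub>F\<^esub> x = N #>\<^bsub>F\<^esub> y"
    for f :: "'f \<Rightarrow> 'k" and x y
  proof -
    have "y \<in> N #>\<^bsub>F\<^esub> x" using xy(3) F.rcos_self[OF xy(2) N.subgroup_axioms] by simp
    then obtain n where n: "n \<in> N" "y = n \<otimes>\<^bsub>F\<^esub> x" by (auto simp: r_coset_def)
    have nF: "n \<in> carrier F" using n(1) N.subset by blast
    have "y = x \<otimes>\<^bsub>F\<^esub> (inv\<^bsub>F\<^esub> x \<otimes>\<^bsub>F\<^esub> n \<otimes>\<^bsub>F\<^esub> x)"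
      using n(2) xy(1) nF by (simp add: F.m_assoc F.mult_inv_cancel)
    moreover have "inv\<^bsub>F\<^esub> x \<otimes>\<^bsub>F\<^esub> n \<otimes>\<^bsub>F\<^esub> x \<in> N" using N.inv_op_closed1[OF xy(1) n(1)] .
    ultimately show ?thesis using f xy(1) by (auto simp: invariant_pol_def)
  qed
  have pol: "f \<in> pol_fun F n \<Longrightarrow> (\<forall>x\<in>carrier F. \<forall>r\<in>N. f (x \<otimes>\<^bsub>F\<^esub> r) = f x) \<Longrightarrow> (\<lambda>g. f (rep g)) \<in> pol_fun G n"
    for f :: "'f \<Rightarrow> 'k" and n
  proof (induction n arbitrary: f)
    case 0
    then show ?case using rep by simp
  next
    case (Suc n)
    have "(\<lambda>g. f (rep (g \<otimes>\<^bsub>G\<^esub> a)) - f (rep g)) \<in> pol_fun G n" if a: "a \<in> carrier G" for a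
    proof -
      let ?d = "\<lambda>x. f (x \<otimes>\<^bsub>F\<^esub> rep a) - f x"
      have ra: "rep a \<in> carrier F" using rep[OF a] by simp
      have "?d (x \<otimes>\<^bsub>F\<^esub> r) = ?d x" if x: "x \<in> carrier F" and r: "r \<in> N" for x r
      proof -
        have rF: "r \<in> carrier F" using r N.subset by blast
        have "x \<otimes>\<^bsub>F\<^esub> r \<otimes>\<^bsub>F\<^esub> rep a = x \<otimes>\<^bsub>F\<^esub> rep a \<otimes>\<^bsub>F\<^esub> (inv\<^bsub>F\<^esub> rep a \<otimes>\<^bsub>F\<^esub> r \<otimes>\<^bsub>F\<^esub> rep a)"
          using x rF ra by (simp add: F.m_assoc F.mult_inv_cancel)
        then show ?thesis
          using Suc.prems(2) N.inv_op_closed1[OF ra r] x ra r by simp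
      qed
      then have "(\<lambda>g. ?d (rep g)) \<in> pol_fun G n"
        using Suc.IH[OF F.pol_fun_difference[OF Suc.prems(1) ra]] by simp
      then show ?thesis
      proof (rule G.pol_fun_cong)
        fix g assume g: "g \<in> carrier G"
        have "N #>\<^bsub>F\<^esub> rep (g \<otimes>\<^bsub>G\<^esub> a) = h g \<otimes>\<^bsub>F Mod N\<^esub> h a"
          using rep[of "g \<otimes>\<^bsub>G\<^esub> a"] g a by simp
        also have "\<dots> = N #>\<^bsub>F\<^esub> (rep g \<otimes>\<^bsub>F\<^esub> rep a)"
          using rep[OF g] rep[OF a] N.rcos_sum by (simp add: FactGroup_def)
        finally have "f (rep (g \<otimes>\<^bsub>G\<^esub> a)) = f (rep g \<otimes>\<^bsub>F\<^esub> rep a)"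
          using same[of f "rep g \<otimes>\<^bsub>F\<^esub> rep a" "rep (g \<otimes>\<^bsub>G\<^esub> a)"] Suc.prems rep[OF g] rep[OF a] rep[of "g \<otimes>\<^bsub>G\<^esub> a"] g a
          by (auto simp: invariant_pol_def simp del: pol_fun.simps)
        then show "?d (rep g) = f (rep (g \<otimes>\<^bsub>G\<^esub> a)) - f (rep g)" by simp
      qed
    qed
    then show ?case by simp
  qed
  have N_iff: "N #>\<^bsub>F\<^esub> x = N \<longleftrightarrow> x \<in> N" if "x \<in> carrier F" for x
    using F.coset_join1[OF _ that N.subgroup_axioms] F.coset_join2[OF that N.subgroup_axioms] by blast
  show ?thesis
    unfolding pol_separated_def
  proof (intro ballI impI)
    fix g assume g: "g \<in> carrier G" "g \<noteq> \<one>\<^bsub>G\<^esub>"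
    have "h g \<noteq> N"
      using inj g h.hom_one G.one_closed unfolding inj_on_def by (metis one_FactGroup)
    then have "rep g \<notin> N" using rep[OF g(1)] N_iff by simp
    then obtain f :: "'f \<Rightarrow> 'k" where f: "f \<in> invariant_pol F N" "f (rep g) \<noteq> f \<one>\<^bsub>F\<^esub>"
      using sep rep[OF g(1)] unfolding pol_separated_mod_def by blast
    obtain n where "f \<in> pol_fun F n" using f(1) by (auto simp: invariant_pol_def)
    then have "(\<lambda>g. f (rep g)) \<in> pol_fun G n" using pol f(1) by (simp add: invariant_pol_def)
    moreover have "f (rep \<one>\<^bsub>G\<^esub>) = f \<one>\<^bsub>F\<^esub>"
      using same[OF f(1), of "\<one>\<^bsub>F\<^esub>" "rep \<one>\<^bsub>G\<^esub>"] rep[OF G.one_closed] h.hom_one N_iff[of "\<one>\<^bsub>F\<^esub>"] N.one_closed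
      by simp
    ultimately show "\<exists>n. \<exists>f :: 'g \<Rightarrow> 'k. f \<in> pol_fun G n \<and> f g \<noteq> f \<one>\<^bsub>G\<^esub>"
      using f(2) by (intro exI[of _ n] exI[of _ "\<lambda>g. f (rep g)"]) simp
  qed
qed

section \<open>Free groups\<close>

text \<open>
  The constant term of \<open>m h\<close> is 1, so multiplication by it changes the coefficient at \<open>bs\<close> by
  a combination of coefficients at shorter words.
\<close>

lemma (in series_hom) pol_fun_ncoeff:
  assumes H: "H = carrier G"
  shows "(\<lambda>w. ncoeff (m w) bs) \<in> pol_fun G (Suc (length bs))"
proof (induction "length bs" arbitrary: bs rule: less_induct)
  case less
  have "(\<lambda>w. ncoeff (m (w \<otimes> h)) bs - ncoeff (m w) bs) \<in> pol_fun G (length bs)" if h: "h \<in> carrier G" for h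
  proof -
    have "(\<lambda>w. \<Sum>k<length bs. ncoeff (m h) (drop k bs) * ncoeff (m w) (take k bs)) \<in> pol_fun G (length bs)"
    proof (intro pol_fun_sum pol_fun_scale)
      fix k assume k: "k \<in> {..<length bs}"
      then have "(\<lambda>w. ncoeff (m w) (take k bs)) \<in> pol_fun G (Suc k)"
        using less[of "take k bs"] by (simp del: pol_fun.simps)
      then show "(\<lambda>w. ncoeff (m w) (take k bs)) \<in> pol_fun G (length bs)"
        using k by (intro pol_fun_mono[of "Suc k" "length bs"]) (simp_all del: pol_fun.simps)
    qed
    then show ?thesis
    proof (rule pol_fun_cong)
      fix w assume w: "w \<in> carrier G"
      have "ncoeff (m (w \<otimes> h)) bs = (\<Sum>k\<le>length bs. ncoeff (m w) (take k bs) * ncoeff (m h) (drop k bs))"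
        using w h H by (simp add: m_mult ncoeff_mult)
      then show "(\<Sum>k<length bs. ncoeff (m h) (drop k bs) * ncoeff (m w) (take k bs)) = ncoeff (m (w \<otimes> h)) bs - ncoeff (m w) bs"
        using m_Nil[of h] h H by (simp add: lessThan_Suc_atMost[symmetric] mult.commute)
    qed
  qed
  then show ?case by simp
qed

text \<open>
  The words without equal neighbours. If only coefficients at such words are looked at, a
  power \<open>(1 + x)^k\<close> with positive or negative \<open>k\<close> acts like \<open>1 + k x\<close>.
\<close>

definition alternating :: "'x list \<Rightarrow> bool" where
  "alternating = successively (\<noteq>)"

text \<open>
  For a reduced word \<open>x1^e1 ... xs^es\<close>, with neighbouring \<open>xi\<close> distinct and all \<open>ei\<close> nonzero,
  the coefficient at the alternating word \<open>x1 ... xs\<close> is \<open>e1 * ... * es\<close>. The induction runs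
  over single letters: \<open>x\<close> is the current base, \<open>k\<close> the absolute value of its exponent so far,
  \<open>c\<close> the product of the exponents of the later syllables. The vanishing of the coefficients
  at other long alternating words keeps these numbers undisturbed.
\<close>

lemma magnus_nonzero:
  fixes M :: "(bool \<times> 'x) list \<Rightarrow> ('x, 'k::{idom,ring_char_0}) nc_series"
  assumes M_Nil: "M [] = 1" and pos: "\<And>x w. M ((True, x) # w) = (1 + letter x) * M w"
    and neg: "\<And>x w. (1 + letter x) * M ((False, x) # w) = M w"
  shows "reduced_word ((b, x) # w) \<Longrightarrow>
    \<exists>v c. alternating (x # v) \<and> c \<noteq> 0 \<and> ncoeff (M ((b, x) # w)) v = c \<and>
      (\<exists>k>0. ncoeff (M ((b, x) # w)) (x # v) = (if b then of_nat k else - of_nat k) * c) \<and>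
      (\<forall>u. alternating u \<longrightarrow> length u > Suc (length v) \<or> length u = Suc (length v) \<and> hd u \<noteq> x \<longrightarrow>
        ncoeff (M ((b, x) # w)) u = 0)"
proof (induction w arbitrary: b x)
  have letter_Cons: "ncoeff (letter x * s) (y # v) = (if y = x then ncoeff s v else 0)" for x y v and s :: "('x, 'k) nc_series"
  proof -
    have "convolve v (\<lambda>u. ncoeff (letter x) (y # u)) (ncoeff s) =
        convolve v (\<lambda>u. (if y = x then 1 else 0) * (if u = [] then 1 else 0)) (ncoeff s)"
      by (rule arg_cong[where f = "\<lambda>f. convolve v f (ncoeff s)"]) (auto simp: letter_def)
    then show ?thesis
      unfolding convolve_scale_left convolve_one_left by (simp add: times_nc_series_def letter_def)
  qed
  have letter_Nil: "ncoeff (letter x * s) [] = 0" for x and s :: "('x, 'k) nc_series"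
    by (simp add: ncoeff_mult_Nil letter_def)
  have other: "ncoeff (M ((b, x) # w)) v = ncoeff (M w) v" if "v = [] \<or> hd v \<noteq> x" for b x w v
  proof (cases b)
    case True
    then show ?thesis using that letter_Nil letter_Cons by (cases v) (auto simp: pos distrib_right)
  next
    case False
    then show ?thesis using that letter_Nil letter_Cons arg_cong[OF neg[of x w], of "\<lambda>s. ncoeff s v"]
      by (cases v) (auto simp: distrib_right)
  qed
  have same: "ncoeff (M ((b, x) # w)) (x # v) = ncoeff (M w) (x # v) + (if b then 1 else - 1) * ncoeff (M w) v"
    if "v = [] \<or> hd v \<noteq> x" for b x w v
  proof (cases b)
    case True
    then show ?thesis using letter_Cons by (simp add: pos distrib_right)
  next
    case False
    then show ?thesis using letter_Cons[of x "M ((False, x) # w)" x v] other[OF that, of False w]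
        arg_cong[OF neg[of x w], of "\<lambda>s. ncoeff s (x # v)"]
      by (simp add: distrib_right eq_diff_eq)
  qed
  have alt: "v = [] \<or> hd v \<noteq> x" if "alternating (x # v)" for x :: 'x and v
    using that by (cases v) (auto simp: alternating_def)
  have alt_tl: "alternating v" if "alternating (x # v)" for x :: 'x and v
    using that by (cases v) (auto simp: alternating_def)
  {
    case Nil
    show ?case
    proof (intro exI[of _ "[]"] exI[of _ 1] conjI allI impI)
      fix u :: "'x list" assume "alternating u" and u: "length u > Suc (length []) \<or> length u = Suc (length []) \<and> hd u \<noteq> x"
      then obtain y u' where y: "u = y # u'" by (cases u) auto
      show "ncoeff (M [(b, x)]) u = 0"
      proof (cases "y = x")
        case True
        then have "u' \<noteq> []" using u y by auto
        then show ?thesis using same[of u' x b "[]"] alt[of x u'] \<open>alternating u\<close> y True by (simp add: M_Nil)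
      next
        case False
        then show ?thesis using other[of u x b "[]"] y by (simp add: M_Nil)
      qed
    qed (use same[of "[]" x b "[]"] other[of "[]" x b "[]"] in \<open>auto simp: M_Nil alternating_def\<close>)
  next
    case (Cons p w)
    obtain b' x' where p: "p = (b', x')" by (cases p)
    have red: "reduced_word ((b', x') # w)" and bx: "\<not> (x = x' \<and> b \<noteq> b')"
      using Cons.prems by (auto simp: reduced_word_def p successively_Cons)
    obtain v c k where v: "alternating (x' # v)" "c \<noteq> 0" "ncoeff (M ((b', x') # w)) v = c" "k > 0"
      "ncoeff (M ((b', x') # w)) (x' # v) = (if b' then of_nat k else - of_nat k) * c"
      "\<And>u. alternating u \<Longrightarrow> length u > Suc (length v) \<or> length u = Suc (length v) \<and> hd u \<noteq> x' \<Longrightarrow>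
        ncoeff (M ((b', x') # w)) u = 0"
      using Cons.IH[OF red] by blast
    let ?W = "(b', x') # w"
    show ?case
    proof (cases "x = x'")
      case True
      then have b: "b = b'" using bx by auto
      show ?thesis unfolding p
      proof (intro exI[of _ v] exI[of _ c] conjI allI impI)
        show "alternating (x # v)" "c \<noteq> 0" using v True by auto
        show "ncoeff (M ((b, x) # ?W)) v = c" using other[OF alt[OF v(1)], of b ?W] v(3) True by simp
        have "ncoeff (M ((b, x) # ?W)) (x # v) = (if b then of_nat (Suc k) else - of_nat (Suc k)) * c"
          using same[OF alt[OF v(1)], of b ?W] v(3,5) True b by (simp add: algebra_simps)
        then show "\<exists>k>0. ncoeff (M ((b, x) # ?W)) (x # v) = (if b then of_nat k else - of_nat k) * c"
          by (intro exI[of _ "Suc k"]) simp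
        fix u assume u: "alternating u" "length u > Suc (length v) \<or> length u = Suc (length v) \<and> hd u \<noteq> x"
        then obtain y u' where y: "u = y # u'" by (cases u) auto
        show "ncoeff (M ((b, x) # ?W)) u = 0"
        proof (cases "y = x")
          case True
          then have alt': "u' = [] \<or> hd u' \<noteq> x" "alternating u'" using alt alt_tl u(1) y by auto
          have "length u' > Suc (length v) \<or> length u' = Suc (length v) \<and> hd u' \<noteq> x'"
            using u(2) y True alt' \<open>x = x'\<close> by (cases "u' = []") auto
          then have "ncoeff (M ?W) u' = 0" using v(6) alt'(2) by blast
          moreover have "ncoeff (M ?W) u = 0" using v(6)[OF u(1)] u(2) \<open>x = x'\<close> by auto
          ultimately show ?thesis using same[OF alt'(1), of b ?W] y True by simp
        next
          case False
          then show ?thesis using other[of u x b ?W] y v(6)[OF u(1)] u(2) \<open>x = x'\<close> by auto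
        qed
      qed
    next
      case False
      let ?v = "x' # v" and ?c = "(if b' then of_nat k else - of_nat k) * c"
      show ?thesis unfolding p
      proof (intro exI[of _ ?v] exI[of _ ?c] conjI allI impI)
        show "alternating (x # ?v)" using v(1) False by (simp add: alternating_def)
        show "?c \<noteq> 0" using v(2,4) by simp
        show vc: "ncoeff (M ((b, x) # ?W)) ?v = ?c" using other[of ?v x b ?W] v(5) False by simp
        have "ncoeff (M ?W) (x # ?v) = 0" using v(6)[of "x # ?v"] v(1) False by (simp add: alternating_def)
        then have "ncoeff (M ((b, x) # ?W)) (x # ?v) = (if b then of_nat 1 else - of_nat 1) * ?c"
          using same[of ?v x b ?W] v(5) False by simp
        then show "\<exists>k>0. ncoeff (M ((b, x) # ?W)) (x # ?v) = (if b then of_nat k else - of_nat k) * ?c"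
          by (intro exI[of _ 1]) simp
        fix u assume u: "alternating u" "length u > Suc (length ?v) \<or> length u = Suc (length ?v) \<and> hd u \<noteq> x"
        then obtain y u' where y: "u = y # u'" by (cases u) auto
        show "ncoeff (M ((b, x) # ?W)) u = 0"
        proof (cases "y = x")
          case True
          then have "ncoeff (M ?W) u' = 0" "ncoeff (M ?W) u = 0"
            using v(6)[of u'] v(6)[of u] alt_tl[of y u'] u y by auto
          then show ?thesis using same[of u' x b ?W] alt[of x u'] u(1) y True by simp
        next
          case False
          then show ?thesis using other[of u x b ?W] y v(6)[OF u(1)] u(2) by auto
        qed
      qed
    qed
  }
qed

lemma letter_eq_linear_series: "letter x = linear_series (\<lambda>i. if i = x then 1 else 0)"
  by (rule nc_series_eqI) (auto simp: letter_def linear_series_def split: list.split)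

lemma generate_word_value:
  assumes F: "group F" and X: "X \<subseteq> carrier F" and g: "g \<in> generate F X"
  shows "\<exists>w. snd ` set w \<subseteq> X \<and> word_value F (\<lambda>x. x) w = g"
  using g
proof induction
  interpret F: group F by fact
  case one
  show ?case by (intro exI[of _ "[]"]) simp
next
  interpret F: group F by fact
  case (incl x)
  then show ?case using X by (intro exI[of _ "[(True, x)]"]) auto
next
  interpret F: group F by fact
  case (inv x)
  then show ?case using X by (intro exI[of _ "[(False, x)]"]) auto
next
  case (eng x y)
  then obtain v w where vw: "snd ` set v \<subseteq> X" "word_value F (\<lambda>x. x) v = x"
    "snd ` set w \<subseteq> X" "word_value F (\<lambda>x. x) w = y" by blast
  have "(\<lambda>x. x) \<in> X \<rightarrow> carrier F" using X by auto
  from word_value_append[OF F this vw(1,3)] show ?case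
    using vw by (intro exI[of _ "v @ w"]) (simp add: image_Un)
qed

theorem free_group_pol_separated:
  fixes F :: "('f, 'm) monoid_scheme"
  assumes F: "group F" and X: "free_basis F X"
  shows "pol_separated TYPE('k::field_char_0) F"
proof -
  interpret F: group F by fact
  let ?S = "series_units :: ('f, 'k) nc_series monoid"
  interpret S: group ?S by (rule group_series_units)
  have XF: "X \<subseteq> carrier F" and gen: "generate F X = carrier F" using X by (auto simp: free_basis_def)
  have unit: "1 + letter x \<in> carrier ?S" for x by (simp add: letter_eq_linear_series one_plus_linear_unit)
  have "(\<lambda>x. 1 + letter x) \<in> X \<rightarrow> carrier ?S" using unit by simp
  from free_basis_universal[OF F X S.group_axioms this]
  obtain m where m: "m \<in> hom F ?S" "\<forall>x\<in>X. m x = 1 + letter x" by blast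
  interpret m: group_hom F ?S m by (intro group_hom.intro group_hom_axioms.intro F S.group_axioms m)
  have m_Nil: "ncoeff (m g) [] = 1" if "g \<in> generate F X" for g
    using that
  proof induction
    case one
    then show ?case using m.hom_one by (simp add: series_units_def)
  next
    case (incl x)
    then show ?case using m(2) by (simp add: letter_def)
  next
    case (inv x)
    have "m (inv\<^bsub>F\<^esub> x) \<otimes>\<^bsub>?S\<^esub> m x = \<one>\<^bsub>?S\<^esub>" using m.hom_mult[of "inv\<^bsub>F\<^esub> x" x] m.hom_one inv XF by auto
    then have "ncoeff (m (inv\<^bsub>F\<^esub> x) * m x) [] = ncoeff 1 []" by (simp add: series_units_def)
    then show ?case using m(2) inv by (simp add: ncoeff_mult_Nil letter_def)
  next
    case (eng x y)
    then show ?case using m.hom_mult[of x y] gen by (simp add: series_units_def ncoeff_mult_Nil)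
  qed
  interpret s: series_hom F "carrier F" m
  proof (intro series_hom.intro series_hom_axioms.intro F F.subgroup_self)
    show "m (x \<otimes>\<^bsub>F\<^esub> y) = m x * m y" if "x \<in> carrier F" "y \<in> carrier F" for x y
      using m.hom_mult[OF that] by (simp add: series_units_def)
    show "m \<one>\<^bsub>F\<^esub> = 1" using m.hom_one by (simp add: series_units_def)
  qed (use m_Nil gen in simp)
  let ?M = "word_value ?S (\<lambda>x. 1 + letter x)"
  have m_word: "snd ` set w \<subseteq> X \<Longrightarrow> word_value F (\<lambda>x. x) w \<in> carrier F \<and> m (word_value F (\<lambda>x. x) w) = ?M w" for w
  proof (induction w)
    case Nil
    then show ?case using m.hom_one by simp
  next
    case (Cons p w)
    then have "snd p \<in> carrier F" "m (snd p) = 1 + letter (snd p)" using XF m(2) by auto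
    then show ?case using Cons by auto
  qed
  show ?thesis
    unfolding pol_separated_def
  proof (intro ballI impI)
    fix g assume g: "g \<in> carrier F" "g \<noteq> \<one>\<^bsub>F\<^esub>"
    obtain w0 where w0: "snd ` set w0 \<subseteq> X" "word_value F (\<lambda>x. x) w0 = g"
      using generate_word_value[OF F XF] g(1) gen by blast
    define w where "w = reduce_word w0"
    have XF': "(\<lambda>x. x) \<in> X \<rightarrow> carrier F" using XF by auto
    have w: "snd ` set w \<subseteq> X" "word_value F (\<lambda>x. x) w = g" "reduced_word w"
      using word_value_reduce_word[OF F XF' w0(1)] snd_reduce_word[of w0] reduced_reduce_word[of w0] w0
      by (auto simp: w_def)
    then obtain b x w' where bx: "w = (b, x) # w'" using g(2) by (cases w) auto
    have Mcl: "?M v \<in> carrier ?S" for v :: "(bool \<times> 'f) list"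
      by (rule word_value_closed[of _ _ UNIV]) (use unit S.group_axioms in auto)
    have pos: "?M ((True, x) # v) = (1 + letter x) * ?M v" for x v by (simp add: series_units_def)
    have neg: "(1 + letter x) * ?M ((False, x) # v) = ?M v" for x v
    proof -
      have "(1 + letter x) \<otimes>\<^bsub>?S\<^esub> (inv\<^bsub>?S\<^esub> (1 + letter x) \<otimes>\<^bsub>?S\<^esub> ?M v) = ?M v"
        by (rule S.mult_inv_cancel(1)[OF unit Mcl])
      then show ?thesis by (simp add: series_units_def)
    qed
    have M_Nil: "?M [] = 1" by (simp add: series_units_def)
    from magnus_nonzero[of ?M, OF M_Nil pos neg w(3)[unfolded bx]]
    obtain v c k where v: "(c::'k) \<noteq> 0" "k > 0"
      "ncoeff (?M ((b, x) # w')) (x # v) = (if b then of_nat k else - of_nat k) * c" by blast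
    then have "ncoeff (m g) (x # v) \<noteq> 0" using m_word[OF w(1)] w(2) bx by auto
    moreover have "ncoeff (m \<one>\<^bsub>F\<^esub>) (x # v) = 0" unfolding s.m_one by simp
    ultimately show "\<exists>n. \<exists>f :: 'f \<Rightarrow> 'k. f \<in> pol_fun F n \<and> f g \<noteq> f \<one>\<^bsub>F\<^esub>"
      using s.pol_fun_ncoeff[of "x # v"] by (intro exI[of _ "Suc (length (x # v))"] exI[of _ "\<lambda>w. ncoeff (m w) (x # v)"]) (simp del: pol_fun.simps)
  qed
qed

section \<open>Faithfulness over integral domains of characteristic zero\<close>

theorem free_polynilpotent_faithful:
  fixes F :: "'f monoid" and G :: "'g monoid"
  assumes F: "free_group F" and G: "group G" and iso: "G \<cong> F Mod polynilpotent_subgroup F cs"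
  shows "faithful_over TYPE('r::{idom,ring_char_0}) G"
proof -
  obtain X where X: "free_basis F X" and gF: "group F" using F by (auto simp: free_group_def)
  interpret F: group F by fact
  have "pol_separated_mod TYPE('r fract) F (carrier F)" by (simp add: pol_separated_mod_def)
  then have "polynilpotent_subgroup F cs \<lhd> F \<and> pol_separated_mod TYPE('r fract) F (polynilpotent_subgroup F cs)"
    by (intro pol_separated_mod_polynilpotent[OF gF X F.subgroup_self _ _ polynilpotent_subgroup_def]) auto
  then show ?thesis
    using pol_separated_quotient[OF gF G _ iso] by (intro faithful_over_if_pol_separated[OF G]) blast
qed

lemma derived_eq_lower_central: "derived F H = lower_central F H (Suc 0)"
  unfolding derived_def lower_central.simps
  by (rule arg_cong[where f = "generate F"]) (auto simp: commutator_def)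

lemma derived_series_eq_polynilpotent:
  "(derived F ^^ d) (carrier F) = polynilpotent_subgroup F (replicate d (Suc 0))"
proof -
  have eq: "derived F = (\<lambda>H. lower_central F H (Suc 0))"
    by (rule ext) (rule derived_eq_lower_central)
  show ?thesis unfolding polynilpotent_subgroup_def fold_replicate eq ..
qed


theorem theorem3:
  shows
    "(\<forall>G :: 'g monoid.
        group G \<and> residually_torsion_free_nilpotent G
          \<longrightarrow> faithful_over TYPE('r::{idom,ring_char_0}) G) \<and>
     (\<forall>G :: 'g monoid.
        free_group G \<longrightarrow> faithful_over TYPE('r) G) \<and>
     (\<forall>(F :: 'f monoid) (G :: 'g monoid) d.
        free_group F \<and> d \<ge> 1 \<and> group G \<and> G \<cong> F Mod (derived F ^^ d) (carrier F)
          \<longrightarrow> faithful_over TYPE('r) G) \<and>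
     (\<forall>(F :: 'f monoid) (G :: 'g monoid) cs.
        free_group F \<and> cs \<noteq> [] \<and> (\<forall>c\<in>set cs. c \<ge> 1) \<and>
        group G \<and> G \<cong> F Mod polynilpotent_subgroup F cs
          \<longrightarrow> faithful_over TYPE('r) G)"
proof (intro conjI allI impI; (elim conjE)?)
  fix G :: "'g monoid"
  assume "group G" "residually_torsion_free_nilpotent G"
  then show "faithful_over TYPE('r) G" by (rule faithful_over_if_residually_torsion_free_nilpotent)
next
  fix G :: "'g monoid"
  assume "free_group G"
  then obtain X where "group G" "free_basis G X" by (auto simp: free_group_def)
  then show "faithful_over TYPE('r) G"
    by (intro faithful_over_if_pol_separated free_group_pol_separated)
next
  fix F :: "'f monoid" and G :: "'g monoid" and d :: nat
  assume "free_group F" "group G" "G \<cong> F Mod (derived F ^^ d) (carrier F)"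
  then show "faithful_over TYPE('r) G"
    unfolding derived_series_eq_polynilpotent by (rule free_polynilpotent_faithful)
next
  fix F :: "'f monoid" and G :: "'g monoid" and cs :: "nat list"
  assume "free_group F" "group G" "G \<cong> F Mod polynilpotent_subgroup F cs"
  then show "faithful_over TYPE('r) G" by (rule free_polynilpotent_faithful)
qed

end
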